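(* Let $G=(V,E)$ be a finite graph. Then the consistent sequence $\{\mathbb{C}[\underline{\chi}(G,[n])],\phi_n\}_{n\ge1}$ of $\mathfrak{S}_n$-representations is representation stable with stable range $n\geq 2\#V$.
   Context: Graphs are simple undirected graphs. $[n]=\{1,\dots,n\}$. $\underline{\chi}(G,[n])=\{c:V\to[n]\mid c(v)\neq c(u)\text{ whenever }\{v,u\}\in E\}$ is the set of regular $n$-colorings, and $\mathbb{C}[\underline{\chi}(G,[n])]$ is the complex vector space with basis this set, an $\mathfrak{S}_n$-representation via $\sigma\cdot c=\sigma\circ c$. The map $\phi_n:\mathbb{C}[\underline{\chi}(G,[n])]\to\mathbb{C}[\underline{\chi}(G,[n+1])]$ is the linear map sending a basis element $c$ to $\iota_n\circ c$, where $\iota_n:[n]\hookrightarrow[n+1]$ is the inclusion. A sequence $\{V_n,\phi_n\}$ of finite-dimensional complex $\mathfrak{S}_n$-representations with linear maps $\phi_n:V_n\to V_{n+1}$ is consistent if $\phi_n\circ\sigma=\sigma\circ\phi_n$ for all $\sigma\in\mathfrak{S}_n$ (viewed in $\mathfrak{S}_{n+1}$ via the standard inclusion). For a partition $\lambda=(\lambda_1,\dots,\lambda_l)\vdash m$ and $n\ge m+\lambda_1$, put $\lambda[n]=(n-m,\lambda_1,\dots,\lambda_l)\vdash n$ and let $V(\lambda)_n$ be the irreducible $\mathfrak{S}_n$-representation indexed by $\lambda[n]$. A consistent sequence is representation stable with stable range $n\ge N$ if for all $n\ge N$: (injectivity) $\phi_n$ is injective; (orbit-surjectivity) the $\mathfrak{S}_{n+1}$-span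 of $\phi_n(V_n)$ is $V_{n+1}$; (multiplicity stability) writing $V_n=\bigoplus_\lambda V(\lambda)_n^{\oplus c_n(\lambda)}$, each multiplicity $c_n(\lambda)$ is finite and independent of $n$. *)

theory Defs
  imports
    Complex_Main
    "HOL-Library.FuncSet"
    "HOL-Library.Function_Algebras"
    "HOL-Combinatorics.Permutations"
begin

section \<open>Representations of the symmetric groups\<close>

text \<open>
  Complex vector spaces are subspaces of an ambient type \<open>'b\<close> that carries a scalar
  multiplication \<open>s\<close> in the sense of the library locale \<open>vector_space\<close>.  Elements of the
  symmetric group on \<open>{1..n}\<close> are the functions \<open>\<sigma>\<close> with \<open>\<sigma> permutes {1..n}\<close>; as such a \<open>\<sigma>\<close>
  fixes everything outside \<open>{1..n}\<close>, the standard inclusion of the \<open>n\<close>-th symmetric group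
  into the next one is the identity on functions.
\<close>

definition linear_on ::
  "(complex \<Rightarrow> 'b::ab_group_add \<Rightarrow> 'b) \<Rightarrow> (complex \<Rightarrow> 'c::ab_group_add \<Rightarrow> 'c) \<Rightarrow>
   'b set \<Rightarrow> 'c set \<Rightarrow> ('b \<Rightarrow> 'c) \<Rightarrow> bool" where
  "linear_on s1 s2 V W f \<longleftrightarrow>
     f \<in> V \<rightarrow> W \<and>
     (\<forall>x\<in>V. \<forall>y\<in>V. f (x + y) = f x + f y) \<and>
     (\<forall>a. \<forall>x\<in>V. f (s1 a x) = s2 a (f x))"

definition sym_rep ::
  "(complex \<Rightarrow> 'b::ab_group_add \<Rightarrow> 'b) \<Rightarrow> nat \<Rightarrow> 'b set \<Rightarrow> ((nat \<Rightarrow> nat) \<Rightarrow> 'b \<Rightarrow> 'b) \<Rightarrow> bool" where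
  "sym_rep s n V \<rho> \<longleftrightarrow>
     vector_space s \<and>
     module.subspace s V \<and>
     (\<exists>B. finite B \<and> V = module.span s B) \<and>
     (\<forall>\<sigma>. \<sigma> permutes {1..n} \<longrightarrow> linear_on s s V V (\<rho> \<sigma>)) \<and>
     (\<forall>v\<in>V. \<rho> id v = v) \<and>
     (\<forall>\<sigma> \<tau>. \<sigma> permutes {1..n} \<longrightarrow> \<tau> permutes {1..n} \<longrightarrow>
        (\<forall>v\<in>V. \<rho> (\<sigma> \<circ> \<tau>) v = \<rho> \<sigma> (\<rho> \<tau> v)))"

definition rep_iso ::
  "(complex \<Rightarrow> 'b::ab_group_add \<Rightarrow> 'b) \<Rightarrow> (complex \<Rightarrow> 'c::ab_group_add \<Rightarrow> 'c) \<Rightarrow> nat \<Rightarrow>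
   'b set \<Rightarrow> ((nat \<Rightarrow> nat) \<Rightarrow> 'b \<Rightarrow> 'b) \<Rightarrow> 'c set \<Rightarrow> ((nat \<Rightarrow> nat) \<Rightarrow> 'c \<Rightarrow> 'c) \<Rightarrow> bool" where
  "rep_iso s1 s2 n V \<rho> W \<tau> \<longleftrightarrow>
     (\<exists>f. linear_on s1 s2 V W f \<and> bij_betw f V W \<and>
          (\<forall>\<sigma>. \<sigma> permutes {1..n} \<longrightarrow> (\<forall>v\<in>V. f (\<rho> \<sigma> v) = \<tau> \<sigma> (f v))))"

definition internal_direct_sum :: "'b::ab_group_add set \<Rightarrow> 'i set \<Rightarrow> ('i \<Rightarrow> 'b set) \<Rightarrow> bool" where
  "internal_direct_sum V I W \<longleftrightarrow>
     finite I \<and> bij_betw (\<lambda>w. \<Sum>k\<in>I. w k) (\<Pi>\<^sub>E k\<in>I. W k) V"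


section \<open>Free vector spaces\<close>

definition fscale :: "complex \<Rightarrow> ('a \<Rightarrow> complex) \<Rightarrow> 'a \<Rightarrow> complex" where
  "fscale a f = (\<lambda>x. a * f x)"

lemma vector_space_fscale: "vector_space fscale"
  by unfold_locales (auto simp: fscale_def fun_eq_iff algebra_simps)

definition delta :: "'a \<Rightarrow> 'a \<Rightarrow> complex" where
  "delta x = (\<lambda>y. if y = x then 1 else 0)"

definition free_space :: "'a set \<Rightarrow> ('a \<Rightarrow> complex) set" where
  "free_space X = module.span fscale (delta ` X)"

text \<open>For finite \<open>X\<close>, the linear map on \<open>free_space X\<close> that sends \<open>delta x\<close> to \<open>delta (g x)\<close>.\<close>

definition lin_ext :: "'a set \<Rightarrow> ('a \<Rightarrow> 'b) \<Rightarrow> ('a \<Rightarrow> complex) \<Rightarrow> 'b \<Rightarrow> complex" where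
  "lin_ext X g f = (\<Sum>x\<in>X. fscale (f x) (delta (g x)))"


section \<open>Irreducible representations of the symmetric groups\<close>

text \<open>Partitions are weakly decreasing lists of positive parts; rows and columns of Young
  diagrams are numbered from \<open>0\<close>.\<close>

definition partition_of :: "nat \<Rightarrow> nat list \<Rightarrow> bool" where
  "partition_of m \<mu> \<longleftrightarrow> sorted_wrt (\<ge>) \<mu> \<and> 0 \<notin> set \<mu> \<and> sum_list \<mu> = m"

definition diagram :: "nat list \<Rightarrow> (nat \<times> nat) set" where
  "diagram \<mu> = {(i, j). i < length \<mu> \<and> j < \<mu> ! i}"

definition tableaux :: "nat list \<Rightarrow> (nat \<times> nat \<Rightarrow> nat) set" where
  "tableaux \<mu> = {t. bij_betw t (diagram \<mu>) {1..sum_list \<mu>}}"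

text \<open>A tabloid, i.e. a tableau up to row equivalence, is recorded by the sets of entries of
  its rows.\<close>

definition tabloid :: "nat list \<Rightarrow> (nat \<times> nat \<Rightarrow> nat) \<Rightarrow> nat \<Rightarrow> nat set" where
  "tabloid \<mu> t = (\<lambda>i. {t (i, j) |j. (i, j) \<in> diagram \<mu>})"

definition column_stabilizer :: "nat list \<Rightarrow> (nat \<times> nat \<Rightarrow> nat) \<Rightarrow> (nat \<Rightarrow> nat) set" where
  "column_stabilizer \<mu> t =
     {\<pi>. \<pi> permutes {1..sum_list \<mu>} \<and>
         (\<forall>i j. (i, j) \<in> diagram \<mu> \<longrightarrow> (\<exists>i'. (i', j) \<in> diagram \<mu> \<and> \<pi> (t (i, j)) = t (i', j)))}"

definition polytabloid :: "nat list \<Rightarrow> (nat \<times> nat \<Rightarrow> nat) \<Rightarrow> (nat \<Rightarrow> nat set) \<Rightarrow> complex" where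
  "polytabloid \<mu> t =
     (\<Sum>\<pi>\<in>column_stabilizer \<mu> t. fscale (of_int (sign \<pi>)) (delta (tabloid \<mu> (\<pi> \<circ> t))))"

text \<open>The irreducible representation indexed by \<open>\<mu>\<close> is realised as the Specht module inside
  the permutation module on tabloids (so \<open>[n]\<close> gives the trivial representation).\<close>

definition specht :: "nat list \<Rightarrow> ((nat \<Rightarrow> nat set) \<Rightarrow> complex) set" where
  "specht \<mu> = module.span fscale (polytabloid \<mu> ` tableaux \<mu>)"

definition specht_act ::
  "nat list \<Rightarrow> (nat \<Rightarrow> nat) \<Rightarrow> ((nat \<Rightarrow> nat set) \<Rightarrow> complex) \<Rightarrow> (nat \<Rightarrow> nat set) \<Rightarrow> complex" where
  "specht_act \<mu> \<sigma> = lin_ext (tabloid \<mu> ` tableaux \<mu>) (\<lambda>T i. \<sigma> ` T i)"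

definition padded :: "nat list \<Rightarrow> nat \<Rightarrow> nat list" where
  "padded \<nu> n = (n - sum_list \<nu>) # \<nu>"

text \<open>The partitions \<open>\<nu>\<close> of some \<open>m\<close> with \<open>n \<ge> m + \<nu>\<^sub>1\<close>, where \<open>\<nu>\<^sub>1 = 0\<close> for the empty partition;
  for \<open>n \<ge> 1\<close> these are the \<open>\<nu>\<close> for which \<open>padded \<nu> n\<close> is a partition of \<open>n\<close>.\<close>

definition paddable :: "nat \<Rightarrow> nat list set" where
  "paddable n = {\<nu>. \<exists>m. partition_of m \<nu> \<and> m + (case \<nu> of [] \<Rightarrow> 0 | a # _ \<Rightarrow> a) \<le> n}"


section \<open>Representation stability\<close>

text \<open>
  \<open>multiplicities s n V \<rho> c\<close>: \<open>V\<close> is the direct sum, over all \<open>\<nu>\<close>, of \<open>c \<nu>\<close> copies of the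
  irreducible representation indexed by \<open>padded \<nu> n\<close>.  The multiplicity of \<open>\<nu>\<close> is \<open>0\<close> when
  \<open>padded \<nu> n\<close> is not a partition.  Such a \<open>c\<close> is unique, so a \<open>c\<close> that serves several \<open>n\<close> at once
  says that the multiplicities agree for these \<open>n\<close>.
\<close>

definition multiplicities ::
  "(complex \<Rightarrow> 'b::ab_group_add \<Rightarrow> 'b) \<Rightarrow> nat \<Rightarrow> 'b set \<Rightarrow> ((nat \<Rightarrow> nat) \<Rightarrow> 'b \<Rightarrow> 'b) \<Rightarrow>
   (nat list \<Rightarrow> nat) \<Rightarrow> bool" where
  "multiplicities s n V \<rho> c \<longleftrightarrow>
     (\<forall>\<nu>. \<nu> \<notin> paddable n \<longrightarrow> c \<nu> = 0) \<and>
     (\<exists>W :: nat list \<times> nat \<Rightarrow> 'b set.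
        internal_direct_sum V {(\<nu>, i). i < c \<nu>} W \<and>
        (\<forall>\<nu> i. i < c \<nu> \<longrightarrow>
           sym_rep s n (W (\<nu>, i)) \<rho> \<and>
           rep_iso s fscale n (W (\<nu>, i)) \<rho> (specht (padded \<nu> n)) (specht_act (padded \<nu> n))))"

definition consistent_sequence ::
  "(complex \<Rightarrow> 'b::ab_group_add \<Rightarrow> 'b) \<Rightarrow> (nat \<Rightarrow> 'b set) \<Rightarrow>
   (nat \<Rightarrow> (nat \<Rightarrow> nat) \<Rightarrow> 'b \<Rightarrow> 'b) \<Rightarrow> (nat \<Rightarrow> 'b \<Rightarrow> 'b) \<Rightarrow> bool" where
  "consistent_sequence s V \<rho> \<phi> \<longleftrightarrow>
     (\<forall>n\<ge>1.
        sym_rep s n (V n) (\<rho> n) \<and>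
        linear_on s s (V n) (V (n + 1)) (\<phi> n) \<and>
        (\<forall>\<sigma>. \<sigma> permutes {1..n} \<longrightarrow> (\<forall>v\<in>V n. \<phi> n (\<rho> n \<sigma> v) = \<rho> (n + 1) \<sigma> (\<phi> n v))))"

definition representation_stable ::
  "(complex \<Rightarrow> 'b::ab_group_add \<Rightarrow> 'b) \<Rightarrow> (nat \<Rightarrow> 'b set) \<Rightarrow>
   (nat \<Rightarrow> (nat \<Rightarrow> nat) \<Rightarrow> 'b \<Rightarrow> 'b) \<Rightarrow> (nat \<Rightarrow> 'b \<Rightarrow> 'b) \<Rightarrow> nat \<Rightarrow> bool" where
  "representation_stable s V \<rho> \<phi> N \<longleftrightarrow>
     consistent_sequence s V \<rho> \<phi> \<and>
     (\<forall>n\<ge>1. n \<ge> N \<longrightarrow> inj_on (\<phi> n) (V n)) \<and>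
     (\<forall>n\<ge>1. n \<ge> N \<longrightarrow>
        module.span s {\<rho> (n + 1) \<sigma> (\<phi> n v) |\<sigma> v. \<sigma> permutes {1..n + 1} \<and> v \<in> V n} = V (n + 1)) \<and>
     (\<exists>c. \<forall>n\<ge>1. n \<ge> N \<longrightarrow> multiplicities s n (V n) (\<rho> n) c)"


section \<open>Graph colorings\<close>

definition simple_graph :: "'v set \<Rightarrow> 'v set set \<Rightarrow> bool" where
  "simple_graph V E \<longleftrightarrow> (\<forall>e\<in>E. e \<subseteq> V \<and> card e = 2)"

definition colorings :: "'v set \<Rightarrow> 'v set set \<Rightarrow> nat \<Rightarrow> ('v \<Rightarrow> nat) set" where
  "colorings V E n = {c \<in> V \<rightarrow>\<^sub>E {1..n}. \<forall>u v. {v, u} \<in> E \<longrightarrow> c v \<noteq> c u}"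

definition coloring_space :: "'v set \<Rightarrow> 'v set set \<Rightarrow> nat \<Rightarrow> (('v \<Rightarrow> nat) \<Rightarrow> complex) set" where
  "coloring_space V E n = free_space (colorings V E n)"

definition coloring_act ::
  "'v set \<Rightarrow> 'v set set \<Rightarrow> nat \<Rightarrow> (nat \<Rightarrow> nat) \<Rightarrow>
   (('v \<Rightarrow> nat) \<Rightarrow> complex) \<Rightarrow> ('v \<Rightarrow> nat) \<Rightarrow> complex" where
  "coloring_act V E n \<sigma> = lin_ext (colorings V E n) (\<lambda>c. compose V \<sigma> c)"

text \<open>The inclusion of \<open>{1..n}\<close> into \<open>{1..n + 1}\<close> is the identity on numbers.\<close>

definition coloring_incl ::
  "'v set \<Rightarrow> 'v set set \<Rightarrow> nat \<Rightarrow> (('v \<Rightarrow> nat) \<Rightarrow> complex) \<Rightarrow> ('v \<Rightarrow> nat) \<Rightarrow> complex" where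
  "coloring_incl V E n = lin_ext (colorings V E n) (\<lambda>c. compose V id c)"

end

theory Submission
  imports Defs
begin

text \<open>
  A coloring is a partition of the vertices into independent blocks together with an injective
  labelling of the blocks, so the permutation module on the colorings splits over the orbits, and
  the orbit of a coloring with \<open>k\<close> colors is induced from the trivial representation of the
  symmetric group on \<open>{1..n - k}\<close>.  A vector of a Specht module that is invariant under this
  subgroup gives an equivariant map into the permutation module.  Stripping the box that contains
  the largest entry shows by induction that the Specht module of a shape \<open>p\<close> has at least as many
  independent invariants as there are paths from the one-row shape \<open>n - k\<close> to \<open>p\<close> in Young's
  lattice, and (for \<open>k = n\<close>) that its dimension is at least the number of paths from the empty
  shape to \<open>p\<close>.  Column antisymmetrizers show that the resulting maps are jointly injective.  The
  products of the two path numbers add up, by the commutation relation of the up and down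
  operators, to \<open>n! / (n - k)!\<close>, the size of the orbit; so all these lower bounds are equalities.
  For \<open>n \<ge> 2k\<close> the number of paths from \<open>n - k\<close> to the shape \<open>padded \<nu> n\<close> does not depend on
  \<open>n\<close>, because the first row is then too long to interact with the other rows.
\<close>

section \<open>Paths in Young's lattice\<close>

text \<open>The maps into the permutation module are Frobenius reciprocity in explicit form: an
  invariant \<open>w\<close> sends \<open>F\<close> to the function whose value at the point
  \<open>\<sigma> x0\<close> is the inner product of \<open>F\<close> with
  \<open>\<sigma> w\<close>. The count closes because the path numbers from the empty shape are an
  eigenfunction: summed over the shapes that cover a shape of size m, they give m + 1 times the
  number of that shape. Each of the k steps up from the row n - k thus contributes the next integer,
  and the product is (n - k + 1) ... n. To separate the shapes, a numerical statistic,
  \<open>height\<close>, takes the place of the dominance order, so that a shape to start with can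
  be picked as a maximum. The constant 2 #V arises as follows: a coloring has k \<le> #V colors, and
  a first row that starts with n - k boxes cannot be obstructed by k further boxes once n - k \<ge>
  k.\<close>

definition diag :: "(nat \<Rightarrow> nat) \<Rightarrow> (nat \<times> nat) set" where
  "diag p = {(i, j). j < p i}"

text \<open>Shapes are functions with zeros after the last row, so that removing the only box of a
  row is a pointwise update like any other.\<close>

definition young :: "nat \<Rightarrow> (nat \<Rightarrow> nat) set" where
  "young n = {p. antimono p \<and> finite (diag p) \<and> card (diag p) = n}"

definition removable :: "(nat \<Rightarrow> nat) \<Rightarrow> nat set" where
  "removable p = {i. p (Suc i) < p i}"

text \<open>Row \<open>Suc i\<close> accepts a box exactly when row \<open>i\<close> can lose one,
  and row \<open>0\<close> always accepts one. Hence there is one more addable row than removable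
  rows, which is the 1 in \<open>DU - UD = 1\<close>.\<close>

definition addable :: "(nat \<Rightarrow> nat) \<Rightarrow> nat set" where
  "addable p = insert 0 (Suc ` removable p)"

definition one_row :: "nat \<Rightarrow> nat \<Rightarrow> nat" where
  "one_row a = (\<lambda>i. if i = 0 then a else 0)"

abbreviation drop_box :: "(nat \<Rightarrow> nat) \<Rightarrow> nat \<Rightarrow> nat \<Rightarrow> nat" where
  "drop_box p i \<equiv> p(i := p i - Suc 0)"

abbreviation add_box :: "(nat \<Rightarrow> nat) \<Rightarrow> nat \<Rightarrow> nat \<Rightarrow> nat" where
  "add_box p i \<equiv> p(i := Suc (p i))"

text \<open>Paths are read backwards from their end \<open>p\<close>. For \<open>p\<close> of size
  \<open>n\<close>, \<open>paths 0 n p\<close> is the number of standard Young tableaux of shape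
  \<open>p\<close>.\<close>

primrec paths :: "nat \<Rightarrow> nat \<Rightarrow> (nat \<Rightarrow> nat) \<Rightarrow> nat" where
  "paths a 0 p = (if p = one_row a then 1 else 0)"
| "paths a (Suc k) p = (\<Sum>i\<in>removable p. paths a k (drop_box p i))"

lemma diag_inject: "diag p = diag q \<longleftrightarrow> p = q"
proof
  assume h: "diag p = diag q"
  show "p = q"
  proof
    fix i
    have "j < p i \<longleftrightarrow> j < q i" for j
      using h by (auto simp: diag_def set_eq_iff)
    then show "p i = q i"
      by (meson linorder_neqE_nat less_irrefl)
  qed
qed simp

lemma diag_drop: "i \<in> removable p \<Longrightarrow> diag (drop_box p i) = diag p - {(i, p i - Suc 0)}"
  by (auto simp: diag_def removable_def split: if_splits)

lemma diag_add: "diag (add_box p i) = insert (i, p i) (diag p)"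
  by (auto simp: diag_def split: if_splits)

lemma corner_in_diag: "i \<in> removable p \<Longrightarrow> (i, p i - Suc 0) \<in> diag p"
  by (auto simp: diag_def removable_def)

lemma youngD:
  assumes "p \<in> young n"
  shows "antimono p" "finite (diag p)" "card (diag p) = n"
  using assms by (auto simp: young_def)

lemma drop_young:
  assumes "p \<in> young (Suc n)" "i \<in> removable p"
  shows "drop_box p i \<in> young n"
proof -
  have le: "p (Suc j) \<le> p j" for j
    using youngD(1)[OF assms(1)] by (simp add: decseq_Suc_iff)
  have "drop_box p i (Suc j) \<le> drop_box p i j" for j
    using assms(2) le[of j] by (auto simp: removable_def)
  then have "decseq (drop_box p i)"
    unfolding decseq_Suc_iff by blast
  then show ?thesis
    using assms corner_in_diag[OF assms(2)] by (auto simp: young_def diag_drop)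
qed

lemma add_young:
  assumes "p \<in> young n" "i \<in> addable p"
  shows "add_box p i \<in> young (Suc n)"
proof -
  have le: "p (Suc j) \<le> p j" for j
    using youngD(1)[OF assms(1)] by (simp add: decseq_Suc_iff)
  have "add_box p i (Suc j) \<le> add_box p i j" for j
    using assms(2) le[of j] by (auto simp: addable_def removable_def)
  then have "decseq (add_box p i)"
    unfolding decseq_Suc_iff by blast
  moreover have "(i, p i) \<notin> diag p"
    by (simp add: diag_def)
  ultimately show ?thesis
    using assms(1) by (auto simp: young_def diag_add)
qed

lemma finite_removable:
  assumes "finite (diag p)"
  shows "finite (removable p)"
proof (rule finite_subset)
  show "removable p \<subseteq> fst ` diag p"
    using corner_in_diag by force
qed (use assms in simp)

lemma finite_addable: "finite (diag p) \<Longrightarrow> finite (addable p)"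
  by (simp add: addable_def finite_removable)

lemma card_addable: "finite (diag p) \<Longrightarrow> card (addable p) = Suc (card (removable p))"
  by (simp add: addable_def finite_removable card_image card_insert_if image_iff)

lemma addable_drop:
  assumes "antimono p" "i \<in> removable p"
  shows "i \<in> addable (drop_box p i)"
proof (cases i)
  case (Suc j)
  have "p (Suc j) \<le> p j"
    using assms(1) by (simp add: antimono_def)
  then show ?thesis
    using assms(2) Suc by (auto simp: addable_def removable_def)
qed (simp add: addable_def)

lemma removable_add:
  assumes "antimono p"
  shows "i \<in> removable (add_box p i)"
proof -
  have "p (Suc i) \<le> p i"
    using assms(1) by (simp add: antimono_def)
  then show ?thesis
    by (auto simp: removable_def)
qed

lemma add_drop: "i \<in> removable p \<Longrightarrow> p(i := Suc (p i - Suc 0)) = p"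
  by (rule ext) (auto simp: removable_def)

lemma drop_add_box: "i \<noteq> j \<Longrightarrow> drop_box (add_box p i) j = add_box (drop_box p j) i"
  by (rule ext) simp

text \<open>Different rows interact only if \<open>i = Suc j\<close>; then both sides say that row
  \<open>j\<close> is at least two boxes longer than row \<open>i\<close>.\<close>

lemma add_drop_commute:
  assumes "i \<noteq> j"
  shows "i \<in> addable p \<and> j \<in> removable (add_box p i) \<longleftrightarrow>
         j \<in> removable p \<and> i \<in> addable (drop_box p j)"
proof (cases i)
  case 0
  then show ?thesis
    using assms by (auto simp: addable_def removable_def)
next
  case (Suc l)
  have "i \<in> addable q \<longleftrightarrow> l \<in> removable q" for q
    using Suc by (auto simp: addable_def)
  then show ?thesis
    using assms Suc by (cases "l = j"; cases "l = Suc j") (auto simp: removable_def)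
qed

text \<open>A box (i, j) of a shape brings along a full rectangle of (i + 1)(j + 1) boxes, so the
  shape lies in an n by n square.\<close>

lemma finite_young: "finite (young n)"
proof (rule finite_imageD)
  have "diag p \<subseteq> {..<n} \<times> {..<n}" if "p \<in> young n" for p
  proof
    fix b assume "b \<in> diag p"
    then obtain i j where b: "b = (i, j)" "j < p i"
      by (auto simp: diag_def)
    have "{..i} \<times> {..j} \<subseteq> diag p"
    proof
      fix c assume "c \<in> {..i} \<times> {..j}"
      then obtain i' j' where c: "c = (i', j')" "i' \<le> i" "j' \<le> j"
        by auto
      then have "p i \<le> p i'"
        using youngD(1)[OF that] by (simp add: antimono_def)
      then show "c \<in> diag p"
        using b c by (auto simp: diag_def)
    qed
    then have "card ({..i} \<times> {..j}) \<le> n"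
      using youngD(2,3)[OF that] card_mono by metis
    then have "Suc i * Suc j \<le> n"
      by (simp add: card_cartesian_product)
    then have "i < n" "j < n"
      by auto
    then show "b \<in> {..<n} \<times> {..<n}"
      using b by auto
  qed
  then have "diag ` young n \<subseteq> Pow ({..<n} \<times> {..<n})"
    by auto
  then show "finite (diag ` young n)"
    by (rule finite_subset) simp
qed (simp add: inj_on_def diag_inject)

lemma diag_one_row: "diag (one_row a) = {0} \<times> {..<a}"
  by (auto simp: diag_def one_row_def split: if_splits)

lemma one_row_young: "one_row a \<in> young a"
  by (simp add: young_def diag_one_row card_cartesian_product)
     (auto simp: one_row_def antimono_def)

lemma young_0: "young 0 = {one_row 0}"
proof -
  have "diag (one_row 0) = {}"
    by (simp add: diag_one_row)
  then have "p = one_row 0" if "p \<in> young 0" for p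
    using youngD(2,3)[OF that] by (simp flip: diag_inject)
  then show ?thesis
    using one_row_young[of 0] by blast
qed

lemma removable_one_row: "removable (one_row (Suc a)) = {0}"
  by (auto simp: removable_def one_row_def)

lemma drop_one_row: "drop_box (one_row (Suc a)) 0 = one_row a"
  by (auto simp: one_row_def)

lemma paths_one_row: "paths 0 a (one_row a) = 1"
  by (induction a) (simp_all add: removable_one_row drop_one_row del: One_nat_def)

text \<open>The relation \<open>DU - UD = 1\<close> between the down and up operators of Young's lattice.\<close>

lemma sum_paths_add:
  "q \<in> young n \<Longrightarrow>
   (\<Sum>i\<in>addable q. paths 0 (Suc n) (add_box q i)) = Suc n * paths 0 n q"
proof (induction n arbitrary: q)
  case 0
  then have "q = one_row 0"
    by (simp add: young_0)
  moreover have "addable (one_row 0) = {0}"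
    by (auto simp: addable_def removable_def one_row_def)
  moreover have "add_box (one_row 0) 0 = one_row (Suc 0)"
    by (auto simp: one_row_def)
  ultimately show ?case
    by (simp add: removable_one_row drop_one_row)
next
  case (Suc n)
  define f where "f = paths 0 (Suc n)"
  have f_rec: "paths 0 (Suc (Suc n)) p = (\<Sum>j\<in>removable p. f (drop_box p j))" for p
    unfolding f_def by (rule paths.simps)
  have fin: "finite (addable q)" "finite (removable q)"
    using youngD(2)[OF Suc.prems] by (simp_all add: finite_addable finite_removable)
  have finr: "finite (removable (add_box q i))" for i
    using youngD(2)[OF Suc.prems] by (simp add: finite_removable diag_add)
  have fina: "finite (addable (drop_box q j))" if "j \<in> removable q" for j
    using youngD(2)[OF Suc.prems] that by (simp add: finite_addable diag_drop)
  have ant: "antimono q"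
    using youngD(1)[OF Suc.prems] .
  have "(\<Sum>i\<in>addable q. paths 0 (Suc (Suc n)) (add_box q i)) =
        (\<Sum>i\<in>addable q. \<Sum>j\<in>removable (add_box q i). f (drop_box (add_box q i) j))"
    by (simp only: f_rec)
  \<comment> \<open>The diagonal term \<open>j = i\<close> removes the box just added and returns to
    \<open>q\<close>.\<close>
  also have "\<dots> = (\<Sum>i\<in>addable q. f q +
      (\<Sum>j\<in>removable (add_box q i) - {i}. f (drop_box (add_box q i) j)))"
    by (intro sum.cong refl, subst sum.remove[OF finr removable_add[OF ant]]) simp
  also have "\<dots> = card (addable q) * f q +
      (\<Sum>i\<in>addable q. \<Sum>j\<in>removable (add_box q i) - {i}. f (drop_box (add_box q i) j))"
    by (simp add: sum.distrib)
  \<comment> \<open>Off the diagonal, adding in row \<open>i\<close> and removing in row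
    \<open>j\<close> can be exchanged.\<close>
  also have "(\<Sum>i\<in>addable q. \<Sum>j\<in>removable (add_box q i) - {i}. f (drop_box (add_box q i) j)) =
      (\<Sum>j\<in>removable q. \<Sum>i\<in>addable (drop_box q j) - {j}. f (add_box (drop_box q j) i))"
    (is "?L = ?R")
  proof -
    have "?L = (\<Sum>(i, j)\<in>(SIGMA i:addable q. removable (add_box q i) - {i}).
        f (drop_box (add_box q i) j))"
      using fin finr by (subst sum.Sigma) auto
    also have "\<dots> = (\<Sum>(j, i)\<in>(SIGMA j:removable q. addable (drop_box q j) - {j}).
        f (add_box (drop_box q j) i))"
    proof (rule sum.reindex_bij_witness[of _ "\<lambda>(j, i). (i, j)" "\<lambda>(i, j). (j, i)"], goal_cases)
      case (2 x)
      then obtain i j where "x = (i, j)" "i \<in> addable q" "j \<in> removable (add_box q i)" "i \<noteq> j"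
        by auto
      then show ?case
        using add_drop_commute[of i j q] by simp
    next
      case (4 x)
      then obtain i j where "x = (j, i)" "j \<in> removable q" "i \<in> addable (drop_box q j)" "i \<noteq> j"
        by auto
      then show ?case
        using add_drop_commute[of i j q] by simp
    next
      case (5 x)
      then obtain i j where "x = (i, j)" "i \<noteq> j"
        by auto
      then show ?case
        using drop_add_box[of i j q] by simp
    qed auto
    also have "\<dots> = ?R"
      using fin fina by (subst sum.Sigma) auto
    finally show ?thesis .
  qed
  \<comment> \<open>Of the diagonal copies of \<open>f q\<close> one is set apart; the others go to
    the removable rows \<open>j\<close>, where each supplies the missing term \<open>i = j\<close>
    of going down and then up.\<close>
  also have "card (addable q) * f q + ?R = f q +
      (\<Sum>j\<in>removable q. f q + (\<Sum>i\<in>addable (drop_box q j) - {j}. f (add_box (drop_box q j) i)))"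
    using youngD(2)[OF Suc.prems] by (simp add: sum.distrib card_addable)
  also have "\<dots> = f q + (\<Sum>j\<in>removable q. \<Sum>i\<in>addable (drop_box q j). f (add_box (drop_box q j) i))"
  proof -
    have "f q + (\<Sum>i\<in>addable (drop_box q j) - {j}. f (add_box (drop_box q j) i)) =
        (\<Sum>i\<in>addable (drop_box q j). f (add_box (drop_box q j) i))" if "j \<in> removable q" for j
      by (subst sum.remove[OF fina[OF that] addable_drop[OF ant that]], simp add: add_drop[OF that])
    then show ?thesis
      by simp
  qed
  also have "\<dots> = f q + (\<Sum>j\<in>removable q. Suc n * paths 0 n (drop_box q j))"
    unfolding f_def
    by (intro arg_cong2[where f = "(+)"] refl sum.cong Suc.IH drop_young Suc.prems)
  also have "\<dots> = f q + Suc n * f q"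
    by (simp only: f_def sum_distrib_left paths.simps)
  finally show ?case
    by (simp add: f_def del: paths.simps)
qed

text \<open>Splitting off the last box of the path that starts at \<open>one_row a\<close> moves the
  sum to shapes of size \<open>a + k\<close>, where \<open>sum_paths_add\<close> produces the factor
  \<open>Suc (a + k)\<close>. The factor \<open>fact a\<close> keeps the identity free of
  division.\<close>

lemma sum_paths_paths:
  "(\<Sum>p\<in>young (a + k). paths a k p * paths 0 (a + k) p) * fact a = fact (a + k)"
proof (induction k)
  case 0
  have "(\<Sum>p\<in>young a. paths a 0 p * paths 0 a p) = (\<Sum>p\<in>{one_row a}. paths a 0 p * paths 0 a p)"
    by (rule sum.mono_neutral_right) (auto simp: finite_young one_row_young)
  then show ?case
    by (simp add: paths_one_row)
next
  case (Suc k)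
  have fin: "finite (removable p)" "finite (addable p)" if "p \<in> young n" for n p
    using youngD(2)[OF that] by (simp_all add: finite_removable finite_addable)
  have "(\<Sum>p\<in>young (Suc (a + k)). paths a (Suc k) p * paths 0 (Suc (a + k)) p) =
      (\<Sum>p\<in>young (Suc (a + k)). \<Sum>i\<in>removable p. paths a k (drop_box p i) * paths 0 (Suc (a + k)) p)"
    by (simp add: sum_distrib_right)
  also have "\<dots> = (\<Sum>(p, i)\<in>(SIGMA p:young (Suc (a + k)). removable p).
      paths a k (drop_box p i) * paths 0 (Suc (a + k)) p)"
    using fin by (subst sum.Sigma) (auto simp: finite_young)
  also have "\<dots> = (\<Sum>(q, i)\<in>(SIGMA q:young (a + k). addable q).
      paths a k q * paths 0 (Suc (a + k)) (add_box q i))"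
    by (rule sum.reindex_bij_witness[of _ "\<lambda>(q, i). (add_box q i, i)" "\<lambda>(p, i). (drop_box p i, i)"])
       (auto simp: add_drop drop_young add_young addable_drop removable_add youngD(1)
         simp del: paths.simps)
  also have "\<dots> = (\<Sum>q\<in>young (a + k). \<Sum>i\<in>addable q. paths a k q * paths 0 (Suc (a + k)) (add_box q i))"
    using fin by (subst sum.Sigma) (auto simp: finite_young)
  also have "\<dots> = (\<Sum>q\<in>young (a + k). paths a k q * (Suc (a + k) * paths 0 (a + k) q))"
    by (simp only: sum_distrib_left[symmetric] sum_paths_add cong: sum.cong)
  also have "\<dots> = Suc (a + k) * (\<Sum>q\<in>young (a + k). paths a k q * paths 0 (a + k) q)"
    unfolding sum_distrib_left by (intro sum.cong refl) (simp only: mult.left_commute)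
  finally show ?case
    by (simp only: add_Suc_right mult.assoc Suc.IH fact_Suc of_nat_id)
qed


section \<open>Linear algebra in free vector spaces\<close>

interpretation fs: vector_space "fscale :: complex \<Rightarrow> ('a \<Rightarrow> complex) \<Rightarrow> 'a \<Rightarrow> complex"
  by (rule vector_space_fscale)

lemma sum_fun_apply: "(\<Sum>i\<in>I. f i) x = (\<Sum>i\<in>I. f i x)"
  for f :: "'i \<Rightarrow> 'a \<Rightarrow> 'b::comm_monoid_add"
  by (induction I rule: infinite_finite_induct) auto

lemma fscale_apply: "fscale a f x = a * f x"
  by (simp add: fscale_def)

lemma fun_eq_sum_delta:
  assumes "finite X" "\<And>x. x \<notin> X \<Longrightarrow> f x = 0"
  shows "f = (\<Sum>x\<in>X. fscale (f x) (delta x))"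
proof
  fix y
  have "(\<Sum>x\<in>X. fscale (f x) (delta x)) y = (\<Sum>x\<in>X. if y = x then f x else 0)"
    by (auto simp: sum_fun_apply fscale_apply delta_def intro!: sum.cong)
  then show "f y = (\<Sum>x\<in>X. fscale (f x) (delta x)) y"
    using assms by simp
qed

lemma free_space_iff:
  assumes "finite X"
  shows "f \<in> free_space X \<longleftrightarrow> (\<forall>x. x \<notin> X \<longrightarrow> f x = 0)"
proof
  assume "f \<in> free_space X"
  then show "\<forall>x. x \<notin> X \<longrightarrow> f x = 0"
    unfolding free_space_def
  proof (induction rule: fs.span_induct)
    case base
    show ?case
      by (auto simp: fs.subspace_def fscale_apply)
  qed (auto simp: delta_def)
next
  assume "\<forall>x. x \<notin> X \<longrightarrow> f x = 0"
  then have "f = (\<Sum>x\<in>X. fscale (f x) (delta x))"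
    using fun_eq_sum_delta[OF assms] by blast
  then show "f \<in> free_space X"
    unfolding free_space_def
    by (metis (no_types, lifting) fs.span_base fs.span_scale fs.span_sum imageI)
qed

lemma subspace_free_space: "fs.subspace (free_space X)"
  by (simp add: free_space_def)

text \<open>Independence of an indexed family: a repeated vector makes it dependent, so the size of
  the index set really counts independent vectors.\<close>

definition lin_indep :: "'i set \<Rightarrow> ('i \<Rightarrow> 'a \<Rightarrow> complex) \<Rightarrow> bool" where
  "lin_indep I w \<longleftrightarrow> (\<forall>c. (\<Sum>i\<in>I. fscale (c i) (w i)) = 0 \<longrightarrow> (\<forall>i\<in>I. c i = 0))"

lemma lin_indepD:
  "lin_indep I w \<Longrightarrow> (\<Sum>i\<in>I. fscale (c i) (w i)) = 0 \<Longrightarrow> i \<in> I \<Longrightarrow> c i = 0"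
  by (auto simp: lin_indep_def)

lemma lin_indep_inj:
  assumes "finite I" "lin_indep I w"
  shows "inj_on w I"
proof (rule inj_onI, rule ccontr)
  fix i j
  assume h: "i \<in> I" "j \<in> I" "w i = w j" "i \<noteq> j"
  define c :: "_ \<Rightarrow> complex" where "c k = (if k = i then 1 else if k = j then -1 else 0)" for k
  have "(\<Sum>k\<in>I. fscale (c k) (w k)) = (\<Sum>k\<in>{i, j}. fscale (c k) (w k))"
    using h assms(1) by (intro sum.mono_neutral_right) (auto simp: c_def)
  also have "\<dots> = 0"
    using h by (simp add: c_def)
  finally have "c i = 0"
    using lin_indepD[OF assms(2) _ h(1)] by blast
  then show False
    by (simp add: c_def)
qed

text \<open>This turns the final count into a spanning statement: a vector outside the span would
  enlarge the family to an independent set with more than \<open>card X\<close> members.\<close>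

lemma lin_indep_spans:
  assumes "finite I" "lin_indep I w" "finite X" "w ` I \<subseteq> free_space X" "card X \<le> card I"
    and f: "f \<in> free_space X"
  obtains c where "f = (\<Sum>i\<in>I. fscale (c i) (w i))"
proof -
  note inj = lin_indep_inj[OF assms(1,2)]
  have fin: "finite (w ` I)"
    using assms(1) by simp
  have sub: "w ` I \<subseteq> fs.span (delta ` X)"
    using assms(4) by (simp add: free_space_def)
  have ind: "fs.independent (w ` I)"
  proof -
    have "u v = 0" if uv: "v \<in> w ` I" "(\<Sum>v\<in>w ` I. fscale (u v) v) = 0" for u v
    proof -
      obtain i where "i \<in> I" "v = w i"
        using uv(1) by blast
      then show ?thesis
        using uv lin_indepD[OF assms(2), of "u \<circ> w" i] by (simp add: sum.reindex[OF inj])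
    qed
    then show ?thesis
      using fs.dependent_finite[OF fin] by blast
  qed
  have "f \<in> fs.span (w ` I)"
  proof (rule ccontr)
    assume f': "f \<notin> fs.span (w ` I)"
    then have "fs.independent (insert f (w ` I))"
      using ind by (simp add: fs.independent_insertI)
    moreover have "insert f (w ` I) \<subseteq> fs.span (delta ` X)"
      using sub f by (simp add: free_space_def)
    ultimately have "card (insert f (w ` I)) \<le> card (delta ` X)"
      using fs.independent_span_bound[of "delta ` X"] assms(3) by blast
    moreover have "f \<notin> w ` I"
      using f' fs.span_base by blast
    ultimately have "Suc (card I) \<le> card X"
      using fin card_image_le[OF assms(3), of delta] by (simp add: card_image[OF inj])
    then show False
      using assms(5) by simp
  qed
  then obtain u where "f = (\<Sum>v\<in>w ` I. fscale (u v) v)"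
    unfolding fs.span_finite[OF fin] by auto
  then have "f = (\<Sum>i\<in>I. fscale ((u \<circ> w) i) (w i))"
    by (simp add: sum.reindex[OF inj])
  then show ?thesis
    by (rule that)
qed

lemma finite_spanning_set:
  assumes "fs.subspace U" "U \<subseteq> free_space X" "finite X"
  shows "\<exists>B. finite B \<and> U = fs.span B"
proof -
  obtain B where B: "B \<subseteq> U" "fs.independent B" "U \<subseteq> fs.span B"
    by (rule fs.maximal_independent_subset)
  have "B \<subseteq> fs.span (delta ` X)"
    using B assms(2) by (auto simp: free_space_def)
  then have "finite B"
    using fs.independent_span_bound[of "delta ` X" B] assms(3) B(2) by blast
  moreover have "U = fs.span B"
    using B assms(1) by (simp add: fs.span_minimal subset_antisym)
  ultimately show ?thesis
    by blast
qed

lemma lin_ext_add: "lin_ext X g (f + f') = lin_ext X g f + lin_ext X g f'"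
  by (simp add: lin_ext_def fs.scale_left_distrib sum.distrib)

lemma lin_ext_scale: "lin_ext X g (fscale a f) = fscale a (lin_ext X g f)"
  by (simp add: lin_ext_def fs.scale_sum_right fscale_apply)

lemma lin_ext_apply:
  assumes "finite X" "inj_on g X" "x \<in> X"
  shows "lin_ext X g f (g x) = f x"
proof -
  have "lin_ext X g f (g x) = (\<Sum>y\<in>X. if x = y then f y else 0)"
    using assms(2,3)
    by (auto simp: lin_ext_def sum_fun_apply fscale_apply delta_def inj_on_eq_iff intro!: sum.cong)
  then show ?thesis
    using assms by simp
qed

lemma lin_ext_outside: "y \<notin> g ` X \<Longrightarrow> lin_ext X g f y = 0"
  by (auto simp: lin_ext_def sum_fun_apply fscale_apply delta_def intro!: sum.neutral)

section \<open>Specht modules of sets of boxes\<close>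

definition relabel :: "(nat \<Rightarrow> nat) \<Rightarrow> (nat \<Rightarrow> nat set) \<Rightarrow> nat \<Rightarrow> nat set" where
  "relabel \<sigma> T = (\<lambda>i. \<sigma> ` T i)"

text \<open>Defined on all functions, with no shape attached, so that a permutation from the tableau
  of one shape can act on the Specht module of another. The inverse makes it a left action.\<close>

definition act ::
  "(nat \<Rightarrow> nat) \<Rightarrow> ((nat \<Rightarrow> nat set) \<Rightarrow> complex) \<Rightarrow> (nat \<Rightarrow> nat set) \<Rightarrow> complex" where
  "act \<sigma> F = (\<lambda>T. F (relabel (inv \<sigma>) T))"

lemma relabel_comp: "relabel (\<sigma> \<circ> \<tau>) T = relabel \<sigma> (relabel \<tau> T)"
  by (simp add: relabel_def image_comp)

lemma relabel_id [simp]: "relabel id T = T"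
  by (simp add: relabel_def)

lemma relabel_inv:
  assumes "bij \<sigma>"
  shows "relabel (inv \<sigma>) (relabel \<sigma> T) = T" "relabel \<sigma> (relabel (inv \<sigma>) T) = T"
  using assms
  by (simp_all flip: relabel_comp add: bij_is_inj bij_is_surj inv_o_cancel surj_iff[THEN iffD1])

lemma act_id [simp]: "act id F = F"
  by (simp add: act_def)

lemma act_comp:
  assumes "bij \<sigma>" "bij \<tau>"
  shows "act (\<sigma> \<circ> \<tau>) F = act \<sigma> (act \<tau> F)"
  using assms by (simp add: act_def o_inv_distrib relabel_comp)

lemma act_delta:
  assumes "bij \<sigma>"
  shows "act \<sigma> (delta T) = delta (relabel \<sigma> T)"
proof
  fix T'
  have "relabel (inv \<sigma>) T' = T \<longleftrightarrow> T' = relabel \<sigma> T"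
    using relabel_inv[OF assms] by metis
  then show "act \<sigma> (delta T) T' = delta (relabel \<sigma> T) T'"
    by (simp add: act_def delta_def)
qed

lemma act_add: "act \<sigma> (F + G) = act \<sigma> F + act \<sigma> G"
  by (simp add: act_def fun_eq_iff)

lemma act_scale: "act \<sigma> (fscale a F) = fscale a (act \<sigma> F)"
  by (simp add: act_def fscale_def)

lemma act_zero [simp]: "act \<sigma> 0 = 0"
  by (simp add: act_def fun_eq_iff)

lemma act_sum: "act \<sigma> (\<Sum>i\<in>I. F i) = (\<Sum>i\<in>I. act \<sigma> (F i))"
  by (simp add: act_def sum_fun_apply fun_eq_iff)

text \<open>\<open>tabs\<close>, \<open>rows\<close>, \<open>colst\<close>, \<open>ptab\<close> and \<open>Sp\<close> are \<open>tableaux\<close>, \<open>tabloid\<close>, \<open>column_stabilizer\<close>,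
  \<open>polytabloid\<close> and \<open>specht\<close> with the set of boxes in place of the partition: a corner can then be
  removed without deleting a part that becomes \<open>0\<close> from the list.\<close>

definition tabs :: "(nat \<times> nat) set \<Rightarrow> (nat \<times> nat \<Rightarrow> nat) set" where
  "tabs D = {t. bij_betw t D {1..card D}}"

definition rows :: "(nat \<times> nat) set \<Rightarrow> (nat \<times> nat \<Rightarrow> nat) \<Rightarrow> nat \<Rightarrow> nat set" where
  "rows D t = (\<lambda>i. {t (i, j) |j. (i, j) \<in> D})"

definition colst :: "(nat \<times> nat) set \<Rightarrow> (nat \<times> nat \<Rightarrow> nat) \<Rightarrow> (nat \<Rightarrow> nat) set" where
  "colst D t =
     {\<pi>. \<pi> permutes {1..card D} \<and>
         (\<forall>i j. (i, j) \<in> D \<longrightarrow> (\<exists>i'. (i', j) \<in> D \<and> \<pi> (t (i, j)) = t (i', j)))}"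

definition ptab :: "(nat \<times> nat) set \<Rightarrow> (nat \<times> nat \<Rightarrow> nat) \<Rightarrow> (nat \<Rightarrow> nat set) \<Rightarrow> complex" where
  "ptab D t = (\<Sum>\<pi>\<in>colst D t. fscale (of_int (sign \<pi>)) (delta (rows D (\<pi> \<circ> t))))"

definition Sp :: "(nat \<times> nat) set \<Rightarrow> ((nat \<Rightarrow> nat set) \<Rightarrow> complex) set" where
  "Sp D = fs.span (ptab D ` tabs D)"

text \<open>The column antisymmetrizer of \<open>t\<close> as an operator. \<open>F\<close> may
  belong to a different shape than \<open>D\<close>; the comparison of shapes depends on
  this.\<close>

definition kappa ::
  "(nat \<times> nat) set \<Rightarrow> (nat \<times> nat \<Rightarrow> nat) \<Rightarrow> ((nat \<Rightarrow> nat set) \<Rightarrow> complex) \<Rightarrow> (nat \<Rightarrow> nat set) \<Rightarrow> complex"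
  where "kappa D t F = (\<Sum>\<pi>\<in>colst D t. fscale (of_int (sign \<pi>)) (act \<pi> F))"

definition colno :: "(nat \<times> nat) set \<Rightarrow> (nat \<times> nat \<Rightarrow> nat) \<Rightarrow> nat \<Rightarrow> nat" where
  "colno D t x = snd (inv_into D t x)"

definition rowno :: "(nat \<times> nat) set \<Rightarrow> (nat \<times> nat \<Rightarrow> nat) \<Rightarrow> nat \<Rightarrow> nat" where
  "rowno D t x = fst (inv_into D t x)"

lemma rows_relabel: "rows D (\<sigma> \<circ> t) = relabel \<sigma> (rows D t)"
  by (auto simp: rows_def relabel_def)

lemma box_of_entry:
  assumes "t \<in> tabs D" "(i, j) \<in> D"
  shows "rowno D t (t (i, j)) = i" "colno D t (t (i, j)) = j" "t (i, j) \<in> {1..card D}"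
  using assms by (auto simp: tabs_def rowno_def colno_def bij_betw_def)

lemma entry_of_box:
  assumes "t \<in> tabs D" "x \<in> {1..card D}"
  shows "(rowno D t x, colno D t x) \<in> D" "t (rowno D t x, colno D t x) = x"
proof -
  have "x \<in> t ` D"
    using assms by (simp add: tabs_def bij_betw_def)
  then show "(rowno D t x, colno D t x) \<in> D" "t (rowno D t x, colno D t x) = x"
    by (auto simp: rowno_def colno_def inv_into_into f_inv_into_f)
qed

lemma mem_rows_iff:
  assumes "t \<in> tabs D"
  shows "x \<in> rows D t i \<longleftrightarrow> x \<in> {1..card D} \<and> rowno D t x = i"
proof
  assume "x \<in> rows D t i"
  then show "x \<in> {1..card D} \<and> rowno D t x = i"
    using box_of_entry[OF assms] by (auto simp: rows_def)
next
  assume "x \<in> {1..card D} \<and> rowno D t x = i"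
  then show "x \<in> rows D t i"
    using entry_of_box[OF assms, of x] by (auto simp: rows_def intro!: exI[of _ "colno D t x"])
qed

text \<open>In terms of entries the column stabilizer consists of the permutations that preserve the
  function \<open>colno D t\<close>, which makes closure under composition and inverse
  visible.\<close>

lemma colst_iff:
  assumes "t \<in> tabs D"
  shows "\<pi> \<in> colst D t \<longleftrightarrow>
    \<pi> permutes {1..card D} \<and> (\<forall>x\<in>{1..card D}. colno D t (\<pi> x) = colno D t x)"
proof (intro iffI conjI ballI)
  assume h: "\<pi> \<in> colst D t"
  then show "\<pi> permutes {1..card D}"
    by (simp add: colst_def)
  fix x assume x: "x \<in> {1..card D}"
  then obtain i' where "(i', colno D t x) \<in> D" "\<pi> x = t (i', colno D t x)"
    using h entry_of_box[OF assms x] by (auto simp: colst_def) metis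
  then show "colno D t (\<pi> x) = colno D t x"
    using box_of_entry[OF assms] by simp
next
  assume h: "\<pi> permutes {1..card D} \<and> (\<forall>x\<in>{1..card D}. colno D t (\<pi> x) = colno D t x)"
  have "\<exists>i'. (i', j) \<in> D \<and> \<pi> (t (i, j)) = t (i', j)" if "(i, j) \<in> D" for i j
  proof (intro exI conjI)
    have x: "t (i, j) \<in> {1..card D}"
      using box_of_entry[OF assms that] by simp
    then have y: "\<pi> (t (i, j)) \<in> {1..card D}" "colno D t (\<pi> (t (i, j))) = j"
      using h box_of_entry(2)[OF assms that] permutes_in_image by metis+
    then show "(rowno D t (\<pi> (t (i, j))), j) \<in> D" "\<pi> (t (i, j)) = t (rowno D t (\<pi> (t (i, j))), j)"
      using entry_of_box[OF assms y(1)] by simp_all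
  qed
  then show "\<pi> \<in> colst D t"
    using h by (simp add: colst_def)
qed

lemma colst_permutes: "\<pi> \<in> colst D t \<Longrightarrow> \<pi> permutes {1..card D}"
  by (simp add: colst_def)

lemma colst_perm: "\<pi> \<in> colst D t \<Longrightarrow> permutation \<pi>"
  using colst_permutes permutation_permutes by blast

lemma colst_bij: "\<pi> \<in> colst D t \<Longrightarrow> bij \<pi>"
  using colst_permutes permutes_bij by blast

lemma finite_colst: "finite (colst D t)"
  by (rule finite_subset[OF _ finite_permutations[of "{1..card D}"]]) (auto simp: colst_def)

lemma colst_comp:
  assumes "t \<in> tabs D" "\<pi> \<in> colst D t" "\<tau> \<in> colst D t"
  shows "\<pi> \<circ> \<tau> \<in> colst D t"
proof -
  have "\<tau> x \<in> {1..card D}" if "x \<in> {1..card D}" for x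
    using permutes_in_image[OF colst_permutes[OF assms(3)]] that by blast
  then show ?thesis
    using assms(2,3) unfolding colst_iff[OF assms(1)] by (metis comp_apply permutes_compose)
qed

lemma colst_inv:
  assumes "t \<in> tabs D" "\<pi> \<in> colst D t"
  shows "inv \<pi> \<in> colst D t"
proof -
  note p = colst_permutes[OF assms(2)]
  have "colno D t (inv \<pi> x) = colno D t x" if "x \<in> {1..card D}" for x
  proof -
    have "inv \<pi> x \<in> {1..card D}"
      using permutes_in_image[OF permutes_inv[OF p]] that by blast
    then have "colno D t (\<pi> (inv \<pi> x)) = colno D t (inv \<pi> x)"
      using assms(2) unfolding colst_iff[OF assms(1)] by blast
    then show ?thesis
      by (simp add: permutes_inverses(1)[OF p])
  qed
  then show ?thesis
    unfolding colst_iff[OF assms(1)] using permutes_inv[OF p] by blast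
qed

lemma tabs_comp: "\<sigma> permutes {1..card D} \<Longrightarrow> t \<in> tabs D \<Longrightarrow> \<sigma> \<circ> t \<in> tabs D"
  unfolding tabs_def using bij_betw_trans permutes_imp_bij by blast

lemma ptab_eq_kappa: "ptab D t = kappa D t (delta (rows D t))"
  unfolding ptab_def kappa_def
  by (intro sum.cong refl) (simp add: act_delta colst_bij rows_relabel)

lemma kappa_scale: "kappa D t (fscale a F) = fscale a (kappa D t F)"
  by (simp add: kappa_def act_scale fs.scale_sum_right mult.commute)

lemma kappa_sum: "kappa D t (\<Sum>i\<in>I. F i) = (\<Sum>i\<in>I. kappa D t (F i))"
  unfolding kappa_def act_sum fs.scale_sum_right by (rule sum.swap)

text \<open>Composing with \<open>\<tau>\<close> on the right permutes the column stabilizer and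
  changes every sign by the sign of \<open>\<tau>\<close>.\<close>

lemma kappa_act:
  assumes t: "t \<in> tabs D" and \<tau>: "\<tau> \<in> colst D t"
  shows "kappa D t (act \<tau> F) = fscale (of_int (sign \<tau>)) (kappa D t F)"
proof -
  have "kappa D t (act \<tau> F) = (\<Sum>\<pi>\<in>colst D t. fscale (of_int (sign \<pi>)) (act (\<pi> \<circ> \<tau>) F))"
    unfolding kappa_def using \<tau> by (intro sum.cong refl) (simp add: act_comp colst_bij)
  also have "\<dots> = (\<Sum>\<pi>\<in>colst D t. fscale (of_int (sign (\<pi> \<circ> inv \<tau>))) (act \<pi> F))"
    by (rule sum.reindex_bij_witness[of _ "\<lambda>\<pi>. \<pi> \<circ> inv \<tau>" "\<lambda>\<pi>. \<pi> \<circ> \<tau>"])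
       (use colst_bij[OF \<tau>] in \<open>auto simp: o_assoc[symmetric] bij_is_surj bij_is_inj
         surj_iff[THEN iffD1] colst_comp[OF t] colst_inv[OF t] \<tau>\<close>)
  also have "\<dots> = (\<Sum>\<pi>\<in>colst D t. fscale (of_int (sign \<tau>)) (fscale (of_int (sign \<pi>)) (act \<pi> F)))"
    using \<tau> by (intro sum.cong refl)
      (simp add: sign_compose colst_perm permutation_inverse sign_inverse mult.commute)
  finally show ?thesis
    by (simp add: kappa_def fs.scale_sum_right)
qed

text \<open>The transposition of \<open>x\<close> and \<open>y\<close> lies in the column stabilizer
  of \<open>t\<close>, is odd, and fixes the tabloid of \<open>s\<close>; so the vector equals its
  own negative.\<close>

lemma kappa_delta_eq_0:
  assumes t: "t \<in> tabs D" and s: "s \<in> tabs D'" and card: "card D' = card D"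
    and xy: "x \<in> {1..card D}" "y \<in> {1..card D}" "x \<noteq> y"
    and col: "colno D t x = colno D t y" and row: "rowno D' s x = rowno D' s y"
  shows "kappa D t (delta (rows D' s)) = 0"
proof -
  let ?\<tau> = "transpose x y"
  have \<tau>: "?\<tau> \<in> colst D t"
    using xy col by (auto simp: colst_iff[OF t] permutes_swap_id transpose_def)
  have "x \<in> rows D' s i \<longleftrightarrow> y \<in> rows D' s i" for i
    using xy card by (simp add: mem_rows_iff[OF s] row)
  then have "relabel ?\<tau> (rows D' s) = rows D' s"
    by (simp add: relabel_def fun_eq_iff)
  then have "kappa D t (delta (rows D' s)) = kappa D t (act ?\<tau> (delta (rows D' s)))"
    by (simp add: act_delta)
  also have "\<dots> = fscale (- 1) (kappa D t (delta (rows D' s)))"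
    using xy(3) by (simp add: kappa_act[OF t \<tau>] sign_swap_id)
  finally have "kappa D t (delta (rows D' s)) T = - kappa D t (delta (rows D' s)) T" for T
    by (metis fscale_apply mult_minus1)
  then show ?thesis
    by (simp add: fun_eq_iff eq_neg_iff_add_eq_0)
qed


section \<open>Column antisymmetrizers and dominance\<close>

text \<open>Compared with the initial segment of the same size, \<open>S\<close> trades the elements
  of \<open>B\<close>, all below \<open>card S\<close>, for equally many elements of
  \<open>A\<close>, all at least \<open>card S\<close>.\<close>

lemma sum_lessThan_card_le:
  fixes S :: "nat set"
  assumes "finite S"
  shows "\<Sum>{..<card S} \<le> \<Sum>S"
    and "\<Sum>{..<card S} = \<Sum>S \<Longrightarrow> S = {..<card S}"
proof -
  define A where "A = S - {..<card S}"
  define B where "B = {..<card S} - S"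
  define C where "C = S \<inter> {..<card S}"
  have fin: "finite A" "finite B" "finite C"
    using assms by (auto simp: A_def B_def C_def)
  have S: "S = C \<union> A" "C \<inter> A = {}" and L: "{..<card S} = C \<union> B" "C \<inter> B = {}"
    by (auto simp: A_def B_def C_def)
  have "card C + card A = card C + card B"
    using card_Un_disjoint[OF fin(3,1) S(2)] card_Un_disjoint[OF fin(3,2) L(2)] S(1) L(1)
    by (metis card_lessThan)
  then have card: "card A = card B"
    by simp
  have sums: "\<Sum>S = \<Sum>C + \<Sum>A" "\<Sum>{..<card S} = \<Sum>C + \<Sum>B"
    using sum.union_disjoint[OF fin(3,1) S(2)] sum.union_disjoint[OF fin(3,2) L(2)] S(1) L(1)
    by metis+
  have A: "\<Sum>A \<ge> card A * card S"
    using sum_bounded_below[of A "card S" "\<lambda>x. x"] by (simp add: A_def)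
  \<comment> \<open>The extra \<open>card B\<close> records that the elements of \<open>B\<close>
    are strictly below \<open>card S\<close>; it forces \<open>A\<close> and \<open>B\<close> to be
    empty in the case of equality.\<close>
  have B: "\<Sum>B + card B \<le> card B * card S"
    using sum_bounded_above[of B Suc "card S"] sum_Suc[of "\<lambda>x. x" B]
    by (simp add: B_def Suc_le_eq)
  show "\<Sum>{..<card S} \<le> \<Sum>S"
    using A B card sums by simp
  show "S = {..<card S}" if "\<Sum>{..<card S} = \<Sum>S"
  proof -
    have "card A = 0" "card B = 0"
      using A B card sums that by simp_all
    then show ?thesis
      using fin S(1) L(1) by simp
  qed
qed

text \<open>\<open>D\<close> arises from \<open>E\<close> by pushing the boxes of each column to the
  top. This lowers the sum of the row numbers unless nothing moves.\<close>

lemma column_compress: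
  fixes D E :: "(nat \<times> nat) set"
  assumes fin: "finite D" "finite E"
    and col: "\<And>j. {i. (i, j) \<in> D} = {..<card {i. (i, j) \<in> E}}"
  shows "sum fst D \<le> sum fst E" and "sum fst D = sum fst E \<Longrightarrow> D = E"
proof -
  define J where "J = snd ` D \<union> snd ` E"
  define cE where "cE j = {i. (i, j) \<in> E}" for j
  define cD where "cD j = {i. (i, j) \<in> D}" for j
  have finc: "finite (cD j)" "finite (cE j)" for j
    using finite_vimageI[OF fin(1), of "\<lambda>i. (i, j)"] finite_vimageI[OF fin(2), of "\<lambda>i. (i, j)"]
    by (simp_all add: vimage_def inj_on_def cD_def cE_def)
  have sums: "sum fst X = (\<Sum>j\<in>J. \<Sum>{i. (i, j) \<in> X})" if "X = D \<or> X = E" for X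
  proof -
    have "(\<Sum>j\<in>J. \<Sum>{i. (i, j) \<in> X}) = (\<Sum>(j, i)\<in>(SIGMA j:J. {i. (i, j) \<in> X}). i)"
      using that fin finc by (subst sum.Sigma) (auto simp: J_def cD_def cE_def)
    also have "\<dots> = sum fst X"
      using that by (intro sum.reindex_bij_witness[of _ "\<lambda>(i, j). (j, i)" "\<lambda>(j, i). (i, j)"])
        (auto simp: J_def image_iff Bex_def)
    finally show ?thesis
      by simp
  qed
  have le: "\<Sum>(cD j) \<le> \<Sum>(cE j)" for j
    using sum_lessThan_card_le(1)[OF finc(2)[of j]] col[of j] by (simp add: cD_def cE_def)
  then show "sum fst D \<le> sum fst E"
    by (simp add: sums cD_def cE_def sum_mono)
  show "D = E" if "sum fst D = sum fst E"
  proof -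
    have J: "cD j = cE j" if "j \<in> J" for j
    proof -
      have "\<Sum>(cD j) = \<Sum>(cE j)"
        using \<open>sum fst D = sum fst E\<close> le that fin
        by (intro sum_mono_inv[of "\<lambda>j. \<Sum>(cD j)" J "\<lambda>j. \<Sum>(cE j)"]) (auto simp: sums cD_def cE_def J_def)
      then show ?thesis
        using sum_lessThan_card_le(2)[OF finc(2)[of j]] col[of j] by (simp add: cD_def cE_def)
    qed
    have "(i, j) \<in> D \<longleftrightarrow> (i, j) \<in> E" for i j
    proof (cases "j \<in> J")
      case True
      then show ?thesis
        using J by (auto simp: cD_def cE_def)
    qed (force simp: J_def)
    then show ?thesis
      by auto
  qed
qed

lemma diag_column:
  assumes "antimono p" "finite (diag p)"
  shows "{i. (i, j) \<in> diag p} = {..<card {i. (i, j) \<in> diag p}}"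
proof -
  let ?C = "{i. (i, j) \<in> diag p}"
  have fin: "finite ?C"
    using finite_vimageI[OF assms(2), of "\<lambda>i. (i, j)"] by (simp add: vimage_def inj_on_def)
  have down: "i' \<in> ?C" if "i \<in> ?C" "i' \<le> i" for i i'
  proof -
    have "p i \<le> p i'"
      using that assms(1) by (simp add: antimono_def)
    then show ?thesis
      using that by (simp add: diag_def)
  qed
  have "\<exists>m. C = {..<m}" if "finite C" "\<And>i i'. i \<in> C \<Longrightarrow> i' \<le> i \<Longrightarrow> i' \<in> C" for C :: "nat set"
  proof (cases "C = {}")
    case False
    then have "C = {..Max C}"
      using that by (meson Max_ge Max_in atMost_iff subsetI subset_antisym)
    then show ?thesis
      using lessThan_Suc_atMost by blast
  qed auto
  from this[of ?C] have "\<exists>m. ?C = {..<m}"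
    using fin down by blast
  then show ?thesis
    by (metis card_lessThan)
qed

lemma card_rows:
  assumes "t \<in> tabs (diag p)"
  shows "card (rows (diag p) t i) = p i"
proof -
  have "rows (diag p) t i = (\<lambda>j. t (i, j)) ` {..<p i}"
    by (auto simp: rows_def diag_def)
  moreover have "inj_on (\<lambda>j. t (i, j)) {..<p i}"
    using assms by (auto simp: tabs_def bij_betw_def inj_on_def diag_def)
  ultimately show ?thesis
    by (simp add: card_image)
qed

text \<open>The statistic usually written n(p), the sum of i times the length of row i. It decreases
  strictly when a shape goes up in the dominance order.\<close>

abbreviation height :: "(nat \<Rightarrow> nat) \<Rightarrow> nat" where
  "height p \<equiv> sum fst (diag p)"

text \<open>If no two entries share both their row in \<open>s\<close> and their column in \<open>t\<close>, sending an entry to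
  the pair of these two numbers gives a set of boxes with the row lengths of \<open>s\<close> and the column
  lengths of \<open>t\<close>.\<close>

lemma tableaux_dominance:
  assumes p: "p \<in> young n" "p' \<in> young n" and t: "t \<in> tabs (diag p)" and s: "s \<in> tabs (diag p')"
    and inj: "inj_on (\<lambda>x. (rowno (diag p') s x, colno (diag p) t x)) {1..n}"
  shows "height p \<le> height p'"
    and "height p = height p' \<Longrightarrow>
      p' = p \<and> (\<exists>\<pi>\<in>colst (diag p) t. rows (diag p') s = rows (diag p) (\<pi> \<circ> t))"
proof -
  let ?D = "diag p" and ?D' = "diag p'"
  define b where "b x = (rowno ?D' s x, colno ?D t x)" for x
  define E where "E = b ` {1..n}"
  note D = youngD[OF p(1)] and D' = youngD[OF p(2)]
  have inj: "inj_on b {1..n}"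
    using inj by (simp add: b_def[abs_def])
  have finE: "finite E"
    by (simp add: E_def)
  \<comment> \<open>Entries in one column of \<open>t\<close> lie in different rows of
    \<open>s\<close> by injectivity, so no box of a column of \<open>E\<close> is hit twice.\<close>
  have col: "card {i. (i, j) \<in> E} = card {i. (i, j) \<in> ?D}" for j
  proof -
    let ?X = "{x \<in> {1..n}. colno ?D t x = j}"
    have "{i. (i, j) \<in> E} = rowno ?D' s ` ?X"
      by (auto simp: E_def b_def)
    moreover have "inj_on (rowno ?D' s) ?X"
    proof (rule inj_onI)
      fix x y assume "x \<in> ?X" "y \<in> ?X" "rowno ?D' s x = rowno ?D' s y"
      then have "x \<in> {1..n}" "y \<in> {1..n}" "b x = b y"
        unfolding b_def by auto
      then show "x = y"
        using inj_onD[OF inj] by blast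
    qed
    ultimately have "card {i. (i, j) \<in> E} = card ?X"
      by (simp add: card_image)
    moreover have "bij_betw (\<lambda>i. t (i, j)) {i. (i, j) \<in> ?D} ?X"
    proof (rule bij_betw_imageI)
      show "inj_on (\<lambda>i. t (i, j)) {i. (i, j) \<in> ?D}"
        using t by (auto simp: tabs_def bij_betw_def inj_on_def)
      show "(\<lambda>i. t (i, j)) ` {i. (i, j) \<in> ?D} = ?X"
      proof
        show "(\<lambda>i. t (i, j)) ` {i. (i, j) \<in> ?D} \<subseteq> ?X"
          using box_of_entry(2,3)[OF t] D(3) by auto
        show "?X \<subseteq> (\<lambda>i. t (i, j)) ` {i. (i, j) \<in> ?D}"
        proof
          fix x assume "x \<in> ?X"
          then show "x \<in> (\<lambda>i. t (i, j)) ` {i. (i, j) \<in> ?D}"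
            using entry_of_box[OF t, of x] D(3) by (auto intro!: image_eqI[of _ _ "rowno ?D t x"])
        qed
      qed
    qed
    ultimately show ?thesis
      using bij_betw_same_card by fastforce
  qed
  then have compress: "{i. (i, j) \<in> ?D} = {..<card {i. (i, j) \<in> E}}" for j
    using diag_column[OF D(1,2)] by simp
  have bij_t: "bij_betw t ?D {1..n}" and bij_s: "bij_betw s ?D' {1..n}"
    using t s D(3) D'(3) by (simp_all add: tabs_def)
  have "height p' = (\<Sum>x\<in>?D'. rowno ?D' s (s x))"
    using box_of_entry(1)[OF s] by (intro sum.cong refl) auto
  also have "\<dots> = (\<Sum>x\<in>{1..n}. rowno ?D' s x)"
    by (rule sum.reindex_bij_betw[OF bij_s])
  also have "\<dots> = sum fst E"
    unfolding E_def sum.reindex[OF inj] by (simp add: b_def)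
  finally have height: "height p' = sum fst E" .
  show "height p \<le> height p'"
    unfolding height by (rule column_compress(1)[OF D(2) finE compress])
  assume "height p = height p'"
  then have "?D = E"
    using column_compress(2)[OF D(2) finE compress] height by simp
  then have bij_b: "bij_betw b {1..n} ?D"
    using inj by (simp add: bij_betw_def E_def)
  \<comment> \<open>\<open>\<pi>\<close> replaces the entry of \<open>t\<close> at a box by the
    entry whose row in \<open>s\<close> and column in \<open>t\<close> are the coordinates of that
    box. So entries stay in their column of \<open>t\<close>, and \<open>\<pi> \<circ> t\<close> has
    the rows of \<open>s\<close>.\<close>
  define \<pi> where "\<pi> x = (if x \<in> {1..n} then inv_into {1..n} b (inv_into ?D t x) else x)" for x
  have "bij_betw (inv_into {1..n} b \<circ> inv_into ?D t) {1..n} {1..n}"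
    using bij_betw_trans[OF bij_betw_inv_into[OF bij_t] bij_betw_inv_into[OF bij_b]] .
  then have "bij_betw \<pi> {1..n} {1..n}"
    by (rule bij_betw_cong[THEN iffD1, rotated]) (simp add: \<pi>_def)
  then have perm: "\<pi> permutes {1..n}"
    by (rule bij_imp_permutes) (auto simp: \<pi>_def)
  have b: "\<pi> (t (i, j)) \<in> {1..n}" "b (\<pi> (t (i, j))) = (i, j)" if "(i, j) \<in> ?D" for i j
  proof -
    have mem: "t (i, j) \<in> {1..n}"
      using box_of_entry(3)[OF t that] D(3) by simp
    then show "\<pi> (t (i, j)) \<in> {1..n}"
      using permutes_in_image[OF perm] by blast
    have "inv_into ?D t (t (i, j)) = (i, j)"
      using bij_t that by (simp add: bij_betw_inv_into_left)
    then show "b (\<pi> (t (i, j))) = (i, j)"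
      using mem bij_betw_inv_into_right[OF bij_b that] by (simp add: \<pi>_def)
  qed
  have \<pi>: "\<pi> \<in> colst ?D t"
    unfolding colst_iff[OF t] D(3)
  proof (intro conjI perm ballI)
    fix x assume x: "x \<in> {1..n}"
    have "b (\<pi> (t (rowno ?D t x, colno ?D t x))) = (rowno ?D t x, colno ?D t x)"
      using entry_of_box(1)[OF t, of x] x D(3) by (intro b(2)) simp
    then show "colno ?D t (\<pi> x) = colno ?D t x"
      using entry_of_box(2)[OF t, of x] x D(3) by (simp add: b_def)
  qed
  have \<pi>t: "\<pi> \<circ> t \<in> tabs ?D"
    using perm t D(3) by (simp add: tabs_comp)
  have rows: "rows ?D' s = rows ?D (\<pi> \<circ> t)"
  proof (rule ext, rule set_eqI)
    fix i x
    have "rowno ?D (\<pi> \<circ> t) x = rowno ?D' s x" if x: "x \<in> {1..n}"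
    proof -
      obtain i j where ij: "(i, j) \<in> ?D" "x = (\<pi> \<circ> t) (i, j)"
        using entry_of_box[OF \<pi>t, of x] x D(3) by metis
      then have "rowno ?D (\<pi> \<circ> t) x = i"
        using box_of_entry(1)[OF \<pi>t] by simp
      moreover have "rowno ?D' s x = i"
        using b(2)[OF ij(1)] ij(2) by (simp add: b_def)
      ultimately show ?thesis
        by simp
    qed
    then show "x \<in> rows ?D' s i \<longleftrightarrow> x \<in> rows ?D (\<pi> \<circ> t) i"
      unfolding mem_rows_iff[OF s] mem_rows_iff[OF \<pi>t] D(3) D'(3) by auto
  qed
  \<comment> \<open>A tabloid determines its shape through the sizes of its rows.\<close>
  have "p' i = p i" for i
    using card_rows[OF s, of i] card_rows[OF \<pi>t, of i] rows by simp
  then show "p' = p \<and> (\<exists>\<pi>\<in>colst ?D t. rows ?D' s = rows ?D (\<pi> \<circ> t))"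
    using rows \<pi> by auto
qed

text \<open>If two entries shared a row of \<open>s\<close> and a column of \<open>t\<close>, the
  vector would vanish. So \<open>tableaux_dominance\<close> applies, and in the case of equal
  heights the tabloid of \<open>s\<close> is a column permutation of that of
  \<open>t\<close>.\<close>

lemma kappa_delta:
  assumes p: "p \<in> young n" "p' \<in> young n" and t: "t \<in> tabs (diag p)" and s: "s \<in> tabs (diag p')"
    and nz: "kappa (diag p) t (delta (rows (diag p') s)) \<noteq> 0"
  shows "height p \<le> height p'"
    and "height p = height p' \<Longrightarrow>
      p' = p \<and> (\<exists>a. kappa (diag p) t (delta (rows (diag p') s)) = fscale a (ptab (diag p) t))"
proof -
  note D = youngD[OF p(1)] and D' = youngD[OF p(2)]
  have inj: "inj_on (\<lambda>x. (rowno (diag p') s x, colno (diag p) t x)) {1..n}"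
  proof (rule inj_onI, rule ccontr)
    fix x y
    assume "x \<in> {1..n}" "y \<in> {1..n}" "x \<noteq> y"
      "(rowno (diag p') s x, colno (diag p) t x) = (rowno (diag p') s y, colno (diag p) t y)"
    then show False
      using kappa_delta_eq_0[OF t s, of x y] nz unfolding D(3) D'(3) by blast
  qed
  show "height p \<le> height p'"
    by (rule tableaux_dominance(1)[OF p t s inj])
  assume h: "height p = height p'"
  obtain \<pi> where "p' = p" and \<pi>: "\<pi> \<in> colst (diag p) t" "rows (diag p') s = rows (diag p) (\<pi> \<circ> t)"
    using tableaux_dominance(2)[OF p t s inj h] by blast
  then have "kappa (diag p) t (delta (rows (diag p') s)) = fscale (of_int (sign \<pi>)) (ptab (diag p) t)"
    by (simp add: rows_relabel kappa_act[OF t] ptab_eq_kappa flip: act_delta[OF colst_bij])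
  with \<open>p' = p\<close> show "p' = p \<and>
      (\<exists>a. kappa (diag p) t (delta (rows (diag p') s)) = fscale a (ptab (diag p) t))"
    by blast
qed

section \<open>Antisymmetrizers on Specht modules: vanishing and rank one\<close>

definition tabloids :: "(nat \<times> nat) set \<Rightarrow> (nat \<Rightarrow> nat set) set" where
  "tabloids D = rows D ` tabs D"

text \<open>Tableaux take arbitrary values off \<open>D\<close>, so finiteness is obtained from
  their restrictions to \<open>D\<close>, which have the same rows.\<close>

lemma finite_tabloids:
  assumes "finite D"
  shows "finite (tabloids D)"
proof (rule finite_subset)
  show "tabloids D \<subseteq> rows D ` (D \<rightarrow>\<^sub>E {1..card D})"
  proof
    fix T assume "T \<in> tabloids D"
    then obtain t where t: "t \<in> tabs D" "T = rows D t"
      by (auto simp: tabloids_def)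
    have "restrict t D \<in> D \<rightarrow>\<^sub>E {1..card D}"
      using box_of_entry(3)[OF t(1)] by (auto simp: PiE_def)
    moreover have "rows D (restrict t D) = T"
      by (auto simp: t(2) rows_def)
    ultimately show "T \<in> rows D ` (D \<rightarrow>\<^sub>E {1..card D})"
      by blast
  qed
  show "finite (rows D ` (D \<rightarrow>\<^sub>E {1..card D}))"
    using assms by (simp add: finite_PiE)
qed

lemma ptab_free: "t \<in> tabs D \<Longrightarrow> ptab D t \<in> free_space (tabloids D)"
  unfolding ptab_def free_space_def tabloids_def
  by (intro fs.span_sum fs.span_scale fs.span_base imageI tabs_comp colst_permutes)

lemma subspace_Sp: "fs.subspace (Sp D)"
  by (simp add: Sp_def)

lemma Sp_subset: "Sp D \<subseteq> free_space (tabloids D)"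
  unfolding Sp_def using ptab_free by (intro fs.span_minimal subspace_free_space) auto

lemma Sp_outside: "finite D \<Longrightarrow> F \<in> Sp D \<Longrightarrow> T \<notin> tabloids D \<Longrightarrow> F T = 0"
  using Sp_subset[of D] free_space_iff[OF finite_tabloids] by blast

lemma kappa_expand:
  assumes "finite D'" "F \<in> Sp D'"
  shows "kappa D t F = (\<Sum>T\<in>tabloids D'. fscale (F T) (kappa D t (delta T)))"
proof -
  have "F = (\<Sum>T\<in>tabloids D'. fscale (F T) (delta T))"
    using fun_eq_sum_delta[OF finite_tabloids] Sp_outside assms by blast
  then show ?thesis
    by (metis (no_types, lifting) kappa_sum kappa_scale sum.cong)
qed

text \<open>A tabloid that survives forces \<open>height p \<le> height p'\<close>, hence equal
  heights, and then equal shapes.\<close>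

lemma kappa_Sp_eq_0:
  assumes p: "p \<in> young n" "p' \<in> young n" and t: "t \<in> tabs (diag p)"
    and F: "F \<in> Sp (diag p')" and h: "height p' \<le> height p" "p' \<noteq> p"
  shows "kappa (diag p) t F = 0"
proof -
  have "kappa (diag p) t (delta T) = 0" if "T \<in> tabloids (diag p')" for T
  proof (rule ccontr)
    assume nz: "\<not> ?thesis"
    obtain s where "s \<in> tabs (diag p')" "T = rows (diag p') s"
      using \<open>T \<in> _\<close> by (auto simp: tabloids_def)
    then show False
      using kappa_delta[OF p t] nz h by (metis antisym)
  qed
  then show ?thesis
    by (simp add: kappa_expand[OF youngD(2)[OF p(2)] F])
qed

text \<open>On its own Specht module the antisymmetrizer has rank at most one, because it maps every
  single tabloid of the shape to a multiple of the polytabloid.\<close>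

lemma kappa_Sp_multiple:
  assumes p: "p \<in> young n" and t: "t \<in> tabs (diag p)" and F: "F \<in> Sp (diag p)"
  shows "\<exists>a. kappa (diag p) t F = fscale a (ptab (diag p) t)"
proof -
  have "\<exists>a. kappa (diag p) t (delta T) = fscale a (ptab (diag p) t)" if "T \<in> tabloids (diag p)" for T
  proof (cases "kappa (diag p) t (delta T) = 0")
    case True
    then show ?thesis
      by (intro exI[of _ 0]) simp
  next
    case False
    obtain s where "s \<in> tabs (diag p)" "T = rows (diag p) s"
      using \<open>T \<in> _\<close> by (auto simp: tabloids_def)
    then show ?thesis
      using kappa_delta(2)[OF p p t] False by blast
  qed
  then obtain a where "\<And>T. T \<in> tabloids (diag p) \<Longrightarrow>
      kappa (diag p) t (delta T) = fscale (a T) (ptab (diag p) t)"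
    by metis
  then have "kappa (diag p) t F = fscale (\<Sum>T\<in>tabloids (diag p). F T * a T) (ptab (diag p) t)"
    by (simp add: kappa_expand[OF youngD(2)[OF p] F] fs.scale_sum_left)
  then show ?thesis
    by blast
qed

section \<open>The invariant Hermitian inner product\<close>

definition inner_prod ::
  "(nat \<times> nat) set \<Rightarrow> ((nat \<Rightarrow> nat set) \<Rightarrow> complex) \<Rightarrow> ((nat \<Rightarrow> nat set) \<Rightarrow> complex) \<Rightarrow> complex" where
  "inner_prod D F G = (\<Sum>T\<in>tabloids D. F T * cnj (G T))"

lemma inner_prod_self_eq_0:
  assumes "finite D" "F \<in> Sp D" "inner_prod D F F = 0"
  shows "F = 0"
proof -
  have "inner_prod D F F = of_real (\<Sum>T\<in>tabloids D. (cmod (F T))\<^sup>2)"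
    by (simp add: inner_prod_def complex_mult_cnj cmod_power2)
  then have "(\<Sum>T\<in>tabloids D. (cmod (F T))\<^sup>2) = 0"
    using assms(3) by (metis of_real_eq_0_iff)
  then have "F T = 0" if "T \<in> tabloids D" for T
    using that finite_tabloids[OF assms(1)] by (simp add: sum_nonneg_eq_0_iff)
  then show ?thesis
    using Sp_outside[OF assms(1,2)] by (auto simp: fun_eq_iff)
qed

text \<open>The antisymmetrizer is self-adjoint: permutations act unitarily and an inverse has the
  same real sign.\<close>

lemma inner_prod_ptab:
  assumes D: "finite D" and t: "t \<in> tabs D"
  shows "inner_prod D F (ptab D t) = kappa D t F (rows D t)"
proof -
  have "inner_prod D F (ptab D t) =
      (\<Sum>T\<in>tabloids D. \<Sum>\<pi>\<in>colst D t. if T = rows D (\<pi> \<circ> t) then of_int (sign \<pi>) * F T else 0)"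
    by (auto simp: inner_prod_def ptab_def sum_fun_apply fscale_apply delta_def cnj_sum
        sum_distrib_left intro!: sum.cong)
  also have "\<dots> = (\<Sum>\<pi>\<in>colst D t. \<Sum>T\<in>tabloids D. if T = rows D (\<pi> \<circ> t) then of_int (sign \<pi>) * F T else 0)"
    by (rule sum.swap)
  also have "\<dots> = (\<Sum>\<pi>\<in>colst D t. of_int (sign \<pi>) * F (rows D (\<pi> \<circ> t)))"
  proof (rule sum.cong[OF refl])
    fix \<pi> assume "\<pi> \<in> colst D t"
    then have "rows D (\<pi> \<circ> t) \<in> tabloids D"
      by (simp add: tabloids_def tabs_comp[OF colst_permutes t])
    then show "(\<Sum>T\<in>tabloids D. if T = rows D (\<pi> \<circ> t) then of_int (sign \<pi>) * F T else 0) =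
        of_int (sign \<pi>) * F (rows D (\<pi> \<circ> t))"
      using finite_tabloids[OF D] by simp
  qed
  also have "\<dots> = (\<Sum>\<pi>\<in>colst D t. of_int (sign \<pi>) * F (relabel (inv \<pi>) (rows D t)))"
    by (rule sum.reindex_bij_witness[of _ inv inv])
       (auto simp: colst_inv[OF t] colst_bij inv_inv_eq sign_inverse colst_perm rows_relabel)
  also have "\<dots> = kappa D t F (rows D t)"
    by (simp add: kappa_def sum_fun_apply fscale_apply act_def)
  finally show ?thesis .
qed

text \<open>The inner product with a polytabloid is a coefficient of the antisymmetrized vector, so a
  vector killed by all antisymmetrizers is orthogonal to the Specht module.\<close>

lemma kappa_nondegenerate:
  assumes D: "finite D" and F: "F \<in> Sp D" and 0: "\<And>t. t \<in> tabs D \<Longrightarrow> kappa D t F = 0"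
  shows "F = 0"
proof -
  have "inner_prod D F G = 0" if "G \<in> Sp D" for G
    using that unfolding Sp_def
  proof (induction rule: fs.span_induct)
    case base
    show ?case
      by (auto simp: fs.subspace_def inner_prod_def fscale_apply distrib_left sum.distrib
          mult.left_commute sum_distrib_left[symmetric])
  next
    case (step G)
    then show ?case
      using inner_prod_ptab[OF D] 0 by auto
  qed
  then show ?thesis
    using inner_prod_self_eq_0[OF D F] F by blast
qed

lemma colst_conj:
  assumes \<sigma>: "\<sigma> permutes {1..card D}" and "\<pi> \<in> colst D t"
  shows "\<sigma> \<circ> \<pi> \<circ> inv \<sigma> \<in> colst D (\<sigma> \<circ> t)"
proof -
  have "\<sigma> \<circ> \<pi> \<circ> inv \<sigma> permutes {1..card D}"
    by (intro permutes_compose permutes_inv \<sigma> colst_permutes[OF assms(2)])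
  then show ?thesis
    using assms(2) unfolding colst_def
    by (auto simp: permutes_inverses(2)[OF \<sigma>]) (metis (no_types))
qed

text \<open>Conjugation by \<open>\<sigma>\<close> carries the column stabilizer of \<open>t\<close>
  to that of \<open>\<sigma> \<circ> t\<close> and preserves signs.\<close>

lemma act_ptab:
  assumes \<sigma>: "\<sigma> permutes {1..card D}"
  shows "act \<sigma> (ptab D t) = ptab D (\<sigma> \<circ> t)"
proof -
  have b: "bij \<sigma>" "permutation \<sigma>" and inv: "inv \<sigma> \<circ> \<sigma> = id" "\<sigma> \<circ> inv \<sigma> = id"
    using \<sigma> permutes_bij permutation_permutes permutes_inv_o by blast+
  have "act \<sigma> (ptab D t) = (\<Sum>\<pi>\<in>colst D t. fscale (of_int (sign \<pi>)) (delta (rows D (\<sigma> \<circ> \<pi> \<circ> t))))"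
    by (simp add: ptab_def act_sum act_scale act_delta[OF b(1)] o_assoc flip: rows_relabel)
  also have "\<dots> = ptab D (\<sigma> \<circ> t)"
    unfolding ptab_def
  proof (rule sum.reindex_bij_witness[of _ "\<lambda>\<pi>. inv \<sigma> \<circ> \<pi> \<circ> \<sigma>" "\<lambda>\<pi>. \<sigma> \<circ> \<pi> \<circ> inv \<sigma>"], goal_cases)
    case (1 \<pi>)
    show ?case
      using inv by (simp add: fun_eq_iff)
  next
    case (2 \<pi>)
    then show ?case
      by (rule colst_conj[OF \<sigma>])
  next
    case (3 \<pi>)
    show ?case
      using inv by (simp add: fun_eq_iff)
  next
    case (4 \<pi>)
    then show ?case
      using colst_conj[OF permutes_inv[OF \<sigma>], of \<pi> "\<sigma> \<circ> t"] inv(1) permutes_inv_inv[OF \<sigma>]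
      by (simp add: o_assoc)
  next
    case (5 \<pi>)
    have "sign (\<sigma> \<circ> \<pi> \<circ> inv \<sigma>) = sign \<pi>"
      using b(2) colst_perm[OF 5]
      by (simp add: sign_compose permutation_compose permutation_inverse sign_inverse sign_idempotent)
    moreover have "\<sigma> \<circ> \<pi> \<circ> inv \<sigma> \<circ> (\<sigma> \<circ> t) = \<sigma> \<circ> \<pi> \<circ> t"
      using inv by (simp add: fun_eq_iff)
    ultimately show ?case
      by simp
  qed
  finally show ?thesis .
qed

lemma act_Sp:
  assumes "\<sigma> permutes {1..card D}" "F \<in> Sp D"
  shows "act \<sigma> F \<in> Sp D"
  using assms(2) unfolding Sp_def
proof (induction rule: fs.span_induct)
  case base
  show ?case
    by (auto simp: fs.subspace_def act_add act_scale fs.span_zero fs.span_add fs.span_scale)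
next
  case (step F)
  then show ?case
    using act_ptab[OF assms(1)] tabs_comp[OF assms(1)] by (auto intro!: fs.span_base)
qed

text \<open>Needed since the permutation between two tableaux can match them only on
  \<open>D\<close>; their values elsewhere are arbitrary.\<close>

lemma ptab_cong:
  assumes "\<And>b. b \<in> D \<Longrightarrow> s b = t b"
  shows "ptab D s = ptab D t"
proof -
  have "colst D s = colst D t"
    unfolding colst_def using assms by (intro Collect_cong conj_cong refl) (metis (no_types, lifting))
  moreover have "rows D (\<pi> \<circ> s) = rows D (\<pi> \<circ> t)" for \<pi>
    unfolding rows_def using assms by (intro ext Collect_cong) (metis comp_apply)
  ultimately show ?thesis
    by (simp add: ptab_def)
qed

lemma ptab_transitive:
  assumes "t \<in> tabs D" "s \<in> tabs D"
  shows "\<exists>\<sigma>. \<sigma> permutes {1..card D} \<and> ptab D s = act \<sigma> (ptab D t)"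
proof -
  let ?N = "{1..card D}"
  define \<sigma> where "\<sigma> x = (if x \<in> ?N then s (inv_into D t x) else x)" for x
  have t: "bij_betw t D ?N" and s: "bij_betw s D ?N"
    using assms by (simp_all add: tabs_def)
  have "bij_betw (s \<circ> inv_into D t) ?N ?N"
    using bij_betw_trans[OF bij_betw_inv_into[OF t] s] .
  then have "bij_betw \<sigma> ?N ?N"
    by (rule bij_betw_cong[THEN iffD1, rotated]) (simp add: \<sigma>_def)
  then have perm: "\<sigma> permutes ?N"
    by (rule bij_imp_permutes) (auto simp: \<sigma>_def)
  have "s b = (\<sigma> \<circ> t) b" if "b \<in> D" for b
    using t that bij_betwE[OF t] by (auto simp: \<sigma>_def bij_betw_inv_into_left)
  then have "ptab D s = act \<sigma> (ptab D t)"
    unfolding act_ptab[OF perm] by (rule ptab_cong)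
  then show ?thesis
    using perm by blast
qed

lemma relabel_tabloids:
  assumes "\<sigma> permutes {1..card D}" "T \<in> tabloids D"
  shows "relabel \<sigma> T \<in> tabloids D"
  using assms tabs_comp by (auto simp: tabloids_def simp flip: rows_relabel)

lemma inner_prod_act:
  assumes \<sigma>: "\<sigma> permutes {1..card D}"
  shows "inner_prod D (act \<sigma> F) (act \<sigma> G) = inner_prod D F G"
  unfolding inner_prod_def act_def
  by (rule sum.reindex_bij_witness[of _ "relabel \<sigma>" "relabel (inv \<sigma>)"])
     (simp_all add: relabel_inv[OF permutes_bij[OF \<sigma>]] relabel_tabloids[OF \<sigma>]
       relabel_tabloids[OF permutes_inv[OF \<sigma>]])


section \<open>Invariants in Specht modules\<close>

definition fixed :: "nat \<Rightarrow> ((nat \<Rightarrow> nat set) \<Rightarrow> complex) \<Rightarrow> bool" where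
  "fixed a F \<longleftrightarrow> (\<forall>h. h permutes {1..a} \<longrightarrow> act h F = F)"

text \<open>Keeps the tabloids with \<open>n\<close> in row \<open>i\<close> and erases
  \<open>n\<close> from them. The value \<open>0\<close> at a \<open>T\<close> that already contains
  \<open>n\<close> makes the result a function on tabloids of the smaller shape.\<close>

definition strip ::
  "nat \<Rightarrow> nat \<Rightarrow> ((nat \<Rightarrow> nat set) \<Rightarrow> complex) \<Rightarrow> (nat \<Rightarrow> nat set) \<Rightarrow> complex" where
  "strip n i F = (\<lambda>T. if \<exists>k. n \<in> T k then 0 else F (T(i := insert n (T i))))"

lemma strip_zero [simp]: "strip n i 0 = 0"
  by (simp add: strip_def fun_eq_iff)

lemma strip_add: "strip n i (F + G) = strip n i F + strip n i G"
  by (simp add: strip_def fun_eq_iff)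

lemma strip_scale: "strip n i (fscale a F) = fscale a (strip n i F)"
  by (simp add: strip_def fscale_def fun_eq_iff)

lemma strip_sum: "strip n i (\<Sum>j\<in>J. F j) = (\<Sum>j\<in>J. strip n i (F j))"
  by (rule ext) (simp add: strip_def sum_fun_apply)

text \<open>Permutations that fix \<open>n\<close> form the smaller symmetric group, so stripping is
  a map of its representations.\<close>

lemma strip_act:
  assumes "bij h" "h n = n"
  shows "strip n i (act h F) = act h (strip n i F)"
proof
  fix T :: "nat \<Rightarrow> nat set"
  have inv: "inv h n = n"
    using assms by (metis bij_is_inj inv_f_f)
  have "n \<in> inv h ` T k \<longleftrightarrow> n \<in> T k" for k
    using assms inv by (metis (no_types, lifting) bij_inv_eq_iff image_iff)
  moreover have "relabel (inv h) (T(i := insert n (T i))) =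
      (relabel (inv h) T)(i := insert n (relabel (inv h) T i))"
    by (simp add: relabel_def fun_eq_iff inv)
  ultimately show "strip n i (act h F) T = act h (strip n i F) T"
    by (simp add: strip_def act_def) (auto simp: relabel_def)
qed

text \<open>A tableau \<open>t'\<close> of the shape without the corner in row \<open>i\<close> is
  extended to \<open>t\<close> by the largest entry \<open>Suc m\<close> in that corner.\<close>

locale corner =
  fixes p :: "nat \<Rightarrow> nat" and m i :: nat and t' :: "nat \<times> nat \<Rightarrow> nat"
  assumes p: "p \<in> young (Suc m)" and i: "i \<in> removable p"
    and t': "t' \<in> tabs (diag (drop_box p i))"
begin

definition t :: "nat \<times> nat \<Rightarrow> nat" where
  "t = t'((i, p i - Suc 0) := Suc m)"

lemma card_diag: "card (diag p) = Suc m" "card (diag (drop_box p i)) = m"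
  using youngD(3)[OF p] youngD(3)[OF drop_young[OF p i]] by simp_all

lemma diag_insert: "diag p = insert (i, p i - Suc 0) (diag (drop_box p i))"
  using corner_in_diag[OF i] by (auto simp: diag_drop[OF i])

lemma corner_notin: "(i, p i - Suc 0) \<notin> diag (drop_box p i)"
  by (simp add: diag_drop[OF i])

lemma t_eq: "b \<in> diag (drop_box p i) \<Longrightarrow> t b = t' b"
  using corner_notin by (auto simp: t_def)

lemma t_le: "b \<in> diag (drop_box p i) \<Longrightarrow> t b \<in> {1..m}"
  using t' card_diag(2) by (auto simp: t_eq tabs_def dest: bij_betwE)

lemma t_corner: "t (i, p i - Suc 0) = Suc m"
  by (simp add: t_def)

lemma t_eq_top: "b \<in> diag p \<Longrightarrow> t b = Suc m \<Longrightarrow> b = (i, p i - Suc 0)"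
  using t_le by (fastforce simp: diag_insert)

lemma t_tabs: "t \<in> tabs (diag p)"
proof -
  have "bij_betw t (diag (drop_box p i)) {1..m}"
    using t' card_diag(2) by (simp add: tabs_def bij_betw_cong[OF t_eq])
  then have "bij_betw t (diag (drop_box p i) \<union> {(i, p i - Suc 0)}) ({1..m} \<union> {t (i, p i - Suc 0)})"
    using notIn_Un_bij_betw[OF corner_notin, of t "{1..m}"] t_corner by simp
  then show ?thesis
    unfolding tabs_def mem_Collect_eq card_diag(1)
    by (simp add: diag_insert t_corner atLeastAtMostSuc_conv)
qed

lemma colst_drop:
  "colst (diag (drop_box p i)) t' = {\<pi> \<in> colst (diag p) t. \<pi> (Suc m) = Suc m}"
proof (intro set_eqI iffI)
  fix \<pi> assume \<pi>: "\<pi> \<in> colst (diag (drop_box p i)) t'"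
  then have perm: "\<pi> permutes {1..m}"
    using colst_permutes card_diag(2) by metis
  then have top: "\<pi> (Suc m) = Suc m"
    by (rule permutes_not_in) simp
  have "\<pi> permutes {1..Suc m}"
    by (rule permutes_subset[OF perm]) simp
  moreover have "\<exists>i'. (i', l) \<in> diag p \<and> \<pi> (t (k, l)) = t (i', l)" if kl: "(k, l) \<in> diag p" for k l
  proof (cases "(k, l) = (i, p i - Suc 0)")
    case True
    then show ?thesis
      using kl top t_corner by auto
  next
    case False
    then have "(k, l) \<in> diag (drop_box p i)"
      using kl diag_insert by auto
    then obtain i' where "(i', l) \<in> diag (drop_box p i)" "\<pi> (t' (k, l)) = t' (i', l)"
      using \<pi> by (auto simp: colst_def)
    then show ?thesis
      using t_eq \<open>(k, l) \<in> diag (drop_box p i)\<close> diag_insert by auto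
  qed
  ultimately show "\<pi> \<in> {\<pi> \<in> colst (diag p) t. \<pi> (Suc m) = Suc m}"
    using top by (simp add: colst_def card_diag)
next
  fix \<pi> assume "\<pi> \<in> {\<pi> \<in> colst (diag p) t. \<pi> (Suc m) = Suc m}"
  then have \<pi>: "\<pi> \<in> colst (diag p) t" and top: "\<pi> (Suc m) = Suc m"
    by auto
  have perm: "\<pi> permutes {1..Suc m}"
    using colst_permutes[OF \<pi>] card_diag(1) by simp
  then have "\<pi> permutes {1..m}"
    by (rule permutes_superset) (auto simp: top le_Suc_eq)
  moreover have "\<exists>i'. (i', l) \<in> diag (drop_box p i) \<and> \<pi> (t' (k, l)) = t' (i', l)"
    if kl: "(k, l) \<in> diag (drop_box p i)" for k l
  proof -
    have "(k, l) \<in> diag p"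
      using kl diag_insert by auto
    then obtain i' where i': "(i', l) \<in> diag p" "\<pi> (t (k, l)) = t (i', l)"
      using \<pi> by (auto simp: colst_def)
    have "t (k, l) \<noteq> Suc m"
      using t_le[OF kl] by simp
    then have "\<pi> (t (k, l)) \<noteq> Suc m"
      using top permutes_inj[OF perm] by (metis injD)
    then have "(i', l) \<in> diag (drop_box p i)"
      using i' t_corner diag_insert by auto
    then show ?thesis
      using i' t_eq kl by auto
  qed
  ultimately show "\<pi> \<in> colst (diag (drop_box p i)) t'"
    by (simp add: colst_def card_diag)
qed

text \<open>A column permutation can move \<open>Suc m\<close> only within the column of the corner,
  and row \<open>k\<close> meets this column in a single box.\<close>

lemma top_in_row:
  assumes "\<pi> \<in> colst (diag p) t" "Suc m \<in> rows (diag p) (\<pi> \<circ> t) k"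
  shows "(k, p i - Suc 0) \<in> diag p" "\<pi> (t (k, p i - Suc 0)) = Suc m"
proof -
  obtain l where l: "(k, l) \<in> diag p" "\<pi> (t (k, l)) = Suc m"
    using assms(2) by (auto simp: rows_def)
  then obtain i' where "(i', l) \<in> diag p" "t (i', l) = Suc m"
    using assms(1) by (auto simp: colst_def) metis
  then have "l = p i - Suc 0"
    using t_eq_top by auto
  then show "(k, p i - Suc 0) \<in> diag p" "\<pi> (t (k, p i - Suc 0)) = Suc m"
    using l by simp_all
qed

lemma rows_insert:
  assumes "\<pi> (Suc m) = Suc m"
  shows "rows (diag p) (\<pi> \<circ> t) =
    (rows (diag (drop_box p i)) (\<pi> \<circ> t'))(i := insert (Suc m) (rows (diag (drop_box p i)) (\<pi> \<circ> t') i))"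
    (is "?L = ?R")
proof (intro ext set_eqI)
  fix k x
  have "x \<in> ?L k \<longleftrightarrow> (\<exists>l. (k, l) \<in> diag p \<and> x = \<pi> (t (k, l)))"
    by (auto simp: rows_def)
  also have "\<dots> \<longleftrightarrow> (k = i \<and> x = Suc m) \<or> (\<exists>l. (k, l) \<in> diag (drop_box p i) \<and> x = \<pi> (t (k, l)))"
    using assms t_corner by (auto simp: diag_insert)
  also have "\<dots> \<longleftrightarrow> (k = i \<and> x = Suc m) \<or> (\<exists>l. (k, l) \<in> diag (drop_box p i) \<and> x = \<pi> (t' (k, l)))"
    using t_eq by metis
  also have "\<dots> \<longleftrightarrow> x \<in> ?R k"
    by (auto simp: rows_def)
  finally show "x \<in> ?L k \<longleftrightarrow> x \<in> ?R k" .
qed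

lemma top_notin_rows:
  assumes "\<pi> \<in> colst (diag (drop_box p i)) t'"
  shows "Suc m \<notin> rows (diag (drop_box p i)) (\<pi> \<circ> t') k"
proof -
  have "\<pi> \<circ> t' \<in> tabs (diag (drop_box p i))"
    by (rule tabs_comp[OF colst_permutes[OF assms] t'])
  then show ?thesis
    using mem_rows_iff card_diag(2) by auto
qed

text \<open>In a term of the polytabloid \<open>Suc m\<close> lies in row \<open>i\<close> exactly
  when \<open>\<pi>\<close> fixes it. By \<open>colst_drop\<close> these \<open>\<pi>\<close> form
  the column stabilizer of \<open>t'\<close>, so what remains is the polytabloid of
  \<open>t'\<close>.\<close>

lemma strip_ptab: "strip (Suc m) i (ptab (diag p) t) = ptab (diag (drop_box p i)) t'"
proof
  fix T
  let ?D = "diag p" and ?D' = "diag (drop_box p i)"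
  show "strip (Suc m) i (ptab ?D t) T = ptab ?D' t' T"
  proof (cases "\<exists>k. Suc m \<in> T k")
    case True
    then have "T \<noteq> rows ?D' (\<pi> \<circ> t')" if "\<pi> \<in> colst ?D' t'" for \<pi>
      using top_notin_rows[OF that] by auto
    then show ?thesis
      using True by (auto simp: strip_def ptab_def sum_fun_apply fscale_apply delta_def intro!: sum.neutral)
  next
    case False
    have iff: "T(i := insert (Suc m) (T i)) = rows ?D (\<pi> \<circ> t) \<longleftrightarrow>
        \<pi> (Suc m) = Suc m \<and> T = rows ?D' (\<pi> \<circ> t')" if \<pi>: "\<pi> \<in> colst ?D t" for \<pi>
    proof
      assume eq: "T(i := insert (Suc m) (T i)) = rows ?D (\<pi> \<circ> t)"
      have "Suc m \<in> (T(i := insert (Suc m) (T i))) i"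
        by simp
      then have "Suc m \<in> rows ?D (\<pi> \<circ> t) i"
        unfolding eq .
      then have top: "\<pi> (Suc m) = Suc m"
        using top_in_row(2)[OF \<pi>] t_corner by metis
      then have "\<pi> \<in> colst ?D' t'"
        using \<pi> by (simp add: colst_drop)
      then have "T k = rows ?D' (\<pi> \<circ> t') k" for k
        using fun_cong[OF eq[unfolded rows_insert[where \<pi> = \<pi>, OF top]], of k] top_notin_rows[of \<pi> k] False
        by (cases "k = i") (auto simp: insert_ident)
      then show "\<pi> (Suc m) = Suc m \<and> T = rows ?D' (\<pi> \<circ> t')"
        using top by auto
    next
      assume "\<pi> (Suc m) = Suc m \<and> T = rows ?D' (\<pi> \<circ> t')"
      then show "T(i := insert (Suc m) (T i)) = rows ?D (\<pi> \<circ> t)"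
        using rows_insert by simp
    qed
    have "strip (Suc m) i (ptab ?D t) T = (\<Sum>\<pi>\<in>colst ?D t.
        if T(i := insert (Suc m) (T i)) = rows ?D (\<pi> \<circ> t) then of_int (sign \<pi>) else 0)"
      using False by (auto simp: strip_def ptab_def sum_fun_apply fscale_apply delta_def intro!: sum.cong)
    also have "\<dots> = (\<Sum>\<pi>\<in>colst ?D t.
        if \<pi> (Suc m) = Suc m then (if T = rows ?D' (\<pi> \<circ> t') then of_int (sign \<pi>) else 0) else 0)"
      using iff by (intro sum.cong refl) simp
    also have "\<dots> = (\<Sum>\<pi>\<in>colst ?D' t'. if T = rows ?D' (\<pi> \<circ> t') then of_int (sign \<pi>) else 0)"
      unfolding colst_drop by (rule sum.inter_filter[OF finite_colst, symmetric])
    also have "\<dots> = ptab ?D' t' T"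
      by (auto simp: ptab_def sum_fun_apply fscale_apply delta_def intro!: sum.cong)
    finally show ?thesis .
  qed
qed

text \<open>The column of a removable corner ends in row \<open>i\<close>, so no column permutation
  takes \<open>Suc m\<close> further down.\<close>

lemma strip_ptab_below:
  assumes "i < j"
  shows "strip (Suc m) j (ptab (diag p) t) = 0"
proof -
  have "T(j := insert (Suc m) (T j)) \<noteq> rows (diag p) (\<pi> \<circ> t)" if \<pi>: "\<pi> \<in> colst (diag p) t" for T \<pi>
  proof
    assume "T(j := insert (Suc m) (T j)) = rows (diag p) (\<pi> \<circ> t)"
    then have "Suc m \<in> rows (diag p) (\<pi> \<circ> t) j"
      by (metis fun_upd_same insertI1)
    then have "p i - Suc 0 < p j"
      using top_in_row(1)[OF \<pi>] by (simp add: diag_def)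
    moreover have "p j \<le> p (Suc i)"
      using youngD(1)[OF p] assms by (simp add: antimono_def)
    moreover have "p (Suc i) < p i"
      using i by (simp add: removable_def)
    ultimately show False
      by simp
  qed
  then show ?thesis
    by (auto simp: strip_def ptab_def sum_fun_apply fscale_apply delta_def fun_eq_iff[of "strip _ _ _"]
        intro!: sum.neutral)
qed

end

text \<open>One layer of the restriction filtration. The vanishing in the rows below
  \<open>i\<close> makes lifts from different corners triangular with respect to each other. The
  vectors with a lift form a subspace, so polytabloids suffice.\<close>

lemma lift_Sp:
  assumes p: "p \<in> young (Suc m)" and i: "i \<in> removable p" and F: "F \<in> Sp (diag (drop_box p i))"
  shows "\<exists>G\<in>Sp (diag p). strip (Suc m) i G = F \<and> (\<forall>j>i. strip (Suc m) j G = 0)"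
  using F unfolding Sp_def[of "diag (drop_box p i)"]
proof (induction rule: fs.span_induct)
  case base
  show ?case
    unfolding fs.subspace_def
  proof (intro conjI ballI allI; clarsimp)
    show "\<exists>G\<in>Sp (diag p). strip (Suc m) i G = 0 \<and> (\<forall>j>i. strip (Suc m) j G = 0)"
      using fs.subspace_0[OF subspace_Sp] by (intro bexI[of _ 0]) auto
  next
    fix G H
    assume "G \<in> Sp (diag p)" "H \<in> Sp (diag p)"
      "\<forall>j>i. strip (Suc m) j G = 0" "\<forall>j>i. strip (Suc m) j H = 0"
    then show "\<exists>K\<in>Sp (diag p). strip (Suc m) i K = strip (Suc m) i G + strip (Suc m) i H \<and>
        (\<forall>j>i. strip (Suc m) j K = 0)"
      by (intro bexI[of _ "G + H"]) (auto simp: strip_add fs.subspace_add[OF subspace_Sp])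
  next
    fix c G
    assume "G \<in> Sp (diag p)" "\<forall>j>i. strip (Suc m) j G = 0"
    then show "\<exists>K\<in>Sp (diag p). strip (Suc m) i K = fscale c (strip (Suc m) i G) \<and>
        (\<forall>j>i. strip (Suc m) j K = 0)"
      by (intro bexI[of _ "fscale c G"]) (auto simp: strip_scale fs.subspace_scale[OF subspace_Sp])
  qed
next
  case (step F)
  then obtain t' where t': "t' \<in> tabs (diag (drop_box p i))"
    and F: "F = ptab (diag (drop_box p i)) t'"
    by auto
  interpret corner p m i t'
    by unfold_locales (use p i t' in auto)
  have "ptab (diag p) t \<in> Sp (diag p)"
    by (simp add: Sp_def fs.span_base t_tabs)
  then show ?case
    using strip_ptab strip_ptab_below F by (intro bexI[of _ "ptab (diag p) t"]) simp_all
qed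

text \<open>The projection onto the invariants of the symmetric group on \<open>{1..a}\<close>; it
  preserves Specht modules and, for \<open>a \<le> m\<close>, commutes with stripping
  \<open>Suc m\<close>.\<close>

definition average :: "nat \<Rightarrow> ((nat \<Rightarrow> nat set) \<Rightarrow> complex) \<Rightarrow> (nat \<Rightarrow> nat set) \<Rightarrow> complex" where
  "average a F = fscale (1 / fact a) (\<Sum>h | h permutes {1..a}. act h F)"

lemma fixed_average: "fixed a (average a F)"
  unfolding fixed_def
proof (intro allI impI)
  fix g assume g: "g permutes {1..a}"
  have "(\<Sum>h | h permutes {1..a}. act g (act h F)) = (\<Sum>h | h permutes {1..a}. act (g \<circ> h) F)"
    using g by (intro sum.cong refl) (simp add: act_comp permutes_bij)
  also have "\<dots> = (\<Sum>h | h permutes {1..a}. act h F)"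
    by (rule sum.reindex_bij_witness[of _ "\<lambda>h. inv g \<circ> h" "\<lambda>h. g \<circ> h"])
       (use g in \<open>auto simp: o_assoc permutes_inv_o intro: permutes_compose permutes_inv\<close>)
  finally show "act g (average a F) = average a F"
    by (simp add: average_def act_scale act_sum)
qed

lemma average_fixed:
  assumes "fixed a F"
  shows "average a F = F"
proof -
  have "(\<Sum>h | h permutes {1..a}. act h F) = (\<Sum>h | h permutes {1..a}. F)"
    using assms by (intro sum.cong refl) (simp add: fixed_def)
  also have "\<dots> = fscale (fact a) F"
    by (rule ext) (simp add: sum_fun_apply fscale_apply card_permutations[of _ a] del: sum_constant
        flip: sum_distrib_right, simp add: card_permutations[of _ a])
  finally show ?thesis
    by (simp add: average_def)
qed

lemma strip_average:
  assumes "a \<le> m"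
  shows "strip (Suc m) i (average a F) = average a (strip (Suc m) i F)"
proof -
  have "strip (Suc m) i (act h F) = act h (strip (Suc m) i F)" if "h permutes {1..a}" for h
    using assms by (intro strip_act permutes_bij[OF that] permutes_not_in[OF that]) simp
  then show ?thesis
    by (simp add: average_def strip_scale strip_sum)
qed

lemma average_Sp:
  assumes "F \<in> Sp D" "a \<le> card D"
  shows "average a F \<in> Sp D"
  unfolding average_def using assms
  by (intro fs.subspace_scale[OF subspace_Sp] fs.subspace_sum[OF subspace_Sp] act_Sp)
     (auto intro: permutes_subset)

text \<open>Averaging a lift makes it invariant and leaves its strips correct: the strip in row
  \<open>i\<close> was invariant already, and the strips below were zero.\<close>

lemma lift_fixed:
  assumes p: "p \<in> young (Suc m)" and i: "i \<in> removable p" and F: "F \<in> Sp (diag (drop_box p i))"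
    and a: "fixed a F" "a \<le> m"
  shows "\<exists>G\<in>Sp (diag p). fixed a G \<and> strip (Suc m) i G = F \<and> (\<forall>j>i. strip (Suc m) j G = 0)"
proof -
  obtain G where G: "G \<in> Sp (diag p)" "strip (Suc m) i G = F" "\<forall>j>i. strip (Suc m) j G = 0"
    using lift_Sp[OF p i F] by blast
  have "fixed a (0 :: (nat \<Rightarrow> nat set) \<Rightarrow> complex)"
    by (simp add: fixed_def)
  then show ?thesis
    using G a youngD(3)[OF p]
    by (intro bexI[of _ "average a G"]) (auto simp: fixed_average strip_average average_fixed average_Sp)
qed

lemma lin_indep_reindex:
  assumes "bij_betw f J I" "lin_indep I w"
  shows "lin_indep J (w \<circ> f)"
  unfolding lin_indep_def
proof (intro allI impI ballI)
  fix c j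
  assume h: "(\<Sum>j\<in>J. fscale (c j) ((w \<circ> f) j)) = 0" and j: "j \<in> J"
  let ?c = "c \<circ> inv_into J f"
  have "(\<Sum>j\<in>J. fscale (?c (f j)) (w (f j))) = 0"
    using h assms(1) by (simp add: bij_betw_inv_into_left cong: sum.cong)
  then have "(\<Sum>i\<in>I. fscale (?c i) (w i)) = 0"
    using sum.reindex_bij_betw[OF assms(1), of "\<lambda>i. fscale (?c i) (w i)"] by simp
  then have "?c (f j) = 0"
    using lin_indepD[OF assms(2)] bij_betwE[OF assms(1)] j by blast
  then show "c j = 0"
    using assms(1) j by (simp add: bij_betw_inv_into_left)
qed

text \<open>Every column has one box, so the column stabilizer is trivial and only one tabloid
  occurs.\<close>

lemma ptab_one_row:
  assumes "t \<in> tabs (diag (one_row a))"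
  shows "ptab (diag (one_row a)) t = delta (\<lambda>i. if i = 0 then {1..a} else {})"
proof -
  let ?D = "diag (one_row a)"
  have card: "card ?D = a"
    using youngD(3)[OF one_row_young] .
  have rows: "rows ?D t = (\<lambda>i. if i = 0 then {1..a} else {})"
    using assms bij_betw_imp_surj_on[of t ?D "{1..a}"]
    by (auto simp: rows_def tabs_def card diag_one_row fun_eq_iff image_iff)
  have "\<pi> = id" if \<pi>: "\<pi> \<in> colst ?D t" for \<pi>
  proof
    fix x
    show "\<pi> x = id x"
    proof (cases "x \<in> {1..a}")
      case True
      then have "x \<in> t ` ?D"
        using assms by (simp add: tabs_def card bij_betw_def)
      then obtain l where "x = t (0, l)" "(0, l) \<in> ?D"
        by (auto simp: diag_one_row)
      then show ?thesis
        using \<pi> by (auto simp: colst_def diag_one_row)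
    next
      case False
      then show ?thesis
        using permutes_not_in[OF colst_permutes[OF \<pi>]] card by simp
    qed
  qed
  moreover have "id \<in> colst ?D t"
    by (auto simp: colst_def permutes_id)
  ultimately have "colst ?D t = {id}"
    by auto
  then show ?thesis
    by (simp add: ptab_def rows sign_id)
qed

text \<open>Restricting the Specht module of \<open>p\<close> to the next smaller symmetric group gives a filtration
  whose factors map onto the Specht modules obtained by removing a corner; iterating, a path from
  the one-row shape \<open>a\<close> to \<open>p\<close> contributes one invariant of the symmetric group on \<open>{1..a}\<close>.\<close>

lemma invariants_exist:
  "p \<in> young (a + k) \<Longrightarrow>
    \<exists>w. (\<forall>j<paths a k p. w j \<in> Sp (diag p) \<and> fixed a (w j)) \<and> lin_indep {..<paths a k p} w"
proof (induction k arbitrary: p)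
  case 0
  show ?case
  proof (cases "p = one_row a")
    case True
    let ?D = "diag (one_row a)"
    define R where "R = (\<lambda>i::nat. if i = 0 then {1..a} else {})"
    have "bij_betw (\<lambda>(i, j). Suc j) ?D {1..a}"
      unfolding diag_one_row by (rule bij_betw_byWitness[of _ "\<lambda>x. (0, x - 1)"]) auto
    then have t: "(\<lambda>(i, j). Suc j) \<in> tabs ?D"
      using youngD(3)[OF one_row_young] by (simp add: tabs_def)
    have "delta R \<in> Sp ?D"
      unfolding Sp_def R_def ptab_one_row[OF t, symmetric] by (intro fs.span_base imageI t)
    moreover have "fixed a (delta R)"
    proof -
      have "relabel h R = R" if "h permutes {1..a}" for h
        by (rule ext) (simp only: relabel_def R_def permutes_image[OF that] image_empty simp_thms split: if_split)
      then show ?thesis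
        by (simp add: fixed_def act_delta permutes_bij)
    qed
    moreover have "lin_indep {..<1::nat} (\<lambda>_. delta R)"
      by (auto simp: lin_indep_def fun_eq_iff fscale_apply delta_def split: if_splits)
    ultimately show ?thesis
      using True by (intro exI[of _ "\<lambda>_. delta R"]) simp
  next
    case False
    then show ?thesis
      by (simp add: lin_indep_def)
  qed
next
  case (Suc k)
  let ?R = "removable p" and ?n = "Suc (a + k)"
  define K where "K i = {..<paths a k (drop_box p i)}" for i
  have p: "p \<in> young (Suc (a + k))"
    using Suc.prems by simp
  have finR: "finite ?R"
    using finite_removable youngD(2)[OF p] by blast
  have "\<forall>i\<in>?R. \<exists>w. (\<forall>j\<in>K i. w j \<in> Sp (diag (drop_box p i)) \<and> fixed a (w j)) \<and> lin_indep (K i) w"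
    unfolding K_def Ball_def lessThan_iff using Suc.IH[OF drop_young[OF p]] by blast
  then obtain w where w: "\<And>i j. i \<in> ?R \<Longrightarrow> j \<in> K i \<Longrightarrow> w i j \<in> Sp (diag (drop_box p i)) \<and> fixed a (w i j)"
    and ind: "\<And>i. i \<in> ?R \<Longrightarrow> lin_indep (K i) (w i)"
    by (metis (no_types))
  have "\<exists>G. G \<in> Sp (diag p) \<and> fixed a G \<and> strip ?n i G = w i j \<and> (\<forall>j>i. strip ?n j G = 0)"
    if "i \<in> ?R" "j \<in> K i" for i j
    using lift_fixed[OF p that(1), of "w i j" a] w[OF that] by auto
  then obtain G where G: "\<And>i j. i \<in> ?R \<Longrightarrow> j \<in> K i \<Longrightarrow>
      G i j \<in> Sp (diag p) \<and> fixed a (G i j) \<and> strip ?n i (G i j) = w i j \<and> (\<forall>l>i. strip ?n l (G i j) = 0)"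
    by metis
  define I where "I = (SIGMA i:?R. K i)"
  have finI: "finite I" and card: "card I = paths a (Suc k) p"
    using finR by (simp_all add: I_def K_def)
  have "lin_indep I (\<lambda>(i, j). G i j)"
    unfolding lin_indep_def
  proof (intro allI impI, rule ccontr)
    fix c
    assume 0: "(\<Sum>x\<in>I. fscale (c x) (case x of (i, j) \<Rightarrow> G i j)) = 0" and "\<not> (\<forall>x\<in>I. c x = 0)"
    define B where "B = {i \<in> ?R. \<exists>j\<in>K i. c (i, j) \<noteq> 0}"
    have "finite B" "B \<noteq> {}"
      using finR \<open>\<not> _\<close> by (auto simp: B_def I_def)
    \<comment> \<open>The lowest corner with a nonzero coefficient. Stripping in its row kills the
      lifts from corners higher up, and corners further down have coefficient zero, so a relation
      among the invariants \<open>w i\<close> alone is left.\<close>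
    define i where "i = Max B"
    have i: "i \<in> B" "\<And>i'. i' \<in> B \<Longrightarrow> i' \<le> i"
      using \<open>finite B\<close> \<open>B \<noteq> {}\<close> by (auto simp: i_def)
    then have iR: "i \<in> ?R"
      by (simp add: B_def)
    have "0 = (\<Sum>x\<in>I. fscale (c x) (strip ?n i (case x of (i, j) \<Rightarrow> G i j)))"
      using arg_cong[OF 0, of "strip ?n i"] by (simp add: strip_sum strip_scale)
    also have "\<dots> = (\<Sum>i'\<in>?R. \<Sum>j\<in>K i'. fscale (c (i', j)) (strip ?n i (G i' j)))"
      unfolding I_def using finR by (subst sum.Sigma) (auto simp: K_def intro!: sum.cong)
    also have "\<dots> = (\<Sum>i'\<in>{i}. \<Sum>j\<in>K i'. fscale (c (i', j)) (strip ?n i (G i' j)))"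
    proof (rule sum.mono_neutral_right[OF finR])
      show "\<forall>i'\<in>?R - {i}. (\<Sum>j\<in>K i'. fscale (c (i', j)) (strip ?n i (G i' j))) = 0"
      proof (intro ballI sum.neutral)
        fix i' j assume h: "i' \<in> ?R - {i}" "j \<in> K i'"
        show "fscale (c (i', j)) (strip ?n i (G i' j)) = 0"
        proof (cases "i' < i")
          case True
          then show ?thesis
            using G[of i' j] h by simp
        next
          case False
          then have "i' \<notin> B"
            using i(2) h by force
          then show ?thesis
            using h by (simp add: B_def)
        qed
      qed
    qed (use iR in simp)
    also have "\<dots> = (\<Sum>j\<in>K i. fscale (c (i, j)) (w i j))"
      using G[OF iR] by (simp cong: sum.cong)
    finally have "c (i, j) = 0" if "j \<in> K i" for j
      using lin_indepD[OF ind[OF iR], of "\<lambda>j. c (i, j)"] that by simp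
    then show False
      using i(1) by (simp add: B_def)
  qed
  moreover obtain f where f: "bij_betw f {..<paths a (Suc k) p} I"
    using ex_bij_betw_nat_finite[OF finI] card by (auto simp: atLeast0LessThan)
  ultimately have "lin_indep {..<paths a (Suc k) p} ((\<lambda>(i, j). G i j) \<circ> f)"
    by (intro lin_indep_reindex)
  moreover have "((\<lambda>(i, j). G i j) \<circ> f) j \<in> Sp (diag p) \<and> fixed a (((\<lambda>(i, j). G i j) \<circ> f) j)"
    if "j < paths a (Suc k) p" for j
  proof -
    have "f j \<in> I"
      using bij_betwE[OF f] that by blast
    then show ?thesis
      using G by (auto simp: I_def)
  qed
  ultimately show ?case
    by blast
qed


section \<open>Maps into permutation modules\<close>

text \<open>The column antisymmetrizer of a tableau of maximal height among the shapes that occur kills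
  all other shapes and maps its own Specht module to a line.\<close>

lemma isotypic_independent:
  fixes \<Theta> :: "'i \<Rightarrow> ((nat \<Rightarrow> nat set) \<Rightarrow> complex) \<Rightarrow> 'x \<Rightarrow> complex"
  assumes fin: "finite A" and pr: "\<And>x. x \<in> A \<Longrightarrow> pr x \<in> young n"
    and add: "\<And>x F G. \<Theta> x (F + G) = \<Theta> x F + \<Theta> x G"
    and scale: "\<And>x a F. \<Theta> x (fscale a F) = fscale a (\<Theta> x F)"
    and L_add: "\<And>\<sigma> f g. L \<sigma> (f + g) = L \<sigma> f + L \<sigma> g"
    and L_scale: "\<And>\<sigma> a f. L \<sigma> (fscale a f) = fscale a (L \<sigma> f)"
    and equi: "\<And>x \<sigma> F. x \<in> A \<Longrightarrow> \<sigma> permutes {1..n} \<Longrightarrow> F \<in> Sp (diag (pr x)) \<Longrightarrow>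
        \<Theta> x (act \<sigma> F) = L \<sigma> (\<Theta> x F)"
    and ind: "\<And>p a x. (\<And>F. F \<in> Sp (diag p) \<Longrightarrow>
          (\<Sum>x\<in>{x \<in> A. pr x = p}. fscale (a x) (\<Theta> x F)) = 0) \<Longrightarrow>
        x \<in> A \<Longrightarrow> pr x = p \<Longrightarrow> a x = 0"
    and v: "\<And>x. x \<in> A \<Longrightarrow> v x \<in> Sp (diag (pr x))"
    and 0: "(\<Sum>x\<in>A. \<Theta> x (v x)) = 0"
    and x: "x \<in> A"
  shows "v x = 0"
proof (rule ccontr)
  have \<Theta>0: "\<Theta> x 0 = 0" for x
    using scale[of x 0 0] by simp
  have \<Theta>_sum: "\<Theta> x (\<Sum>i\<in>I. F i) = (\<Sum>i\<in>I. \<Theta> x (F i))" for x and I :: "(nat \<Rightarrow> nat) set" and F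
    by (induction I rule: infinite_finite_induct) (simp_all only: sum.infinite sum.empty sum.insert \<Theta>0 add not_False_eq_True)
  have L0: "L \<sigma> 0 = 0" for \<sigma>
    using L_scale[of \<sigma> 0 0] by simp
  have L_sum: "L \<sigma> (\<Sum>i\<in>I. f i) = (\<Sum>i\<in>I. L \<sigma> (f i))" for \<sigma> f and I :: "'i set"
    by (induction I rule: infinite_finite_induct) (simp_all only: sum.infinite sum.empty sum.insert L0 L_add not_False_eq_True)
  assume "v x \<noteq> 0"
  define B where "B = {x \<in> A. v x \<noteq> 0}"
  have "finite B" "B \<noteq> {}"
    using fin x \<open>v x \<noteq> 0\<close> by (auto simp: B_def)
  then have "Max ((\<lambda>x. height (pr x)) ` B) \<in> (\<lambda>x. height (pr x)) ` B"
    by (intro Max_in) auto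
  then obtain y where y: "y \<in> B" "height (pr y) = Max ((\<lambda>x. height (pr x)) ` B)"
    by auto
  then have max: "height (pr x) \<le> height (pr y)" if "x \<in> B" for x
    using that \<open>finite B\<close> by simp
  define p where "p = pr y"
  have p: "p \<in> young n" and yA: "y \<in> A"
    using y pr by (auto simp: p_def B_def)
  have card: "card (diag p) = n" and finD: "finite (diag p)"
    using youngD[OF p] by simp_all
  have "kappa (diag p) t (v y) = 0" if t: "t \<in> tabs (diag p)" for t
  proof -
    \<comment> \<open>By rank one, each vector of shape \<open>p\<close> is replaced by a scalar
      \<open>a x\<close>. The aim becomes \<open>a y = 0\<close>, which \<open>ind\<close> gives
      once the \<open>a x\<close> are the coefficients of a relation between the maps.\<close>
    have "\<exists>a. kappa (diag p) t (v x) = fscale a (ptab (diag p) t)" if "x \<in> A" "pr x = p" for x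
      using kappa_Sp_multiple[OF p t] v that by metis
    then obtain a where a: "\<And>x. x \<in> A \<Longrightarrow> pr x = p \<Longrightarrow>
        kappa (diag p) t (v x) = fscale (a x) (ptab (diag p) t)"
      by metis
    have other: "kappa (diag p) t (v x) = 0" if "x \<in> A" "pr x \<noteq> p" for x
    proof (cases "x \<in> B")
      case True
      then show ?thesis
        using kappa_Sp_eq_0[OF p pr[OF that(1)] t v[OF that(1)]] max[OF True] that(2)
        by (simp add: p_def)
    next
      case False
      then have "v x = 0"
        using that by (simp add: B_def)
      then show ?thesis
        using kappa_scale[of "diag p" t 0 0] by simp
    qed
    \<comment> \<open>Equivariance moves the antisymmetrizer to the target, where it acts on the sum
      that vanishes.\<close>
    have "(\<Sum>x\<in>A. \<Theta> x (kappa (diag p) t (v x))) =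
        (\<Sum>x\<in>A. \<Sum>\<pi>\<in>colst (diag p) t. fscale (of_int (sign \<pi>)) (L \<pi> (\<Theta> x (v x))))"
      unfolding kappa_def \<Theta>_sum scale
      using colst_permutes[of _ "diag p" t] v by (intro sum.cong refl) (simp add: card equi)
    also have "\<dots> = (\<Sum>\<pi>\<in>colst (diag p) t. fscale (of_int (sign \<pi>)) (L \<pi> (\<Sum>x\<in>A. \<Theta> x (v x))))"
      unfolding L_sum fs.scale_sum_right by (rule sum.swap)
    also have "\<dots> = 0"
      by (simp add: 0 L0)
    finally have all0: "(\<Sum>x\<in>A. \<Theta> x (kappa (diag p) t (v x))) = 0" .
    have "(\<Sum>x\<in>{x \<in> A. pr x = p}. fscale (a x) (\<Theta> x (ptab (diag p) t))) =
        (\<Sum>x\<in>{x \<in> A. pr x = p}. \<Theta> x (kappa (diag p) t (v x)))"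
      by (rule sum.cong[OF refl]) (simp only: mem_Collect_eq a scale)
    also have "\<dots> = (\<Sum>x\<in>A. \<Theta> x (kappa (diag p) t (v x)))"
      using fin other by (intro sum.mono_neutral_left) (auto simp: \<Theta>0)
    finally have t0: "(\<Sum>x\<in>{x \<in> A. pr x = p}. fscale (a x) (\<Theta> x (ptab (diag p) t))) = 0"
      unfolding all0 .
    have tS: "ptab (diag p) s \<in> Sp (diag p)" if "s \<in> tabs (diag p)" for s
      using that by (simp add: Sp_def fs.span_base)
    \<comment> \<open>The relation is known on one polytabloid; it spreads because the symmetric
      group permutes the polytabloids transitively and they span the Specht module.\<close>
    have "(\<Sum>x\<in>{x \<in> A. pr x = p}. fscale (a x) (\<Theta> x F)) = 0" if "F \<in> Sp (diag p)" for F
      using that unfolding Sp_def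
    proof (induction rule: fs.span_induct)
      case base
      have "(\<Sum>x\<in>{x \<in> A. pr x = p}. fscale (a x) (\<Theta> x (fscale c F))) =
          fscale c (\<Sum>x\<in>{x \<in> A. pr x = p}. fscale (a x) (\<Theta> x F))" for c F
        unfolding scale fs.scale_sum_right by (intro sum.cong refl fs.scale_left_commute)
      then show ?case
        by (simp add: fs.subspace_def \<Theta>0 add fs.scale_right_distrib sum.distrib)
           (auto simp: zero_fun_def fscale_def)
    next
      case (step F)
      then obtain s where s: "s \<in> tabs (diag p)" "F = ptab (diag p) s"
        by auto
      then obtain \<sigma> where \<sigma>: "\<sigma> permutes {1..n}" "F = act \<sigma> (ptab (diag p) t)"
        using ptab_transitive[OF t s(1)] card by auto
      have "(\<Sum>x\<in>{x \<in> A. pr x = p}. fscale (a x) (\<Theta> x F)) =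
          (\<Sum>x\<in>{x \<in> A. pr x = p}. L \<sigma> (fscale (a x) (\<Theta> x (ptab (diag p) t))))"
        unfolding \<sigma>(2) L_scale using equi[OF _ \<sigma>(1)] tS[OF t] by (intro sum.cong refl) auto
      also have "\<dots> = 0"
        by (simp only: L_sum[symmetric] t0 L0)
      finally show ?case .
    qed
    then have "a y = 0"
      using ind yA p_def by blast
    then show ?thesis
      using a[OF yA] by (simp add: p_def)
  qed
  then have "v y = 0"
    using kappa_nondegenerate[OF finD] v[OF yA] by (simp add: p_def)
  then show False
    using y(1) by (simp add: B_def)
qed

locale perm_action =
  fixes n :: nat and X :: "'x set" and g :: "(nat \<Rightarrow> nat) \<Rightarrow> 'x \<Rightarrow> 'x"
  assumes finite_X: "finite X"
    and g_mem: "\<sigma> permutes {1..n} \<Longrightarrow> x \<in> X \<Longrightarrow> g \<sigma> x \<in> X"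
    and g_id: "x \<in> X \<Longrightarrow> g id x = x"
    and g_comp: "\<sigma> permutes {1..n} \<Longrightarrow> \<tau> permutes {1..n} \<Longrightarrow> x \<in> X \<Longrightarrow> g (\<sigma> \<circ> \<tau>) x = g \<sigma> (g \<tau> x)"
begin

abbreviation rep :: "(nat \<Rightarrow> nat) \<Rightarrow> ('x \<Rightarrow> complex) \<Rightarrow> 'x \<Rightarrow> complex" where
  "rep \<sigma> \<equiv> lin_ext X (g \<sigma>)"

lemma g_inv:
  assumes "\<sigma> permutes {1..n}" "x \<in> X"
  shows "g (inv \<sigma>) (g \<sigma> x) = x" "g \<sigma> (g (inv \<sigma>) x) = x"
  using assms g_id by (simp_all flip: g_comp add: permutes_inv permutes_inv_o)

lemma g_inj: "\<sigma> permutes {1..n} \<Longrightarrow> inj_on (g \<sigma>) X"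
  by (metis g_inv(1) inj_onI)

lemma rep_apply:
  assumes "\<sigma> permutes {1..n}" "x \<in> X"
  shows "rep \<sigma> f (g \<sigma> x) = f x"
  by (rule lin_ext_apply[OF finite_X g_inj[OF assms(1)] assms(2)])

lemma rep_outside:
  assumes "\<sigma> permutes {1..n}" "y \<notin> X"
  shows "rep \<sigma> f y = 0"
  using assms g_mem by (intro lin_ext_outside) auto

text \<open>Every point of \<open>X\<close> is some \<open>g \<sigma> x\<close>, and both sides
  vanish off \<open>X\<close>. This avoids computing with the sum in \<open>lin_ext\<close>.\<close>

lemma rep_eqI:
  assumes \<sigma>: "\<sigma> permutes {1..n}" and f: "f \<in> free_space X"
    and eq: "\<And>x. x \<in> X \<Longrightarrow> f (g \<sigma> x) = f' x"
  shows "rep \<sigma> f' = f"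
proof
  fix y
  show "rep \<sigma> f' y = f y"
  proof (cases "y \<in> X")
    case True
    then have y: "g (inv \<sigma>) y \<in> X" "g \<sigma> (g (inv \<sigma>) y) = y"
      using g_mem[OF permutes_inv[OF \<sigma>]] g_inv[OF \<sigma>] by auto
    then show ?thesis
      using rep_apply[OF \<sigma> y(1), of f'] eq[OF y(1)] by simp
  next
    case False
    then show ?thesis
      using rep_outside[OF \<sigma>] f free_space_iff[OF finite_X] by metis
  qed
qed

lemma rep_free_space: "\<sigma> permutes {1..n} \<Longrightarrow> rep \<sigma> f \<in> free_space X"
  using rep_outside by (simp add: free_space_iff[OF finite_X])

lemma sym_rep_subspace:
  assumes U: "fs.subspace U" "U \<subseteq> free_space X"
    and inv: "\<And>\<sigma> f. \<sigma> permutes {1..n} \<Longrightarrow> f \<in> U \<Longrightarrow> rep \<sigma> f \<in> U"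
  shows "sym_rep fscale n U rep"
  unfolding sym_rep_def
proof (intro conjI allI impI ballI)
  show "vector_space fscale"
    by (rule vector_space_fscale)
  show "fs.subspace U"
    by (rule U)
  show "\<exists>B. finite B \<and> U = fs.span B"
    by (rule finite_spanning_set[OF U finite_X])
  show "linear_on fscale fscale U U (rep \<sigma>)" if "\<sigma> permutes {1..n}" for \<sigma>
    using inv[OF that] by (auto simp: linear_on_def lin_ext_add lin_ext_scale)
  show "rep id f = f" if "f \<in> U" for f
    using that U by (intro rep_eqI permutes_id) (auto simp: g_id)
  show "rep (\<sigma> \<circ> \<tau>) f = rep \<sigma> (rep \<tau> f)"
    if "\<sigma> permutes {1..n}" "\<tau> permutes {1..n}" "f \<in> U" for \<sigma> \<tau> f
    using that by (intro rep_eqI rep_free_space permutes_compose)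
      (simp_all add: g_comp rep_apply g_mem)
qed

lemma sym_rep_free_space: "sym_rep fscale n (free_space X) rep"
  by (rule sym_rep_subspace[OF subspace_free_space order_refl rep_free_space])

section \<open>Explicit Frobenius reciprocity: maps from invariants\<close>

definition in_orbit :: "'x \<Rightarrow> 'x \<Rightarrow> bool" where
  "in_orbit x0 x \<longleftrightarrow> (\<exists>\<sigma>. \<sigma> permutes {1..n} \<and> x = g \<sigma> x0)"

text \<open>Matrix coefficients of \<open>w\<close>, spread over the orbit of \<open>x0\<close>. The
  map is linear in \<open>F\<close> and conjugate-linear in \<open>w\<close>; for \<open>w\<close>
  invariant under the stabilizer of \<open>x0\<close> the choice made by \<open>SOME\<close> does
  not affect the value.\<close>

definition orbit_map ::
  "(nat \<times> nat) set \<Rightarrow> 'x \<Rightarrow> ((nat \<Rightarrow> nat set) \<Rightarrow> complex) \<Rightarrow> ((nat \<Rightarrow> nat set) \<Rightarrow> complex) \<Rightarrow> 'x \<Rightarrow> complex"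
  where "orbit_map D x0 w F = (\<lambda>x.
    if in_orbit x0 x
    then inner_prod D F (act (SOME \<sigma>. \<sigma> permutes {1..n} \<and> x = g \<sigma> x0) w) else 0)"

lemma orbit_map_add: "orbit_map D x0 w (F + G) = orbit_map D x0 w F + orbit_map D x0 w G"
  by (rule ext) (simp add: orbit_map_def inner_prod_def distrib_right sum.distrib)

lemma orbit_map_scale: "orbit_map D x0 w (fscale a F) = fscale a (orbit_map D x0 w F)"
  by (rule ext) (simp add: orbit_map_def inner_prod_def fscale_apply sum_distrib_left mult.assoc)

lemma orbit_map_outside:
  "\<not> in_orbit x0 x \<Longrightarrow> orbit_map D x0 w F x = 0"
  by (simp add: orbit_map_def)

text \<open>Two permutations that take \<open>x0\<close> to the same point differ by an element of
  the stabilizer, which fixes \<open>w\<close>.\<close>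

lemma orbit_map_apply:
  assumes \<sigma>: "\<sigma> permutes {1..n}" and x0: "x0 \<in> X"
    and stab: "\<And>\<sigma>. \<sigma> permutes {1..n} \<Longrightarrow> g \<sigma> x0 = x0 \<Longrightarrow> act \<sigma> w = w"
  shows "orbit_map D x0 w F (g \<sigma> x0) = inner_prod D F (act \<sigma> w)"
proof -
  define \<tau> where "\<tau> = (SOME \<tau>. \<tau> permutes {1..n} \<and> g \<sigma> x0 = g \<tau> x0)"
  have \<tau>: "\<tau> permutes {1..n}" "g \<sigma> x0 = g \<tau> x0"
    using someI[of "\<lambda>\<tau>. \<tau> permutes {1..n} \<and> g \<sigma> x0 = g \<tau> x0" \<sigma>] \<sigma> by (auto simp: \<tau>_def)
  let ?\<rho> = "inv \<tau> \<circ> \<sigma>"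
  have \<rho>: "?\<rho> permutes {1..n}"
    by (intro permutes_compose permutes_inv \<sigma> \<tau>)
  have "g ?\<rho> x0 = x0"
    using \<sigma> \<tau> x0 by (simp add: g_comp permutes_inv g_inv)
  then have "act ?\<rho> w = w"
    by (rule stab[OF \<rho>])
  moreover have "\<tau> \<circ> ?\<rho> = \<sigma>"
    using \<tau>(1) by (simp add: o_assoc permutes_inv_o)
  ultimately have "act \<sigma> w = act \<tau> w"
    using act_comp[of \<tau> ?\<rho> w] permutes_bij[OF \<tau>(1)] permutes_bij[OF \<rho>] by simp
  then show ?thesis
    using \<sigma> unfolding orbit_map_def \<tau>_def in_orbit_def by auto
qed

lemma orbit_map_free_space:
  assumes "x0 \<in> X"
  shows "orbit_map D x0 w F \<in> free_space X"
proof -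
  have "\<not> in_orbit x0 x" if "x \<notin> X" for x
    using that assms g_mem unfolding in_orbit_def by blast
  then show ?thesis
    by (simp add: free_space_iff[OF finite_X] orbit_map_outside)
qed

text \<open>At \<open>\<tau> \<sigma> x0\<close> the left side pairs \<open>\<tau> F\<close> with
  \<open>\<tau> \<sigma> w\<close>, and the inner product is invariant under
  \<open>\<tau>\<close>.\<close>

lemma orbit_map_act:
  assumes \<tau>: "\<tau> permutes {1..n}" and x0: "x0 \<in> X" and D: "card D = n"
    and stab: "\<And>\<sigma>. \<sigma> permutes {1..n} \<Longrightarrow> g \<sigma> x0 = x0 \<Longrightarrow> act \<sigma> w = w"
  shows "orbit_map D x0 w (act \<tau> F) = rep \<tau> (orbit_map D x0 w F)"
proof (rule rep_eqI[OF \<tau> orbit_map_free_space[OF x0], symmetric])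
  fix x assume x: "x \<in> X"
  show "orbit_map D x0 w (act \<tau> F) (g \<tau> x) = orbit_map D x0 w F x"
  proof (cases "in_orbit x0 x")
    case True
    then obtain \<sigma> where \<sigma>: "\<sigma> permutes {1..n}" "x = g \<sigma> x0"
      unfolding in_orbit_def by blast
    have "orbit_map D x0 w (act \<tau> F) (g (\<tau> \<circ> \<sigma>) x0) = inner_prod D (act \<tau> F) (act (\<tau> \<circ> \<sigma>) w)"
      by (rule orbit_map_apply[OF permutes_compose[OF \<sigma>(1) \<tau>] x0 stab])
    then show ?thesis
      using \<sigma> \<tau> x0 orbit_map_apply[OF \<sigma>(1) x0 stab] inner_prod_act[of \<tau> D] D
      by (simp add: g_comp act_comp permutes_bij)
  next
    case False
    have "\<not> in_orbit x0 (g \<tau> x)"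
    proof
      assume "in_orbit x0 (g \<tau> x)"
      then obtain \<sigma> where \<sigma>: "\<sigma> permutes {1..n}" "g \<tau> x = g \<sigma> x0"
        unfolding in_orbit_def by blast
      then have "x = g (inv \<tau> \<circ> \<sigma>) x0"
        using g_inv(1)[OF \<tau> x] g_comp[OF permutes_inv[OF \<tau>] \<sigma>(1) x0] by simp
      then show False
        using False permutes_compose[OF \<sigma>(1) permutes_inv[OF \<tau>]] unfolding in_orbit_def by blast
    qed
    then show ?thesis
      using False by (simp add: orbit_map_outside)
  qed
qed

text \<open>The relation is tested on one vector at one point. At \<open>x0 r\<close> the maps of
  all other orbits vanish, and for the combination \<open>W\<close> of the invariants of orbit
  \<open>r\<close> the rest adds up to the inner product of \<open>W\<close> with itself.\<close>

lemma orbit_maps_independent: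
  assumes D: "finite D" and fin: "finite R" "\<And>r. r \<in> R \<Longrightarrow> finite (K r)"
    and x0: "\<And>r. r \<in> R \<Longrightarrow> x0 r \<in> X"
    and orbits: "\<And>r r' \<sigma>. r \<in> R \<Longrightarrow> r' \<in> R \<Longrightarrow> \<sigma> permutes {1..n} \<Longrightarrow> x0 r = g \<sigma> (x0 r') \<Longrightarrow> r = r'"
    and w: "\<And>r j. r \<in> R \<Longrightarrow> j \<in> K r \<Longrightarrow> w r j \<in> Sp D"
    and stab: "\<And>r j \<sigma>. r \<in> R \<Longrightarrow> j \<in> K r \<Longrightarrow> \<sigma> permutes {1..n} \<Longrightarrow> g \<sigma> (x0 r) = x0 r \<Longrightarrow>
        act \<sigma> (w r j) = w r j"
    and ind: "\<And>r. r \<in> R \<Longrightarrow> lin_indep (K r) (w r)"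
    and 0: "\<And>F. F \<in> Sp D \<Longrightarrow>
        (\<Sum>r\<in>R. \<Sum>j\<in>K r. fscale (a r j) (orbit_map D (x0 r) (w r j) F)) = 0"
    and r: "r \<in> R" and j: "j \<in> K r"
  shows "a r j = 0"
proof -
  \<comment> \<open>The coefficients are conjugated because \<open>orbit_map\<close> is
    conjugate-linear in the invariant.\<close>
  define W where "W = (\<Sum>j\<in>K r. fscale (cnj (a r j)) (w r j))"
  have W: "W \<in> Sp D"
    unfolding W_def using w[OF r]
    by (intro fs.subspace_sum[OF subspace_Sp] fs.subspace_scale[OF subspace_Sp]) auto
  have at: "orbit_map D (x0 r) (w r j) W (x0 r) = inner_prod D W (w r j)" if "j \<in> K r" for j
    using orbit_map_apply[OF permutes_id x0[OF r] stab[OF r that], of D W] g_id[OF x0[OF r]]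
    by simp
  have "0 = (\<Sum>r'\<in>R. \<Sum>j\<in>K r'. a r' j * orbit_map D (x0 r') (w r' j) W (x0 r))"
    using fun_cong[OF 0[OF W], of "x0 r"] by (simp add: sum_fun_apply fscale_apply)
  also have "\<dots> = (\<Sum>r'\<in>{r}. \<Sum>j\<in>K r'. a r' j * orbit_map D (x0 r') (w r' j) W (x0 r))"
  proof (rule sum.mono_neutral_right[OF fin(1)])
    show "\<forall>r'\<in>R - {r}. (\<Sum>j\<in>K r'. a r' j * orbit_map D (x0 r') (w r' j) W (x0 r)) = 0"
    proof (intro ballI sum.neutral)
      fix r' j assume "r' \<in> R - {r}"
      then have "\<not> in_orbit (x0 r') (x0 r)"
        using orbits[OF r, of r'] unfolding in_orbit_def by blast
      then show "a r' j * orbit_map D (x0 r') (w r' j) W (x0 r) = 0"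
        by (simp add: orbit_map_outside)
    qed
  qed (use r in simp)
  also have "\<dots> = (\<Sum>j\<in>K r. a r j * inner_prod D W (w r j))"
    using at by simp
  also have "\<dots> = (\<Sum>T\<in>tabloids D. \<Sum>j\<in>K r. a r j * (W T * cnj (w r j T)))"
    unfolding inner_prod_def sum_distrib_left by (rule sum.swap)
  also have "\<dots> = inner_prod D W W"
    unfolding inner_prod_def
  proof (rule sum.cong[OF refl])
    fix T
    have "cnj (W T) = (\<Sum>j\<in>K r. a r j * cnj (w r j T))"
      by (simp add: W_def sum_fun_apply fscale_apply)
    then show "(\<Sum>j\<in>K r. a r j * (W T * cnj (w r j T))) = W T * cnj (W T)"
      by (simp add: sum_distrib_left mult.left_commute)
  qed
  finally have "W = 0"
    using inner_prod_self_eq_0[OF D W] by simp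
  then have "cnj (a r j) = 0"
    using lin_indepD[OF ind[OF r], of "\<lambda>j. cnj (a r j)"] j by (simp add: W_def)
  then show ?thesis
    by simp
qed

end


section \<open>Decomposition of permutation modules\<close>

definition shape :: "nat list \<Rightarrow> nat \<Rightarrow> nat" where
  "shape \<mu> = (\<lambda>i. if i < length \<mu> then \<mu> ! i else 0)"

lemma diagram_eq_diag: "diagram \<mu> = diag (shape \<mu>)"
  by (auto simp: diagram_def diag_def shape_def split: if_splits)

lemma card_diagram: "finite (diag (shape \<mu>))" "card (diag (shape \<mu>)) = sum_list \<mu>"
proof -
  have eq: "diag (shape \<mu>) = (SIGMA i:{..<length \<mu>}. {..<\<mu> ! i})"
    by (auto simp: diag_def shape_def split: if_splits)
  show "finite (diag (shape \<mu>))"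
    by (simp add: eq)
  show "card (diag (shape \<mu>)) = sum_list \<mu>"
    by (simp add: eq sum_list_sum_nth atLeast0LessThan)
qed

lemma specht_eq_Sp: "specht \<mu> = Sp (diag (shape \<mu>))"
proof -
  have "tableaux \<mu> = tabs (diag (shape \<mu>))"
    by (simp add: tableaux_def tabs_def diagram_eq_diag card_diagram)
  moreover have "polytabloid \<mu> = ptab (diag (shape \<mu>))"
    by (rule ext) (simp add: polytabloid_def ptab_def column_stabilizer_def colst_def tabloid_def
        rows_def diagram_eq_diag card_diagram)
  ultimately show ?thesis
    by (simp add: specht_def Sp_def)
qed

text \<open>\<open>lin_ext\<close> sees only the values at tabloids of the shape; a Specht vector
  vanishes elsewhere, so the two actions agree on it.\<close>

lemma specht_act_eq_act:
  assumes \<sigma>: "\<sigma> permutes {1..sum_list \<mu>}" and F: "F \<in> Sp (diag (shape \<mu>))"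
  shows "specht_act \<mu> \<sigma> F = act \<sigma> F"
proof -
  let ?D = "diag (shape \<mu>)"
  have "tabloid \<mu> ` tableaux \<mu> = tabloids ?D"
    by (simp add: tabloids_def tableaux_def tabs_def tabloid_def[abs_def] rows_def[abs_def]
        diagram_eq_diag card_diagram)
  then have eq: "specht_act \<mu> \<sigma> = lin_ext (tabloids ?D) (relabel \<sigma>)"
    by (simp add: specht_act_def relabel_def[abs_def])
  have \<sigma>': "\<sigma> permutes {1..card ?D}"
    using \<sigma> card_diagram by simp
  note inv = relabel_inv[OF permutes_bij[OF \<sigma>]]
  have inj: "inj_on (relabel \<sigma>) (tabloids ?D)"
    by (metis inj_onI inv(1))
  show ?thesis
  proof
    fix T
    show "specht_act \<mu> \<sigma> F T = act \<sigma> F T"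
    proof (cases "T \<in> tabloids ?D")
      case True
      then have "relabel (inv \<sigma>) T \<in> tabloids ?D"
        by (rule relabel_tabloids[OF permutes_inv[OF \<sigma>']])
      then show ?thesis
        using lin_ext_apply[OF finite_tabloids[OF card_diagram(1)] inj, of "relabel (inv \<sigma>) T" F]
        by (simp add: eq inv act_def)
    next
      case False
      then have "T \<notin> relabel \<sigma> ` tabloids ?D" "relabel (inv \<sigma>) T \<notin> tabloids ?D"
        using relabel_tabloids[OF \<sigma>'] inv by (force, metis)
      then show ?thesis
        using Sp_outside[OF card_diagram(1) F] by (simp add: eq lin_ext_outside act_def)
    qed
  qed
qed

lemma partition_shape_young:
  assumes "partition_of n \<mu>"
  shows "shape \<mu> \<in> young n"
proof -
  have "shape \<mu> j \<le> shape \<mu> i" if "i \<le> j" for i j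
    using assms that sorted_wrt_nth_less[of "(\<ge>)" \<mu> i j]
    by (cases "i = j") (auto simp: shape_def partition_of_def)
  then show ?thesis
    using assms by (auto simp: young_def antimono_def card_diagram partition_of_def)
qed

lemma shape_inject:
  assumes "partition_of n \<mu>" "partition_of m \<nu>" "shape \<mu> = shape \<nu>"
  shows "\<mu> = \<nu>"
proof -
  have len: "i < length \<mu> \<longleftrightarrow> 0 < shape \<mu> i" "i < length \<nu> \<longleftrightarrow> 0 < shape \<nu> i" for i
    using assms(1,2) by (auto simp: partition_of_def shape_def intro!: gr0I) (metis nth_mem)+
  then have "i < length \<mu> \<longleftrightarrow> i < length \<nu>" for i
    by (simp add: assms(3))
  then have "length \<mu> = length \<nu>"
    by (meson linorder_neqE_nat less_irrefl)
  then show ?thesis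
    using assms(3) by (intro nth_equalityI) (auto simp: shape_def fun_eq_iff split: if_splits)
qed

lemma young_shape_ex:
  assumes p: "p \<in> young n"
  shows "\<exists>\<mu>. partition_of n \<mu> \<and> shape \<mu> = p"
proof -
  \<comment> \<open>The length of the first column, which is the number of nonzero rows.\<close>
  define L where "L = card {i. (i, 0) \<in> diag p}"
  have L: "0 < p i \<longleftrightarrow> i < L" for i
    using diag_column[OF youngD(1,2)[OF p], of 0] by (auto simp: L_def diag_def)
  define \<mu> where "\<mu> = map p [0..<L]"
  have shape: "shape \<mu> = p"
    using L by (auto simp: shape_def \<mu>_def fun_eq_iff)
  have "sorted_wrt (\<ge>) \<mu>"
    using youngD(1)[OF p] by (auto simp: \<mu>_def sorted_wrt_iff_nth_less antimono_def)
  moreover have "0 \<notin> set \<mu>"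
  proof
    assume "0 \<in> set \<mu>"
    then obtain i where "i < L" "p i = 0"
      by (auto simp: \<mu>_def image_iff)
    then show False
      using L[of i] by simp
  qed
  moreover have "sum_list \<mu> = n"
    using youngD(3)[OF p] card_diagram(2)[of \<mu>] shape by simp
  ultimately show ?thesis
    using shape by (auto simp: partition_of_def)
qed

section \<open>Padded partitions and stable path numbers\<close>

lemma paddableD:
  assumes \<nu>: "\<nu> \<in> paddable n" and n: "1 \<le> n"
  shows "partition_of (sum_list \<nu>) \<nu>" "sum_list \<nu> + shape \<nu> 0 \<le> n" "partition_of n (padded \<nu> n)"
proof -
  obtain m where m: "partition_of m \<nu>" "m + (case \<nu> of [] \<Rightarrow> 0 | a # _ \<Rightarrow> a) \<le> n"
    using \<nu> by (auto simp: paddable_def)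
  then have sum: "sum_list \<nu> = m"
    by (simp add: partition_of_def)
  then show "partition_of (sum_list \<nu>) \<nu>"
    using m by simp
  show le: "sum_list \<nu> + shape \<nu> 0 \<le> n"
    using m sum by (cases \<nu>) (auto simp: shape_def)
  show "partition_of n (padded \<nu> n)"
    using m n sum by (cases \<nu>) (auto simp: partition_of_def padded_def)
qed

lemma shape_Cons: "shape (x # \<nu>) = case_nat x (shape \<nu>)"
  by (auto simp: shape_def fun_eq_iff split: nat.split)

text \<open>Deleting the first row is the inverse. For \<open>n = 0\<close> the padded empty
  partition would be \<open>[0]\<close>, which has a part equal to zero.\<close>

lemma bij_betw_paddable:
  assumes n: "1 \<le> n"
  shows "bij_betw (\<lambda>\<nu>. shape (padded \<nu> n)) (paddable n) (young n)"
proof (rule bij_betw_imageI)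
  show "inj_on (\<lambda>\<nu>. shape (padded \<nu> n)) (paddable n)"
    using shape_inject paddableD(3)[OF _ n] by (fastforce simp: inj_on_def padded_def)
  show "(\<lambda>\<nu>. shape (padded \<nu> n)) ` paddable n = young n"
  proof
    show "(\<lambda>\<nu>. shape (padded \<nu> n)) ` paddable n \<subseteq> young n"
      using partition_shape_young paddableD(3)[OF _ n] by auto
    show "young n \<subseteq> (\<lambda>\<nu>. shape (padded \<nu> n)) ` paddable n"
    proof
      fix p assume "p \<in> young n"
      then obtain \<mu> where \<mu>: "partition_of n \<mu>" "shape \<mu> = p"
        using young_shape_ex by blast
      then obtain x \<nu> where x: "\<mu> = x # \<nu>"
        using n by (cases \<mu>) (auto simp: partition_of_def)
      have "partition_of (sum_list \<nu>) \<nu>" and "padded \<nu> n = \<mu>"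
        using \<mu> x by (auto simp: partition_of_def padded_def)
      moreover have "sum_list \<nu> + (case \<nu> of [] \<Rightarrow> 0 | a # _ \<Rightarrow> a) \<le> n"
        using \<mu>(1) x by (cases \<nu>) (auto simp: partition_of_def)
      ultimately show "p \<in> (\<lambda>\<nu>. shape (padded \<nu> n)) ` paddable n"
        using \<mu>(2) by (auto simp: paddable_def)
    qed
  qed
qed

text \<open>Paths that forget the first row: \<open>q\<close> is what lies below it, and a step that
  puts its box into the first row leaves \<open>q\<close> unchanged.\<close>

primrec stable_paths :: "nat \<Rightarrow> (nat \<Rightarrow> nat) \<Rightarrow> nat" where
  "stable_paths 0 q = (if q = (\<lambda>_. 0) then 1 else 0)"
| "stable_paths (Suc k) q = stable_paths k q + (\<Sum>i\<in>removable q. stable_paths k (drop_box q i))"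

lemma young_pos:
  assumes "q \<in> young m" "i \<in> removable q"
  obtains m' where "m = Suc m'"
proof -
  have "diag q \<noteq> {}"
    using corner_in_diag[OF assms(2)] by auto
  then have "0 < m"
    using youngD(2,3)[OF assms(1)] by (simp add: card_gt_0_iff flip: youngD(3)[OF assms(1)])
  then show ?thesis
    using that by (cases m) auto
qed

text \<open>Each step adds at most one box to \<open>q\<close>.\<close>

lemma stable_paths_nonzero:
  "q \<in> young m \<Longrightarrow> stable_paths k q \<noteq> 0 \<Longrightarrow> m \<le> k"
proof (induction k arbitrary: q m)
  case 0
  then have "q = (\<lambda>_. 0)"
    by (simp split: if_splits)
  then have "diag q = {}"
    by (simp add: diag_def)
  then show ?case
    using youngD(3)[OF 0(1)] by simp
next
  case (Suc k)
  show ?case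
  proof (cases "stable_paths k q = 0")
    case True
    then have "(\<Sum>i\<in>removable q. stable_paths k (drop_box q i)) \<noteq> 0"
      using Suc.prems(2) by simp
    then obtain i where i: "i \<in> removable q" "stable_paths k (drop_box q i) \<noteq> 0"
      by (rule sum.not_neutral_contains_not_neutral)
    then obtain m' where "m = Suc m'"
      using young_pos Suc.prems(1) by blast
    then show ?thesis
      using Suc.IH[OF drop_young i(2)] i(1) Suc.prems(1) by auto
  next
    case False
    then show ?thesis
      using Suc.IH[OF Suc.prems(1)] by simp
  qed
qed

lemma first_row_le:
  assumes "q \<in> young m"
  shows "q 0 \<le> m"
proof -
  have "{0} \<times> {..<q 0} \<subseteq> diag q"
    by (auto simp: diag_def)
  then have "card ({0::nat} \<times> {..<q 0}) \<le> card (diag q)"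
    by (intro card_mono youngD(2)[OF assms])
  then show ?thesis
    using youngD(3)[OF assms] by (simp add: card_cartesian_product)
qed

lemma removable_case_nat:
  "removable (case_nat x q) = (if q 0 < x then {0} else {}) \<union> Suc ` removable q"
proof (rule set_eqI)
  fix i
  show "i \<in> removable (case_nat x q) \<longleftrightarrow> i \<in> (if q 0 < x then {0} else {}) \<union> Suc ` removable q"
    by (cases i) (auto simp: removable_def)
qed

lemma drop_case_nat:
  "drop_box (case_nat x q) 0 = case_nat (x - Suc 0) q"
  "drop_box (case_nat x q) (Suc i) = case_nat x (drop_box q i)"
  by (auto simp: fun_eq_iff split: nat.split)

text \<open>With \<open>a \<ge> k\<close> boxes already in the first row, adding \<open>k\<close> more boxes never violates the
  condition between the first row and the second.\<close>

lemma paths_case_nat: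
  "q \<in> young m \<Longrightarrow> m + q 0 \<le> a + k \<Longrightarrow> k \<le> a \<Longrightarrow>
    paths a k (case_nat (a + k - m) q) = stable_paths k q"
proof (induction k arbitrary: q m)
  case 0
  show ?case
  proof (cases "q = (\<lambda>_. 0)")
    case True
    then have "m = 0"
      using youngD(3)[OF 0(1)] by (simp add: diag_def)
    then have "case_nat (a - m) q = one_row a"
      using True by (auto simp: one_row_def fun_eq_iff split: nat.split)
    then show ?thesis
      using True by simp
  next
    case False
    then obtain i where "q i \<noteq> 0"
      by auto
    then have "case_nat (a - m) q (Suc i) \<noteq> one_row a (Suc i)"
      by (simp add: one_row_def)
    then have "case_nat (a - m) q \<noteq> one_row a"
      by metis
    then show ?thesis
      using False by simp
  qed
next
  case (Suc k)
  let ?x = "a + Suc k - m"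
  have fin: "finite (removable q)"
    using finite_removable youngD(2)[OF Suc.prems(1)] by blast
  have first: "(if q 0 < ?x then paths a k (case_nat (?x - Suc 0) q) else 0) = stable_paths k q"
  proof (cases "q 0 < ?x")
    case True
    then show ?thesis
      using Suc.IH[OF Suc.prems(1)] Suc.prems by auto
  next
    case False
    \<comment> \<open>Here the first row is exactly as long as the second and cannot lose a box, so
      \<open>m + q 0 = a + Suc k\<close>. A nonzero value would give
      \<open>q 0 \<le> m \<le> k\<close>, hence \<open>a + Suc k \<le> 2 * k\<close>, against
      \<open>Suc k \<le> a\<close>.\<close>
    then have "stable_paths k q = 0"
      using stable_paths_nonzero[OF Suc.prems(1), of k] first_row_le[OF Suc.prems(1)] Suc.prems
      by fastforce
    then show ?thesis
      using False by simp
  qed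
  have rest: "paths a k (case_nat ?x (drop_box q i)) = stable_paths k (drop_box q i)"
    if i: "i \<in> removable q" for i
  proof -
    obtain m' where m': "m = Suc m'"
      by (rule young_pos[OF Suc.prems(1) i])
    have "drop_box q i 0 \<le> q 0"
      by simp
    then have le: "m' + drop_box q i 0 \<le> a + k" and x: "a + k - m' = ?x"
      using Suc.prems(2) m' by linarith+
    have "paths a k (case_nat (a + k - m') (drop_box q i)) = stable_paths k (drop_box q i)"
      using Suc.prems(3) by (intro Suc.IH[OF drop_young[OF Suc.prems(1)[unfolded m'] i] le]) simp
    then show ?thesis
      unfolding x .
  qed
  have "paths a (Suc k) (case_nat ?x q) =
      (\<Sum>i\<in>(if q 0 < ?x then {0} else {}). paths a k (drop_box (case_nat ?x q) i)) +
      (\<Sum>i\<in>Suc ` removable q. paths a k (drop_box (case_nat ?x q) i))"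
    unfolding paths.simps removable_case_nat using fin by (intro sum.union_disjoint) auto
  also have "(\<Sum>i\<in>(if q 0 < ?x then {0} else {}). paths a k (drop_box (case_nat ?x q) i)) =
      stable_paths k q"
  proof -
    have "(\<Sum>i\<in>(if q 0 < ?x then {0} else {}). paths a k (drop_box (case_nat ?x q) i)) =
        (if q 0 < ?x then paths a k (drop_box (case_nat ?x q) 0) else 0)"
      by simp
    then show ?thesis
      using first unfolding drop_case_nat(1) by (rule trans)
  qed
  also have "(\<Sum>i\<in>Suc ` removable q. paths a k (drop_box (case_nat ?x q) i)) =
      (\<Sum>i\<in>removable q. stable_paths k (drop_box q i))"
    by (subst sum.reindex) (auto simp only: inj_on_def comp_def drop_case_nat rest intro!: sum.cong)
  finally show ?case
    by simp
qed

text \<open>The origin of the stable range: \<open>2 * k \<le> n\<close> is the condition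
  \<open>k \<le> a\<close> of \<open>paths_case_nat\<close> for \<open>a = n - k\<close>.\<close>

lemma paths_padded:
  assumes "\<nu> \<in> paddable n" "1 \<le> n" "2 * k \<le> n"
  shows "paths (n - k) k (shape (padded \<nu> n)) = stable_paths k (shape \<nu>)"
  using paths_case_nat[OF partition_shape_young[OF paddableD(1)[OF assms(1,2)]], of "n - k" k]
    paddableD(2)[OF assms(1,2)] assms(3) by (simp add: padded_def shape_Cons)

context perm_action
begin

text \<open>The orbit maps built from all invariants realise \<open>paths (n - k) k p\<close> copies of the Specht
  module of \<open>p\<close> for every orbit; since Specht modules have dimension at least \<open>paths 0 n p\<close>, a
  dimension count shows that these copies exhaust the permutation module.\<close>

lemma orbit_decomposition:
  assumes R: "finite R" and k: "\<And>r. r \<in> R \<Longrightarrow> k r \<le> n" and x0: "\<And>r. r \<in> R \<Longrightarrow> x0 r \<in> X"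
    and orbits: "\<And>r r' \<sigma>. r \<in> R \<Longrightarrow> r' \<in> R \<Longrightarrow> \<sigma> permutes {1..n} \<Longrightarrow> x0 r = g \<sigma> (x0 r') \<Longrightarrow> r = r'"
    and stab: "\<And>r \<sigma>. r \<in> R \<Longrightarrow> \<sigma> permutes {1..n} \<Longrightarrow> g \<sigma> (x0 r) = x0 r \<Longrightarrow> \<sigma> permutes {1..n - k r}"
    and count: "card X \<le> (\<Sum>r\<in>R. fact n div fact (n - k r))"
    and A: "A = (SIGMA p:young n. SIGMA r:R. {..<paths (n - k r) (k r) p})"
  obtains \<Theta> where
    "\<And>x F G. \<Theta> x (F + G) = \<Theta> x F + \<Theta> x G"
    "\<And>x a F. \<Theta> x (fscale a F) = fscale a (\<Theta> x F)"
    "\<And>x F. x \<in> A \<Longrightarrow> \<Theta> x F \<in> free_space X"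
    "\<And>x \<sigma> F. x \<in> A \<Longrightarrow> \<sigma> permutes {1..n} \<Longrightarrow> \<Theta> x (act \<sigma> F) = rep \<sigma> (\<Theta> x F)"
    "\<And>v x. (\<And>x. x \<in> A \<Longrightarrow> v x \<in> Sp (diag (fst x))) \<Longrightarrow> (\<Sum>x\<in>A. \<Theta> x (v x)) = 0 \<Longrightarrow> x \<in> A \<Longrightarrow> v x = 0"
    "\<And>f. f \<in> free_space X \<Longrightarrow>
      \<exists>v. (\<forall>x\<in>A. v x \<in> Sp (diag (fst x))) \<and> f = (\<Sum>x\<in>A. \<Theta> x (v x))"
proof -
  define J where "J p r = {..<paths (n - k r) (k r) p}" for p r
  have "\<forall>p\<in>young n. \<forall>r\<in>R. \<exists>w. (\<forall>j\<in>J p r. w j \<in> Sp (diag p) \<and> fixed (n - k r) (w j)) \<and> lin_indep (J p r) w"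
    unfolding J_def Ball_def lessThan_iff using invariants_exist k by (metis le_add_diff_inverse2)
  then obtain w where w: "\<And>p r j. p \<in> young n \<Longrightarrow> r \<in> R \<Longrightarrow> j \<in> J p r \<Longrightarrow>
        w p r j \<in> Sp (diag p) \<and> fixed (n - k r) (w p r j)"
    and w_ind: "\<And>p r. p \<in> young n \<Longrightarrow> r \<in> R \<Longrightarrow> lin_indep (J p r) (w p r)"
    by (metis (no_types))
  \<comment> \<open>For \<open>a = 0\<close> the invariance is under the trivial group, so these are
    just independent vectors: the lower bound for the dimension of the Specht module.\<close>
  have "\<forall>p\<in>young n. \<exists>u. (\<forall>j<paths 0 n p. u j \<in> Sp (diag p)) \<and> lin_indep {..<paths 0 n p} u"
    using invariants_exist[of _ 0 n] by fastforce
  then obtain u where u: "\<And>p j. p \<in> young n \<Longrightarrow> j < paths 0 n p \<Longrightarrow> u p j \<in> Sp (diag p)"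
    and u_ind: "\<And>p. p \<in> young n \<Longrightarrow> lin_indep {..<paths 0 n p} (u p)"
    by metis
  have A_iff: "(p, r, j) \<in> A \<longleftrightarrow> p \<in> young n \<and> r \<in> R \<and> j \<in> J p r" for p r j
    by (simp add: A J_def)
  have finA: "finite A"
    unfolding A using R by (auto simp: finite_young)
  define \<Theta> where "\<Theta> = (\<lambda>(p, r, j). orbit_map (diag p) (x0 r) (w p r j))"
  have add: "\<Theta> x (F + G) = \<Theta> x F + \<Theta> x G" for x F G
    by (cases x) (simp only: \<Theta>_def case_prod_conv orbit_map_add)
  have scale: "\<Theta> x (fscale a F) = fscale a (\<Theta> x F)" for x a F
    by (cases x) (simp only: \<Theta>_def case_prod_conv orbit_map_scale)
  have free: "\<Theta> x F \<in> free_space X" if "x \<in> A" for x F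
    using that x0 by (cases x) (auto simp: \<Theta>_def A_iff intro!: orbit_map_free_space)
  have fix_w: "act \<sigma> (w p r j) = w p r j"
    if "p \<in> young n" "r \<in> R" "j \<in> J p r" "\<sigma> permutes {1..n}" "g \<sigma> (x0 r) = x0 r" for p r j \<sigma>
    using w[OF that(1-3)] stab[OF that(2,4,5)] by (simp add: fixed_def)
  have equi: "\<Theta> x (act \<sigma> F) = rep \<sigma> (\<Theta> x F)" if x: "x \<in> A" and \<sigma>: "\<sigma> permutes {1..n}" for x \<sigma> F
  proof -
    obtain p r j where prj: "x = (p, r, j)" "p \<in> young n" "r \<in> R" "j \<in> J p r"
      using x by (cases x) (auto simp: A_iff)
    have "orbit_map (diag p) (x0 r) (w p r j) (act \<sigma> F) = rep \<sigma> (orbit_map (diag p) (x0 r) (w p r j) F)"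
      by (rule orbit_map_act[OF \<sigma> x0[OF prj(3)] youngD(3)[OF prj(2)] fix_w[OF prj(2-4)]])
    then show ?thesis
      by (simp add: \<Theta>_def prj(1))
  qed
  have ind: "a x = 0"
    if h: "\<And>F. F \<in> Sp (diag p) \<Longrightarrow> (\<Sum>x\<in>{x \<in> A. fst x = p}. fscale (a x) (\<Theta> x F)) = 0"
      and x: "x \<in> A" "fst x = p" for p a x
  proof -
    obtain r j where rj: "x = (p, r, j)" "p \<in> young n" "r \<in> R" "j \<in> J p r"
      using x by (cases x) (auto simp: A_iff)
    have "(\<Sum>r\<in>R. \<Sum>j\<in>J p r. fscale (a (p, r, j)) (orbit_map (diag p) (x0 r) (w p r j) F)) = 0"
      if F: "F \<in> Sp (diag p)" for F
    proof -
      have "(\<Sum>r\<in>R. \<Sum>j\<in>J p r. fscale (a (p, r, j)) (orbit_map (diag p) (x0 r) (w p r j) F)) =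
          (\<Sum>(r, j)\<in>(SIGMA r:R. J p r). fscale (a (p, r, j)) (\<Theta> (p, r, j) F))"
        using R by (subst sum.Sigma) (auto simp: J_def \<Theta>_def)
      also have "\<dots> = (\<Sum>x\<in>{x \<in> A. fst x = p}. fscale (a x) (\<Theta> x F))"
        by (rule sum.reindex_bij_witness[of _ snd "Pair p"]) (auto simp: A_iff rj(2))
      finally show ?thesis
        using h[OF F] by simp
    qed
    then have "a (p, r, j) = 0"
      using rj(3,4) w[OF rj(2)] fix_w[OF rj(2)] w_ind[OF rj(2)] x0 orbits
      by (intro orbit_maps_independent[of "diag p" R "J p" x0 "w p" "\<lambda>r j. a (p, r, j)"])
        (auto simp: R J_def youngD(2)[OF rj(2)])
    then show ?thesis
      by (simp add: rj(1))
  qed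
  have indep: "v x = 0"
    if v: "\<And>x. x \<in> A \<Longrightarrow> v x \<in> Sp (diag (fst x))" "(\<Sum>x\<in>A. \<Theta> x (v x)) = 0" "x \<in> A" for v x
  proof (rule isotypic_independent[where A = A and pr = fst and \<Theta> = \<Theta> and L = rep and n = n and v = v])
    show "a x = 0"
      if "\<And>F. F \<in> Sp (diag p) \<Longrightarrow> (\<Sum>x\<in>{x \<in> A. fst x = p}. fscale (a x) (\<Theta> x F)) = 0"
        "x \<in> A" "fst x = p" for p a x
      by (rule ind[OF that])
  qed (use finA add scale equi v in \<open>auto simp: A lin_ext_add lin_ext_scale\<close>)
  have span: "\<exists>v. (\<forall>x\<in>A. v x \<in> Sp (diag (fst x))) \<and> f = (\<Sum>x\<in>A. \<Theta> x (v x))"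
    if f: "f \<in> free_space X" for f
  proof -
    \<comment> \<open>One index for each copy of a Specht module and each of its known independent
      vectors. By \<open>sum_paths_paths\<close> there are at least \<open>card X\<close> of them,
      so their images span.\<close>
    define B where "B = (SIGMA x:A. {..<paths 0 n (fst x)})"
    define z where "z = (\<lambda>(x, b). \<Theta> x (u (fst x) b))"
    have fst: "fst x \<in> young n" if "x \<in> A" for x
      using that by (auto simp: A)
    have finB: "finite B"
      using finA by (auto simp: B_def)
    have \<Theta>_sum: "\<Theta> x (\<Sum>i\<in>I. fscale (c i) (F i)) = (\<Sum>i\<in>I. fscale (c i) (\<Theta> x (F i)))"
      for x and I :: "nat set" and c F
    proof -
      have "\<Theta> x 0 = 0"
        using scale[of x 0 0] by simp
      then show ?thesis
        by (induction I rule: infinite_finite_induct)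
          (simp_all only: sum.infinite sum.empty sum.insert add scale not_False_eq_True)
    qed
    have combine: "(\<Sum>y\<in>B. fscale (c y) (z y)) =
        (\<Sum>x\<in>A. \<Theta> x (\<Sum>b<paths 0 n (fst x). fscale (c (x, b)) (u (fst x) b)))" for c
      unfolding \<Theta>_sum B_def using finA
      by (subst sum.Sigma) (auto simp: z_def intro!: sum.cong)
    have mem: "(\<Sum>b<paths 0 n (fst x). fscale (c (x, b)) (u (fst x) b)) \<in> Sp (diag (fst x))"
      if "x \<in> A" for c x
      using u[OF fst[OF that]]
      by (intro fs.subspace_sum[OF subspace_Sp] fs.subspace_scale[OF subspace_Sp]) auto
    have "lin_indep B z"
      unfolding lin_indep_def
    proof (intro allI impI ballI)
      fix c y
      assume 0: "(\<Sum>y\<in>B. fscale (c y) (z y)) = 0" and y: "y \<in> B"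
      obtain x b where xb: "y = (x, b)" "x \<in> A" "b < paths 0 n (fst x)"
        using y by (auto simp: B_def)
      have "(\<Sum>b<paths 0 n (fst x). fscale (c (x, b)) (u (fst x) b)) = 0"
        using indep[OF mem 0[unfolded combine] xb(2)] .
      then show "c y = 0"
        using lin_indepD[OF u_ind[OF fst[OF xb(2)]], of "\<lambda>b. c (x, b)" b] xb by simp
    qed
    moreover have "card X \<le> card B"
    proof -
      have "fact n div fact (n - k r) =
          (\<Sum>p\<in>young n. paths (n - k r) (k r) p * paths 0 n p)" if "r \<in> R" for r
      proof -
        have "n - k r + k r = n"
          using k[OF that] by simp
        then have "fact n = (\<Sum>p\<in>young n. paths (n - k r) (k r) p * paths 0 n p) * fact (n - k r)"
          using sum_paths_paths[of "n - k r" "k r"] by simp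
        then show ?thesis
          by simp
      qed
      then have "(\<Sum>r\<in>R. fact n div fact (n - k r)) =
          (\<Sum>r\<in>R. \<Sum>p\<in>young n. paths (n - k r) (k r) p * paths 0 n p)"
        by simp
      also have "\<dots> = (\<Sum>p\<in>young n. \<Sum>r\<in>R. \<Sum>j\<in>J p r. paths 0 n p)"
        by (subst sum.swap) (simp add: J_def)
      also have "\<dots> = (\<Sum>p\<in>young n. \<Sum>x\<in>(SIGMA r:R. J p r). paths 0 n p)"
        using R by (simp add: J_def sum_distrib_right)
      also have "\<dots> = (\<Sum>(p, x)\<in>A. paths 0 n p)"
        unfolding A J_def using R by (subst sum.Sigma) (auto simp: finite_young)
      also have "\<dots> = card B"
        using finA by (simp add: B_def case_prod_beta)
      finally show ?thesis
        using count by simp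
    qed
    moreover have "z ` B \<subseteq> free_space X"
      using free by (auto simp: z_def B_def)
    ultimately obtain c where "f = (\<Sum>y\<in>B. fscale (c y) (z y))"
      using lin_indep_spans[OF finB _ finite_X _ _ f] by blast
    then show ?thesis
      unfolding combine using mem
      by (intro exI[of _ "\<lambda>x. \<Sum>b<paths 0 n (fst x). fscale (c (x, b)) (u (fst x) b)"]) simp
  qed
  show thesis
    by (rule that[of \<Theta>]) (use add scale free equi indep span in blast)+
qed

text \<open>Repackages \<open>orbit_decomposition\<close> for \<open>multiplicities\<close>: the
  copies, indexed by shape, orbit and invariant, are renumbered by a partition \<open>\<nu>\<close>
  and a number below \<open>c \<nu>\<close>.\<close>

lemma multiplicities_permutation_module:
  assumes n: "1 \<le> n"
    and R: "finite R" and k: "\<And>r. r \<in> R \<Longrightarrow> k r \<le> n" and x0: "\<And>r. r \<in> R \<Longrightarrow> x0 r \<in> X"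
    and orbits: "\<And>r r' \<sigma>. r \<in> R \<Longrightarrow> r' \<in> R \<Longrightarrow> \<sigma> permutes {1..n} \<Longrightarrow> x0 r = g \<sigma> (x0 r') \<Longrightarrow> r = r'"
    and stab: "\<And>r \<sigma>. r \<in> R \<Longrightarrow> \<sigma> permutes {1..n} \<Longrightarrow> g \<sigma> (x0 r) = x0 r \<Longrightarrow> \<sigma> permutes {1..n - k r}"
    and count: "card X \<le> (\<Sum>r\<in>R. fact n div fact (n - k r))"
    and c0: "\<And>\<nu>. \<nu> \<notin> paddable n \<Longrightarrow> c \<nu> = 0"
    and c: "\<And>\<nu>. \<nu> \<in> paddable n \<Longrightarrow> c \<nu> = (\<Sum>r\<in>R. paths (n - k r) (k r) (shape (padded \<nu> n)))"
  shows "multiplicities fscale n (free_space X) rep c"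
proof -
  define A where "A = (SIGMA p:young n. SIGMA r:R. {..<paths (n - k r) (k r) p})"
  obtain \<Theta> where add: "\<And>x F G. \<Theta> x (F + G) = \<Theta> x F + \<Theta> x G"
    and scale: "\<And>x a F. \<Theta> x (fscale a F) = fscale a (\<Theta> x F)"
    and free: "\<And>x F. x \<in> A \<Longrightarrow> \<Theta> x F \<in> free_space X"
    and equi: "\<And>x \<sigma> F. x \<in> A \<Longrightarrow> \<sigma> permutes {1..n} \<Longrightarrow> \<Theta> x (act \<sigma> F) = rep \<sigma> (\<Theta> x F)"
    and indep: "\<And>v x. (\<And>x. x \<in> A \<Longrightarrow> v x \<in> Sp (diag (fst x))) \<Longrightarrow>
        (\<Sum>x\<in>A. \<Theta> x (v x)) = 0 \<Longrightarrow> x \<in> A \<Longrightarrow> v x = 0"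
    and span: "\<And>f. f \<in> free_space X \<Longrightarrow>
      \<exists>v. (\<forall>x\<in>A. v x \<in> Sp (diag (fst x))) \<and> f = (\<Sum>x\<in>A. \<Theta> x (v x))"
    by (rule orbit_decomposition[where R = R and k = k and ?x0.0 = x0 and A = A, OF R _ _ _ _ count A_def])
       (assumption | use k x0 orbits stab in blast)+
  have finA: "finite A"
    unfolding A_def using R by (auto simp: finite_young)
  have \<Theta>0: "\<Theta> x 0 = 0" for x
    using scale[of x 0 0] by simp
  have diff: "\<Theta> x (F - G) = \<Theta> x F - \<Theta> x G" for x F G
    using add[of x "F - G" G] by (metis add_diff_cancel_right' diff_add_cancel)
  define sh where "sh \<nu> = shape (padded \<nu> n)" for \<nu>
  have sh: "bij_betw sh (paddable n) (young n)"
    using bij_betw_paddable[OF n] by (simp add: sh_def[abs_def])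
  define I where "I = {(\<nu>, i). i < c \<nu>}"
  have I: "I = (SIGMA \<nu>:paddable n. {..<c \<nu>})"
    using c0 by (force simp: I_def)
  \<comment> \<open>\<open>e \<nu>\<close> numbers the pairs of an orbit and an invariant that
    belong to the shape of \<open>\<nu>\<close>.\<close>
  have "\<exists>e. bij_betw e {..<c \<nu>} (SIGMA r:R. {..<paths (n - k r) (k r) (sh \<nu>)})" if "\<nu> \<in> paddable n" for \<nu>
    using R c[OF that] by (intro finite_same_card_bij) (auto simp: sh_def)
  then obtain e where e: "\<And>\<nu>. \<nu> \<in> paddable n \<Longrightarrow>
      bij_betw (e \<nu>) {..<c \<nu>} (SIGMA r:R. {..<paths (n - k r) (k r) (sh \<nu>)})"
    by metis
  define b where "b = (\<lambda>(\<nu>, i). (sh \<nu>, e \<nu> i))"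
  have b: "bij_betw b I A"
  proof (rule bij_betw_imageI)
    show "inj_on b I"
    proof (rule inj_onI)
      fix x y assume h: "x \<in> I" "y \<in> I" "b x = b y"
      obtain \<nu> i \<nu>' i' where xy: "x = (\<nu>, i)" "y = (\<nu>', i')"
        by (cases x, cases y) auto
      then have mem: "\<nu> \<in> paddable n" "\<nu>' \<in> paddable n" "i < c \<nu>" "i' < c \<nu>'"
        using h by (auto simp: I)
      then have "\<nu> = \<nu>'"
        using h(3) xy bij_betw_imp_inj_on[OF sh] by (auto simp: b_def dest: inj_onD)
      moreover from this have "i = i'"
        using h(3) xy mem bij_betw_imp_inj_on[OF e[of \<nu>]] by (auto simp: b_def dest: inj_onD)
      ultimately show "x = y"
        using xy by simp
    qed
    show "b ` I = A"
    proof
      show "b ` I \<subseteq> A"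
        using bij_betwE[OF sh] bij_betwE[OF e] by (fastforce simp: b_def I A_def)
      show "A \<subseteq> b ` I"
      proof
        fix x assume "x \<in> A"
        then obtain p y where py: "x = (p, y)" "p \<in> young n" "y \<in> (SIGMA r:R. {..<paths (n - k r) (k r) p})"
          by (auto simp: A_def)
        then obtain \<nu> where \<nu>: "\<nu> \<in> paddable n" "p = sh \<nu>"
          using bij_betw_imp_surj_on[OF sh] by blast
        then obtain i where "i < c \<nu>" "y = e \<nu> i"
          using bij_betw_imp_surj_on[OF e[OF \<nu>(1)]] py(3) by blast
        then show "x \<in> b ` I"
          using \<nu> py(1) by (auto simp: I b_def intro!: image_eqI[of _ _ "(\<nu>, i)"])
      qed
    qed
  qed
  have finI: "finite I"
    using bij_betw_finite[OF b] finA by simp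
  have bI: "b x \<in> A" if "x \<in> I" for x
    using bij_betwE[OF b] that by blast
  define S where "S x = Sp (diag (fst (b x)))" for x
  have subS: "fs.subspace (S x)" for x
    by (simp add: S_def subspace_Sp)
  define W where "W x = \<Theta> (b x) ` S x" for x
  have W_free: "W x \<subseteq> free_space X" if "x \<in> I" for x
    using free[OF bI[OF that]] by (auto simp: W_def)
  have W_ex: "\<exists>F. F \<in> S x \<and> u = \<Theta> (b x) F" if "u \<in> W x" for u x
    using that by (auto simp: W_def)
  have indep': "v x = 0" if v: "\<And>x. x \<in> I \<Longrightarrow> v x \<in> S x" "(\<Sum>x\<in>I. \<Theta> (b x) (v x)) = 0" "x \<in> I" for v x
  proof -
    let ?v = "v \<circ> inv_into I b"
    have inv: "inv_into I b (b x) = x" if "x \<in> I" for x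
      using b that by (simp add: bij_betw_inv_into_left)
    have "(\<Sum>x\<in>A. \<Theta> x (?v x)) = (\<Sum>x\<in>I. \<Theta> (b x) (?v (b x)))"
      by (rule sum.reindex_bij_betw[OF b, symmetric])
    also have "\<dots> = (\<Sum>x\<in>I. \<Theta> (b x) (v x))"
      by (intro sum.cong refl) (simp add: inv)
    finally have sum0: "(\<Sum>x\<in>A. \<Theta> x (?v x)) = 0"
      unfolding v(2) .
    have "?v y \<in> Sp (diag (fst y))" if y: "y \<in> A" for y
    proof -
      obtain x where "x \<in> I" "y = b x"
        using y bij_betw_imp_surj_on[OF b] by blast
      then show ?thesis
        using v(1) inv by (simp add: S_def)
    qed
    then have "?v (b x) = 0"
      using indep[OF _ sum0 bI[OF v(3)]] by blast
    then show ?thesis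
      by (simp add: inv[OF v(3)])
  qed
  have inj: "inj_on (\<Theta> (b x)) (S x)" if x: "x \<in> I" for x
  proof (rule inj_onI)
    fix F G assume h: "F \<in> S x" "G \<in> S x" "\<Theta> (b x) F = \<Theta> (b x) G"
    \<comment> \<open>Injectivity of a single map is joint independence for a family concentrated at
      \<open>x\<close>.\<close>
    define v where "v y = (if y = x then F - G else 0)" for y
    have "v y \<in> S y" for y
      using h fs.subspace_diff[OF subS] fs.subspace_0[OF subS] by (auto simp: v_def)
    moreover have "(\<Sum>y\<in>I. \<Theta> (b y) (v y)) = 0"
      using h(3) diff by (intro sum.neutral) (auto simp: v_def \<Theta>0)
    ultimately have "v x = 0"
      using indep' x by blast
    then show "F = G"
      by (simp add: v_def)
  qed
  have "internal_direct_sum (free_space X) I W"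
    unfolding internal_direct_sum_def
  proof (intro conjI finI bij_betw_imageI)
    show "inj_on (\<lambda>w. \<Sum>x\<in>I. w x) (\<Pi>\<^sub>E x\<in>I. W x)"
    proof (rule inj_onI)
      fix w w' assume w: "w \<in> (\<Pi>\<^sub>E x\<in>I. W x)" "w' \<in> (\<Pi>\<^sub>E x\<in>I. W x)" "(\<Sum>x\<in>I. w x) = (\<Sum>x\<in>I. w' x)"
      have "\<forall>x\<in>I. \<exists>F. F \<in> S x \<and> w x = \<Theta> (b x) F" "\<forall>x\<in>I. \<exists>F. F \<in> S x \<and> w' x = \<Theta> (b x) F"
        using PiE_mem[OF w(1)] PiE_mem[OF w(2)] W_ex by blast+
      then obtain v v' where v: "\<And>x. x \<in> I \<Longrightarrow> v x \<in> S x \<and> w x = \<Theta> (b x) (v x)"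
        and v': "\<And>x. x \<in> I \<Longrightarrow> v' x \<in> S x \<and> w' x = \<Theta> (b x) (v' x)"
        by metis
      have "(\<Sum>x\<in>I. \<Theta> (b x) (v x - v' x)) = (\<Sum>x\<in>I. w x - w' x)"
        by (intro sum.cong refl) (simp add: diff v v')
      also have "\<dots> = 0"
        unfolding sum_subtractf w(3) by simp
      finally have "v x - v' x = 0" if "x \<in> I" for x
        using indep'[of "\<lambda>x. v x - v' x" x] fs.subspace_diff[OF subS] v v' that by blast
      then have "w x = w' x" if "x \<in> I" for x
        using that v v' by simp
      then show "w = w'"
        by (rule PiE_ext[OF w(1,2)])
    qed
    show "(\<lambda>w. \<Sum>x\<in>I. w x) ` (\<Pi>\<^sub>E x\<in>I. W x) = free_space X"
    proof
      show "(\<lambda>w. \<Sum>x\<in>I. w x) ` (\<Pi>\<^sub>E x\<in>I. W x) \<subseteq> free_space X"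
      proof (rule image_subsetI)
        fix w assume w: "w \<in> (\<Pi>\<^sub>E x\<in>I. W x)"
        show "(\<Sum>x\<in>I. w x) \<in> free_space X"
          by (intro fs.subspace_sum[OF subspace_free_space]) (use PiE_mem[OF w] W_free in blast)
      qed
      show "free_space X \<subseteq> (\<lambda>w. \<Sum>x\<in>I. w x) ` (\<Pi>\<^sub>E x\<in>I. W x)"
      proof
        fix f assume "f \<in> free_space X"
        then obtain v where v: "\<And>x. x \<in> A \<Longrightarrow> v x \<in> Sp (diag (fst x))" "f = (\<Sum>x\<in>A. \<Theta> x (v x))"
          using span by blast
        have "f = (\<Sum>x\<in>I. \<Theta> (b x) (v (b x)))"
          unfolding v(2) by (rule sum.reindex_bij_betw[OF b, symmetric])
        also have "\<dots> = (\<Sum>x\<in>I. restrict (\<lambda>x. \<Theta> (b x) (v (b x))) I x)"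
          by (intro sum.cong refl) simp
        finally have f: "f = (\<Sum>x\<in>I. restrict (\<lambda>x. \<Theta> (b x) (v (b x))) I x)" .
        have "\<Theta> (b x) (v (b x)) \<in> W x" if "x \<in> I" for x
          unfolding W_def S_def by (intro imageI v(1) bI[OF that])
        then have "restrict (\<lambda>x. \<Theta> (b x) (v (b x))) I \<in> (\<Pi>\<^sub>E x\<in>I. W x)"
          unfolding restrict_PiE_iff by blast
        then show "f \<in> (\<lambda>w. \<Sum>x\<in>I. w x) ` (\<Pi>\<^sub>E x\<in>I. W x)"
          by (rule image_eqI[rotated]) (rule f)
      qed
    qed
  qed
  moreover have "sym_rep fscale n (W (\<nu>, i)) rep \<and>
      rep_iso fscale fscale n (W (\<nu>, i)) rep (specht (padded \<nu> n)) (specht_act (padded \<nu> n))"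
    if i: "i < c \<nu>" for \<nu> i
  proof
    let ?x = "(\<nu>, i)"
    let ?D = "diag (sh \<nu>)"
    have x: "?x \<in> I"
      using i by (simp add: I_def)
    then have \<nu>: "\<nu> \<in> paddable n"
      by (simp add: I)
    have S: "S ?x = Sp ?D"
      by (simp add: S_def b_def)
    have card: "card ?D = n" and sum: "sum_list (padded \<nu> n) = n"
      using card_diagram(2)[of "padded \<nu> n"] paddableD(3)[OF \<nu> n] by (simp_all add: sh_def partition_of_def)
    have actS: "act \<sigma> F \<in> S ?x" if "\<sigma> permutes {1..n}" "F \<in> S ?x" for \<sigma> F
      using act_Sp[of \<sigma> ?D F] that S card by simp
    have sub: "fs.subspace (W ?x)"
      unfolding W_def fs.subspace_def
      using fs.subspace_0[OF subS, of ?x] fs.subspace_add[OF subS, of _ ?x] fs.subspace_scale[OF subS, of _ ?x]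
      by (auto simp flip: add scale) (metis \<Theta>0 image_eqI)
    show "sym_rep fscale n (W ?x) rep"
    proof (rule sym_rep_subspace[OF sub])
      show "W ?x \<subseteq> free_space X"
        by (rule W_free[OF x])
      show "rep \<sigma> f \<in> W ?x" if "\<sigma> permutes {1..n}" "f \<in> W ?x" for \<sigma> f
        using that(2) equi[OF bI[OF x] that(1)] actS[OF that(1)] unfolding W_def
        by (metis (no_types, lifting) image_iff)
    qed
    \<comment> \<open>\<open>rep_iso\<close> is directed towards the Specht module, whereas
      \<open>\<Theta>\<close> starts there, so its inverse is used.\<close>
    let ?f = "inv_into (S ?x) (\<Theta> (b ?x))"
    have f: "?f (\<Theta> (b ?x) F) = F" if "F \<in> S ?x" for F
      by (rule inv_into_f_f[OF inj[OF x] that])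
    have bij: "bij_betw ?f (W ?x) (S ?x)"
      unfolding W_def by (rule bij_betw_inv_into[OF inj_on_imp_bij_betw[OF inj[OF x]]])
    have "linear_on fscale fscale (W ?x) (S ?x) ?f"
      unfolding linear_on_def
    proof (intro conjI ballI allI)
      show "?f \<in> W ?x \<rightarrow> S ?x"
        using bij_betwE[OF bij] by blast
      fix u assume "u \<in> W ?x"
      then obtain F where F: "F \<in> S ?x" "u = \<Theta> (b ?x) F"
        by (auto simp: W_def)
      show "?f (fscale a u) = fscale a (?f u)" for a
        using f[OF fs.subspace_scale[OF subS F(1)], of a] f[OF F(1)] by (simp only: F(2) scale)
      fix v assume "v \<in> W ?x"
      then obtain G where G: "G \<in> S ?x" "v = \<Theta> (b ?x) G"
        by (auto simp: W_def)
      show "?f (u + v) = ?f u + ?f v"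
        using f[OF fs.subspace_add[OF subS F(1) G(1)]] f[OF F(1)] f[OF G(1)] by (simp only: F(2) G(2) add)
    qed
    moreover have "?f (rep \<sigma> u) = specht_act (padded \<nu> n) \<sigma> (?f u)"
      if \<sigma>: "\<sigma> permutes {1..n}" and u: "u \<in> W ?x" for \<sigma> u
    proof -
      obtain F where F: "F \<in> S ?x" "u = \<Theta> (b ?x) F"
        using u by (auto simp: W_def)
      have "?f (rep \<sigma> u) = act \<sigma> F"
        using f[OF actS[OF \<sigma> F(1)]] equi[OF bI[OF x] \<sigma>] by (simp add: F(2))
      also have "\<dots> = specht_act (padded \<nu> n) \<sigma> F"
        using specht_act_eq_act[of \<sigma> "padded \<nu> n" F] \<sigma> F(1) sum S by (simp add: sh_def)
      finally show ?thesis
        using f[OF F(1)] F(2) by simp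
    qed
    ultimately show "rep_iso fscale fscale n (W ?x) rep (specht (padded \<nu> n)) (specht_act (padded \<nu> n))"
      unfolding rep_iso_def specht_eq_Sp using bij S by (auto simp: sh_def)
  qed
  ultimately show ?thesis
    unfolding multiplicities_def I_def using c0 by blast
qed

end


section \<open>Colorings\<close>

definition same_color :: "'v set \<Rightarrow> ('v \<Rightarrow> nat) \<Rightarrow> ('v \<times> 'v) set" where
  "same_color V c = {(u, v). u \<in> V \<and> v \<in> V \<and> c u = c v}"

definition num_classes :: "'v set \<Rightarrow> ('v \<times> 'v) set \<Rightarrow> nat" where
  "num_classes V r = card ((\<lambda>u. r `` {u}) ` V)"

text \<open>The partitions of \<open>V\<close> into independent blocks, encoded as equivalence
  relations. A coloring uses at most \<open>card V\<close> colors, so those with colors up to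
  \<open>card V\<close> already show every type, and the index set of the orbits is the same for all
  \<open>n\<close>.\<close>

definition color_types :: "'v set \<Rightarrow> 'v set set \<Rightarrow> ('v \<times> 'v) set set" where
  "color_types V E = same_color V ` colorings V E (card V)"

lemma num_classes_same_color: "num_classes V (same_color V c) = card (c ` V)"
proof -
  have "(\<lambda>u. same_color V c `` {u}) ` V = (\<lambda>x. {v \<in> V. c v = x}) ` c ` V"
    unfolding image_image by (intro image_cong refl) (auto simp: same_color_def)
  moreover have "inj_on (\<lambda>x. {v \<in> V. c v = x}) (c ` V)"
    by (rule inj_onI) blast
  ultimately show ?thesis
    by (simp add: num_classes_def card_image)
qed

lemma same_color_compose:
  assumes "inj_on h (c ` V)"
  shows "same_color V (compose V h c) = same_color V c"
  by (auto simp: same_color_def compose_def inj_on_eq_iff[OF assms])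

lemma compose_colorings:
  assumes "simple_graph V E" "c \<in> colorings V E n" "inj_on h (c ` V)" "h ` c ` V \<subseteq> {1..m}"
  shows "compose V h c \<in> colorings V E m"
proof -
  have "compose V h c u \<noteq> compose V h c v" if "{u, v} \<in> E" for u v
  proof -
    have uv: "u \<in> V" "v \<in> V"
      using assms(1) that by (auto simp: simple_graph_def)
    have "c u \<noteq> c v"
      using assms(2) that by (auto simp: colorings_def)
    then show ?thesis
      using uv assms(3) by (auto simp: compose_def dest: inj_onD)
  qed
  then show ?thesis
    using assms(4) by (fastforce simp: colorings_def compose_def)
qed

lemma coloring_range: "c \<in> colorings V E n \<Longrightarrow> c ` V \<subseteq> {1..n}"
  by (auto simp: colorings_def)

lemma coloring_extensional: "c \<in> colorings V E n \<Longrightarrow> c \<in> extensional V"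
  by (auto simp: colorings_def PiE_def)

lemma finite_colorings: "finite V \<Longrightarrow> finite (colorings V E n)"
  by (rule finite_subset[of _ "V \<rightarrow>\<^sub>E {1..n}"]) (auto simp: colorings_def finite_PiE)

text \<open>Only the equality pattern matters for being a coloring, so its colors can be exchanged
  for any set of the same size.\<close>

lemma recolor:
  assumes "finite V" "simple_graph V E" "c \<in> colorings V E n" "S \<subseteq> {1..m}" "card S = card (c ` V)"
  obtains c' where "c' \<in> colorings V E m" "same_color V c' = same_color V c" "c' ` V = S"
proof -
  have "finite S"
    using assms(4) finite_subset by blast
  then obtain h where h: "bij_betw h (c ` V) S"
    using finite_same_card_bij[of "c ` V" S] assms(1,5) by auto
  then have "inj_on h (c ` V)" "h ` c ` V = S"
    by (auto simp: bij_betw_def)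
  then have "compose V h c \<in> colorings V E m" "same_color V (compose V h c) = same_color V c"
    using compose_colorings[OF assms(2,3)] same_color_compose assms(4) by metis+
  moreover have "compose V h c ` V = S"
    using \<open>h ` c ` V = S\<close> by (auto simp: compose_def image_iff)
  ultimately show ?thesis
    by (rule that)
qed

lemma same_color_mem_color_types:
  assumes "finite V" "simple_graph V E" "c \<in> colorings V E n"
  shows "same_color V c \<in> color_types V E"
proof -
  have "card (c ` V) \<le> card V"
    by (rule card_image_le[OF assms(1)])
  then have "{1..card (c ` V)} \<subseteq> {1..card V}" "card {1..card (c ` V)} = card (c ` V)"
    by auto
  then obtain c' where "c' \<in> colorings V E (card V)" "same_color V c' = same_color V c"
    using recolor[OF assms] by metis
  then show ?thesis
    unfolding color_types_def by (metis imageI)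
qed

lemma num_classes_le:
  assumes "finite V" "r \<in> color_types V E"
  shows "num_classes V r \<le> card V"
  using assms by (auto simp: color_types_def num_classes_same_color card_image_le)

lemma perm_action_colorings:
  assumes "finite V" "simple_graph V E"
  shows "perm_action n (colorings V E n) (compose V)"
proof
  show "finite (colorings V E n)"
    by (rule finite_colorings[OF assms(1)])
next
  fix \<sigma> c assume \<sigma>: "\<sigma> permutes {1..n}" and c: "c \<in> colorings V E n"
  show "compose V \<sigma> c \<in> colorings V E n"
  proof (rule compose_colorings[OF assms(2) c])
    show "inj_on \<sigma> (c ` V)"
      by (rule inj_on_subset[OF permutes_inj[OF \<sigma>] subset_UNIV])
    show "\<sigma> ` c ` V \<subseteq> {1..n}"
      using coloring_range[OF c] permutes_image[OF \<sigma>] by blast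
  qed
next
  fix c assume "c \<in> colorings V E n"
  then show "compose V id c = c"
    using coloring_extensional by (fastforce simp: compose_def extensional_def fun_eq_iff)
next
  fix \<sigma> \<tau> :: "nat \<Rightarrow> nat" and c
  show "compose V (\<sigma> \<circ> \<tau>) c = compose V \<sigma> (compose V \<tau> c)"
    by (auto simp: compose_def fun_eq_iff)
qed

lemma card_injections:
  assumes "finite A" "card A \<le> n"
  shows "card {h \<in> A \<rightarrow>\<^sub>E {1..n}. inj_on h A} = fact n div fact (n - card A)"
proof -
  have "card {h \<in> A \<rightarrow>\<^sub>E {1..n}. inj_on h A} = (\<Prod>i\<in>{0..<card A}. n - i)"
    using card_inj_on_subset_funcset[OF assms(1) finite_atLeastAtMost order_refl, of 1 n] by simp
  also have "\<dots> = \<Prod>{n - card A + 1..n}"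
    by (rule prod.reindex_bij_witness[of _ "\<lambda>j. n - j" "\<lambda>i. n - i"]) (use assms(2) in auto)
  also have "\<dots> = fact n div fact (n - card A)"
    by (rule fact_div_fact[symmetric]) simp
  finally show ?thesis .
qed

text \<open>A coloring of type \<open>r\<close> is a fixed coloring of that type followed by an
  injection of its colors into \<open>{1..n}\<close>.\<close>

lemma card_colorings_le:
  assumes V: "finite V" "simple_graph V E"
  shows "card (colorings V E n) \<le> (\<Sum>r\<in>color_types V E. fact n div fact (n - num_classes V r))"
proof -
  have fin: "finite (color_types V E)"
    by (simp add: color_types_def finite_colorings V)
  have "colorings V E n \<subseteq> (\<Union>r\<in>color_types V E. {c \<in> colorings V E n. same_color V c = r})"
    using same_color_mem_color_types[OF V] by auto
  then have "card (colorings V E n) \<le> card (\<Union>r\<in>color_types V E. {c \<in> colorings V E n. same_color V c = r})"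
    using fin finite_colorings[OF V(1)] by (intro card_mono finite_UN_I) auto
  also have "\<dots> \<le> (\<Sum>r\<in>color_types V E. card {c \<in> colorings V E n. same_color V c = r})"
    by (rule card_UN_le[OF fin])
  also have "\<dots> \<le> (\<Sum>r\<in>color_types V E. fact n div fact (n - num_classes V r))"
  proof (rule sum_mono)
    fix r assume "r \<in> color_types V E"
    then obtain c0 where r: "r = same_color V c0"
      by (auto simp: color_types_def)
    let ?C = "c0 ` V"
    let ?I = "{h \<in> ?C \<rightarrow>\<^sub>E {1..n}. inj_on h ?C}"
    have finI: "finite ?I"
      using V(1) by (intro finite_subset[of ?I "?C \<rightarrow>\<^sub>E {1..n}"] finite_PiE) auto
    have "{c \<in> colorings V E n. same_color V c = r} \<subseteq> (\<lambda>h. compose V h c0) ` ?I"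
    proof
      fix c assume "c \<in> {c \<in> colorings V E n. same_color V c = r}"
      then have c: "c \<in> colorings V E n" "same_color V c = same_color V c0"
        by (simp_all add: r)
      have iff: "c u = c v \<longleftrightarrow> c0 u = c0 v" if "u \<in> V" "v \<in> V" for u v
        using c(2) that by (auto simp: same_color_def set_eq_iff)
      \<comment> \<open>The vertex picked by \<open>inv_into\<close> does not matter, as
        \<open>c\<close> and \<open>c0\<close> have the same color classes.\<close>
      define h where "h = restrict (\<lambda>y. c (inv_into V c0 y)) ?C"
      have h: "h (c0 v) = c v" if "v \<in> V" for v
        using that iff[OF inv_into_into[of "c0 v" c0 V] that] f_inv_into_f[of "c0 v" c0 V]
        by (simp add: h_def)
      have "h \<in> ?I"
        using h iff coloring_range[OF c(1)] by (fastforce simp: inj_on_def h_def)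
      moreover have "c = compose V h c0"
        using h coloring_extensional[OF c(1)] by (auto simp: compose_def extensional_def fun_eq_iff)
      ultimately show "c \<in> (\<lambda>h. compose V h c0) ` ?I"
        by blast
    qed
    then have le: "card {c \<in> colorings V E n. same_color V c = r} \<le> card ?I"
      using finI by (meson card_image_le card_mono finite_imageI le_trans)
    show "card {c \<in> colorings V E n. same_color V c = r} \<le> fact n div fact (n - num_classes V r)"
    proof (cases "card ?C \<le> n")
      case True
      then have "card ?I = fact n div fact (n - card ?C)"
        using V(1) by (intro card_injections) simp_all
      then show ?thesis
        using le by (simp add: r num_classes_same_color)
    next
      \<comment> \<open>Too few colors: the type does not occur, and the right side, with
        \<open>n - card ?C\<close> truncated to zero, is still a valid bound.\<close>
      case False
      have "\<not> inj_on h ?C" if "h \<in> ?C \<rightarrow>\<^sub>E {1..n}" for h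
        using card_inj_on_le[of h ?C "{1..n}"] that False by auto
      then have "?I = {}"
        by blast
      then show ?thesis
        using le by (simp only: card.empty le_zero_eq)
    qed
  qed
  finally show ?thesis .
qed

text \<open>The guard is needed because \<open>shape\<close> ignores zeros at the end of a list:
  \<open>[0]\<close> has the shape of the empty partition but must get multiplicity zero.\<close>

definition stable_mult :: "'v set \<Rightarrow> 'v set set \<Rightarrow> nat list \<Rightarrow> nat" where
  "stable_mult V E \<nu> = (if partition_of (sum_list \<nu>) \<nu>
     then \<Sum>r\<in>color_types V E. stable_paths (num_classes V r) (shape \<nu>) else 0)"

lemma multiplicities_colorings:
  assumes V: "finite V" "simple_graph V E" and n: "1 \<le> n" "2 * card V \<le> n"
  shows "multiplicities fscale n (coloring_space V E n) (coloring_act V E n) (stable_mult V E)"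
proof -
  interpret perm_action n "colorings V E n" "compose V"
    by (rule perm_action_colorings[OF V])
  let ?k = "num_classes V" and ?R = "color_types V E"
  have k: "?k r \<le> card V" "?k r \<le> n" "2 * ?k r \<le> n" if "r \<in> ?R" for r
    using num_classes_le[OF V(1) that] n by auto
  \<comment> \<open>The representative of an orbit uses the largest colors, so a permutation that
    fixes it moves only \<open>{1..n - ?k r}\<close>, the set for which invariants were
    constructed.\<close>
  have "\<exists>c. c \<in> colorings V E n \<and> same_color V c = r \<and> c ` V = {n - ?k r<..n}" if r: "r \<in> ?R" for r
  proof -
    obtain c where c: "c \<in> colorings V E (card V)" "r = same_color V c"
      using r by (auto simp: color_types_def)
    have "{n - ?k r<..n} \<subseteq> {1..n}" "card {n - ?k r<..n} = card (c ` V)"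
      using k[OF r] c(2) num_classes_same_color[of V c] by auto
    then show ?thesis
      using recolor[OF V c(1)] c(2) by metis
  qed
  then obtain x0 where x0: "\<And>r. r \<in> ?R \<Longrightarrow>
      x0 r \<in> colorings V E n \<and> same_color V (x0 r) = r \<and> x0 r ` V = {n - ?k r<..n}"
    by metis
  have "multiplicities fscale n (free_space (colorings V E n)) rep (stable_mult V E)"
  proof (rule multiplicities_permutation_module[where R = ?R and k = ?k and ?x0.0 = x0])
    show "1 \<le> n"
      by (rule n)
    show "finite ?R"
      by (simp add: color_types_def finite_colorings V)
    show "?k r \<le> n" "x0 r \<in> colorings V E n" if "r \<in> ?R" for r
      using k x0 that by auto
    show "r = r'" if "r \<in> ?R" "r' \<in> ?R" "\<sigma> permutes {1..n}" "x0 r = compose V \<sigma> (x0 r')" for r r' \<sigma>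
    proof -
      have "r = same_color V (compose V \<sigma> (x0 r'))"
        using x0[OF that(1)] by (simp only: that(4))
      also have "\<dots> = same_color V (x0 r')"
        by (rule same_color_compose[OF inj_on_subset[OF permutes_inj[OF that(3)] subset_UNIV]])
      also have "\<dots> = r'"
        using x0[OF that(2)] by blast
      finally show ?thesis .
    qed
    show "\<sigma> permutes {1..n - ?k r}" if r: "r \<in> ?R" and \<sigma>: "\<sigma> permutes {1..n}" "compose V \<sigma> (x0 r) = x0 r" for r \<sigma>
    proof (rule permutes_superset[OF \<sigma>(1)])
      fix y assume "y \<in> {1..n} - {1..n - ?k r}"
      then have "y \<in> x0 r ` V"
        using x0[OF r] by auto
      then obtain v where "v \<in> V" "y = x0 r v"
        by blast
      then show "\<sigma> y = y"
        using fun_cong[OF \<sigma>(2), of v] by (simp add: compose_def)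
    qed
    show "card (colorings V E n) \<le> (\<Sum>r\<in>?R. fact n div fact (n - ?k r))"
      by (rule card_colorings_le[OF V])
    show "stable_mult V E \<nu> = 0" if \<nu>: "\<nu> \<notin> paddable n" for \<nu>
    proof (cases "partition_of (sum_list \<nu>) \<nu>")
      case True
      have "stable_paths (?k r) (shape \<nu>) = 0" if r: "r \<in> ?R" for r
      proof (rule ccontr)
        note young = partition_shape_young[OF True]
        assume "\<not> ?thesis"
        \<comment> \<open>A nonzero term makes both the size and the first part of
          \<open>\<nu>\<close> at most \<open>?k r\<close>; their sum is then at most
          \<open>n\<close>, so \<open>\<nu>\<close> would be paddable.\<close>
        then have "sum_list \<nu> \<le> ?k r"
          by (rule stable_paths_nonzero[OF young])
        moreover from this have "shape \<nu> 0 \<le> ?k r"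
          using first_row_le[OF young] by simp
        moreover have "(case \<nu> of [] \<Rightarrow> 0 | a # _ \<Rightarrow> a) = shape \<nu> 0"
          by (cases \<nu>) (auto simp: shape_def)
        ultimately show False
          using \<nu> True k(3)[OF r] by (auto simp: paddable_def)
      qed
      then show ?thesis
        by (simp add: stable_mult_def)
    qed (simp add: stable_mult_def)
    show "stable_mult V E \<nu> = (\<Sum>r\<in>?R. paths (n - ?k r) (?k r) (shape (padded \<nu> n)))"
      if "\<nu> \<in> paddable n" for \<nu>
      using paddableD(1)[OF that n(1)] paths_padded[OF that n(1) k(3)] by (simp add: stable_mult_def)
  qed
  moreover have "rep = coloring_act V E n"
    by (simp add: coloring_act_def fun_eq_iff)
  ultimately show ?thesis
    by (simp add: coloring_space_def)
qed

section \<open>The inclusion maps and orbit-surjectivity\<close>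

lemma colorings_mono: "n \<le> m \<Longrightarrow> colorings V E n \<subseteq> colorings V E m"
  by (fastforce simp: colorings_def PiE_def)

text \<open>Colorings are functions into \<open>nat\<close> with no bound recorded, so the linear
  map induced by the inclusion of colors is the identity on vectors.\<close>

lemma coloring_incl_eq:
  assumes "finite V" "f \<in> coloring_space V E n"
  shows "coloring_incl V E n f = f"
proof -
  have id: "compose V id c = c" if "c \<in> colorings V E n" for c
    using coloring_extensional[OF that] by (auto simp: compose_def extensional_def fun_eq_iff)
  then have "coloring_incl V E n f = (\<Sum>c\<in>colorings V E n. fscale (f c) (delta c))"
    by (simp add: coloring_incl_def lin_ext_def)
  also have "\<dots> = f"
    using fun_eq_sum_delta[OF finite_colorings[OF assms(1)]]
      assms(2) free_space_iff[OF finite_colorings[OF assms(1)]]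
    unfolding coloring_space_def by metis
  finally show ?thesis .
qed

lemma coloring_space_mono: "coloring_space V E n \<subseteq> coloring_space V E (n + 1)"
  unfolding coloring_space_def free_space_def
  by (intro fs.span_mono image_mono colorings_mono) simp

lemma coloring_act_delta:
  assumes "finite V" "c \<in> colorings V E n"
  shows "coloring_act V E n \<sigma> (delta c) = delta (compose V \<sigma> c)"
proof -
  have "coloring_act V E n \<sigma> (delta c) =
      (\<Sum>c'\<in>colorings V E n. if c' = c then delta (compose V \<sigma> c) else 0)"
    unfolding coloring_act_def lin_ext_def by (intro sum.cong refl) (simp add: delta_def[of c])
  also have "\<dots> = delta (compose V \<sigma> c)"
    using assms by (simp add: finite_colorings)
  finally show ?thesis .
qed

text \<open>The action with one more color sums over more colorings, but \<open>f\<close> vanishes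
  on those that use the new color.\<close>

lemma coloring_act_extend:
  assumes V: "finite V" "simple_graph V E" and \<sigma>: "\<sigma> permutes {1..n}" and f: "f \<in> coloring_space V E n"
  shows "coloring_act V E (n + 1) \<sigma> f = coloring_act V E n \<sigma> f"
proof -
  interpret A: perm_action n "colorings V E n" "compose V"
    by (rule perm_action_colorings[OF V])
  interpret B: perm_action "n + 1" "colorings V E (n + 1)" "compose V"
    by (rule perm_action_colorings[OF V])
  have \<sigma>': "\<sigma> permutes {1..n + 1}"
    by (rule permutes_subset[OF \<sigma>]) auto
  show ?thesis
    unfolding coloring_act_def
  proof (rule B.rep_eqI[OF \<sigma>'])
    show "A.rep \<sigma> f \<in> free_space (colorings V E (n + 1))"
      using A.rep_free_space[OF \<sigma>] coloring_space_mono unfolding coloring_space_def by blast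
    fix c assume c: "c \<in> colorings V E (n + 1)"
    show "A.rep \<sigma> f (compose V \<sigma> c) = f c"
    proof (cases "c \<in> colorings V E n")
      case True
      then show ?thesis
        by (rule A.rep_apply[OF \<sigma>])
    next
      case False
      then have "compose V \<sigma> c \<notin> colorings V E n"
        using B.g_inv(1)[OF \<sigma>' c] A.g_mem[OF permutes_inv[OF \<sigma>]] by metis
      then show ?thesis
        using False f A.rep_outside[OF \<sigma>] free_space_iff[OF A.finite_X]
        unfolding coloring_space_def by metis
    qed
  qed
qed

lemma consistent_colorings:
  assumes V: "finite V" "simple_graph V E"
  shows "consistent_sequence fscale (coloring_space V E) (coloring_act V E) (coloring_incl V E)"
  unfolding consistent_sequence_def
proof (intro allI impI conjI ballI)
  fix n :: nat
  interpret perm_action n "colorings V E n" "compose V"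
    by (rule perm_action_colorings[OF V])
  have act: "coloring_act V E n = rep"
    by (simp add: coloring_act_def fun_eq_iff)
  show "sym_rep fscale n (coloring_space V E n) (coloring_act V E n)"
    using sym_rep_free_space by (simp add: act coloring_space_def)
  show "linear_on fscale fscale (coloring_space V E n) (coloring_space V E (n + 1)) (coloring_incl V E n)"
    using coloring_incl_eq[OF V(1)] coloring_space_mono[of V E n]
    by (auto simp: linear_on_def coloring_incl_def lin_ext_add lin_ext_scale)
  fix \<sigma> f
  assume \<sigma>: "\<sigma> permutes {1..n}" and f: "f \<in> coloring_space V E n"
  have "coloring_act V E n \<sigma> f \<in> coloring_space V E n"
    using rep_free_space[OF \<sigma>] by (simp add: act coloring_space_def)
  then show "coloring_incl V E n (coloring_act V E n \<sigma> f) =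
      coloring_act V E (n + 1) \<sigma> (coloring_incl V E n f)"
    using coloring_act_extend[OF V \<sigma> f] by (simp add: coloring_incl_eq[OF V(1)] f)
qed

text \<open>A coloring uses at most \<open>card V\<close> of the \<open>n + 1\<close> colors, so it
  misses some \<open>j\<close>. Exchanging \<open>j\<close> and \<open>n + 1\<close> gives a
  coloring with colors up to \<open>n\<close>, and the same exchange leads back.\<close>

lemma colorings_orbit_surjective:
  assumes V: "finite V" "simple_graph V E" and n: "card V \<le> n"
  shows "fs.span {coloring_act V E (n + 1) \<sigma> (coloring_incl V E n f) |\<sigma> f.
    \<sigma> permutes {1..n + 1} \<and> f \<in> coloring_space V E n} = coloring_space V E (n + 1)"
    (is "fs.span ?S = _")
proof
  interpret perm_action "n + 1" "colorings V E (n + 1)" "compose V"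
    by (rule perm_action_colorings[OF V])
  have "?S \<subseteq> coloring_space V E (n + 1)"
    using rep_free_space by (auto simp: coloring_act_def coloring_space_def)
  then show "fs.span ?S \<subseteq> coloring_space V E (n + 1)"
    by (simp add: fs.span_minimal coloring_space_def subspace_free_space)
  have "delta c \<in> ?S" if c: "c \<in> colorings V E (n + 1)" for c
  proof -
    have "card (c ` V) < card {1..n + 1}"
      using card_image_le[OF V(1), of c] n by simp
    then have "\<not> {1..n + 1} \<subseteq> c ` V"
      using card_mono[of "c ` V" "{1..n + 1}"] V(1) by auto
    then obtain j where j: "j \<in> {1..n + 1}" "j \<notin> c ` V"
      by blast
    define \<sigma> where "\<sigma> = transpose j (n + 1)"
    have \<sigma>: "\<sigma> permutes {1..n + 1}"
      using j by (auto simp: \<sigma>_def intro!: permutes_swap_id)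
    have inv: "\<sigma> \<circ> \<sigma> = id"
      by (simp add: \<sigma>_def)
    let ?c = "compose V \<sigma> c"
    have "\<sigma> ` c ` V \<subseteq> {1..n}"
    proof
      fix y assume "y \<in> \<sigma> ` c ` V"
      then obtain x where x: "x \<in> c ` V" "y = \<sigma> x"
        by blast
      then have "x \<in> {1..n + 1}" "x \<noteq> j"
        using coloring_range[OF c] j by auto
      then show "y \<in> {1..n}"
        using j x(2) by (auto simp: \<sigma>_def transpose_def)
    qed
    then have c': "?c \<in> colorings V E n"
      using compose_colorings[OF V(2) c inj_on_subset[OF permutes_inj[OF \<sigma>] subset_UNIV]] by blast
    then have mem: "delta ?c \<in> coloring_space V E n"
      unfolding coloring_space_def free_space_def by (intro fs.span_base imageI)
    have "coloring_act V E (n + 1) \<sigma> (coloring_incl V E n (delta ?c)) = delta (compose V \<sigma> ?c)"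
      using coloring_act_delta[OF V(1) g_mem[OF \<sigma> c]] by (simp add: coloring_incl_eq[OF V(1) mem])
    also have "compose V \<sigma> ?c = c"
      using g_comp[OF \<sigma> \<sigma> c] g_id[OF c] inv by simp
    finally show ?thesis
      using \<sigma> mem by (metis (mono_tags, lifting) mem_Collect_eq)
  qed
  then have "delta ` colorings V E (n + 1) \<subseteq> ?S"
    by blast
  then show "coloring_space V E (n + 1) \<subseteq> fs.span ?S"
    unfolding coloring_space_def free_space_def by (rule fs.span_mono)
qed

theorem theorem3p3:
  fixes V :: "'v set" and E :: "'v set set"
  assumes "finite V" and "simple_graph V E"
  shows "representation_stable fscale (coloring_space V E) (coloring_act V E) (coloring_incl V E)
           (2 * card V)"
  unfolding representation_stable_def
proof (intro conjI allI impI)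
  show "consistent_sequence fscale (coloring_space V E) (coloring_act V E) (coloring_incl V E)"
    by (rule consistent_colorings[OF assms])
  show "inj_on (coloring_incl V E n) (coloring_space V E n)" for n
    using coloring_incl_eq[OF assms(1)] by (simp add: inj_on_def)
  show "fs.span {coloring_act V E (n + 1) \<sigma> (coloring_incl V E n v) |\<sigma> v.
      \<sigma> permutes {1..n + 1} \<and> v \<in> coloring_space V E n} = coloring_space V E (n + 1)"
    if "2 * card V \<le> n" for n
    using that by (intro colorings_orbit_surjective assms) simp
  show "\<exists>c. \<forall>n\<ge>1. 2 * card V \<le> n \<longrightarrow>
      multiplicities fscale n (coloring_space V E n) (coloring_act V E n) c"
    using multiplicities_colorings[OF assms] by blast
qed

end
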